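(* Let $\alpha>-\frac12$. The transform ${}^tV_{\alpha,q}$ is a linear isomorphism from $\mathcal{D}_q(\mathbb{R}_q)$ onto itself, and its inverse transform is given, for $f\in\mathcal{D}_q(\mathbb{R}_q)$, by $$({}^tV_{\alpha,q})^{-1}(f)(x)=({}^tR_{\alpha,q})^{-1}(f_e)(x)+\partial_q\big[({}^tR_{\alpha,q})^{-1}J_q(f_o)\big](x)\qquad\text{for all }x\in\mathbb{R}_q,$$ where $({}^tR_{\alpha,q})^{-1}$ is the inverse of ${}^tR_{\alpha,q}:\mathcal{D}_{*,q}(\mathbb{R}_q)\to\mathcal{D}_{*,q}(\mathbb{R}_q)$ and $J_q(f_o)(x)=\int_{-\infty}^{qx}f_o(t)\,d_qt$.
   Context: Standing assumptions: $q\in(0,1)$ and $\frac{\log(1-q)}{\log q}\in 2\mathbb{Z}$. Functions are complex-valued. $\mathbb{R}_q=\{\pm q^n: n\in\mathbb{Z}\}$; $f_e,f_o$ are the even and odd parts of $f$. Notation: $(a;q)_\infty=\prod_{k\ge0}(1-aq^k)$, $\Gamma_{q^2}(x)=\frac{(q^2;q^2)_\infty}{(q^{2x};q^2)_\infty}(1-q^2)^{1-x}$. $q$-Jackson integrals, for $a\in\{q^n:n\in\mathbb{Z}\}$: $\int_a^\infty f(x)d_qx=(1-q)a\sum_{n=-\infty}^{-1}q^nf(aq^n)$, $\int_{-\infty}^{-a}f(x)d_qx=\int_a^\infty f(-x)d_qx$, $\int_0^{a}f(x)d_qx=(1-q)a\sum_{n\ge0}q^nf(aq^n)$, $\int_{-\infty}^0f(x)d_qx=(1-q)\sum_{n\in\mathbb{Z}}q^nf(-q^n)$,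 and $\int_{-\infty}^a=\int_{-\infty}^0+\int_0^a$. For $z\neq0$, $\partial_q f(z)=\frac{f(q^{-1}z)+f(-q^{-1}z)-f(qz)+f(-qz)-2f(-z)}{2(1-q)z}$. $\mathcal{E}_q(\mathbb{R}_q)$ is the space of functions $f$ on $\mathbb{R}_q$ such that for all $n\in\mathbb{N}$, $a\ge0$, $\sup\{|\partial_q^kf(x)|:0\le k\le n,\ x\in[-a,a]\cap\mathbb{R}_q\}<\infty$ and $\lim_{x\to0,x\in\mathbb{R}_q}\partial_q^nf(x)$ exists. $\mathcal{D}_q(\mathbb{R}_q)$ is the space of $f\in\mathcal{E}_q(\mathbb{R}_q)$ with compact support, i.e. vanishing for $|x|$ large; $\mathcal{D}_{*,q}(\mathbb{R}_q)$ is its subspace of even functions. $W_\alpha(t;q^2)=\frac{(t^2q^2;q^2)_\infty}{(t^2q^{2\alpha+1};q^2)_\infty}$. $q$-Weyl operator: for $f\in\mathcal{D}_{*,q}(\mathbb{R}_q)$, ${}^tR_{\alpha,q}(f)(t)=\frac{(1+q)^{-\alpha+\frac12}}{\Gamma_{q^2}(\alpha+\frac12)}\int_{q|t|}^{+\infty}W_\alpha\left(\frac tx;q^2\right)f(x)x^{2\alpha}d_qx$, $t\in\mathbb{R}_q$. It is an isomorphism from $\mathcal{D}_{*,q}(\mathbb{R}_q)$ onto itself, so its inverse makes sense. Dual intertwining operator: for $f\in\mathcal{D}_q(\mathbb{R}_q)$, $t\in\mathbb{R}_q$, $${}^tV_{\alpha,q}(f)(t)=\frac{(1+q)^{-\alpha+\frac12}}{2\Gamma_{q^2}(\alpha+\frac12)}\int_{|x|\ge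 q|t|}W_\alpha\!\left(\tfrac tx;q^2\right)\left(1+\tfrac tx\right)f(x)|x|^{2\alpha}d_qx,$$ where $\int_{|x|\ge q|t|}g(x)d_qx=\int_{q|t|}^\infty[g(x)+g(-x)]d_qx$ (by the convention above, the sums run over points with $|x|\ge|t|$). *)

theory Defs
  imports "HOL-Analysis.Analysis"
begin

text \<open>
  A complex function on the countable set \<open>Rq q\<close> is represented by a function of type
  \<open>real \<Rightarrow> complex\<close> that is \<open>0\<close> outside \<open>Rq q\<close>.  This makes the representation unique, so that
  bijections between function spaces and their inverses have the intended meaning.
\<close>

definition Rq :: "real \<Rightarrow> real set" where
  "Rq q = {x. \<exists>n::int. x = q powi n \<or> x = - (q powi n)}"

definition even_part :: "(real \<Rightarrow> complex) \<Rightarrow> real \<Rightarrow> complex" where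
  "even_part f x = (f x + f (- x)) / 2"

definition odd_part :: "(real \<Rightarrow> complex) \<Rightarrow> real \<Rightarrow> complex" where
  "odd_part f x = (f x - f (- x)) / 2"

definition qpoch_inf :: "real \<Rightarrow> real \<Rightarrow> real" where
  "qpoch_inf a q = (\<Prod>k. 1 - a * q ^ k)"

text \<open>\<open>Gamma_q2 q\<close> is the \<open>q\<close>-Gamma function with base \<open>q\<^sup>2\<close>.\<close>

definition Gamma_q2 :: "real \<Rightarrow> real \<Rightarrow> real" where
  "Gamma_q2 q x =
     qpoch_inf (q\<^sup>2) (q\<^sup>2) / qpoch_inf (q powr (2 * x)) (q\<^sup>2) * (1 - q\<^sup>2) powr (1 - x)"

text \<open>
  Jackson integrals over \<open>[a, \<infinity>)\<close>, \<open>(-\<infinity>, -a]\<close>, \<open>[0, a]\<close>, \<open>(-\<infinity>, 0]\<close> and \<open>(-\<infinity>, b]\<close>, where \<open>a\<close>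
  and \<open>\<bar>b\<bar>\<close> are powers of \<open>q\<close>.  The sum defining the first one contains only points \<open>\<ge> a / q\<close>.
\<close>

definition jackson_Ici :: "real \<Rightarrow> real \<Rightarrow> (real \<Rightarrow> complex) \<Rightarrow> complex" where
  "jackson_Ici q a f =
     of_real ((1 - q) * a) * (\<Sum>\<^sub>\<infinity>n\<in>{..-1::int}. of_real (q powi n) * f (a * q powi n))"

definition jackson_Iic_neg :: "real \<Rightarrow> real \<Rightarrow> (real \<Rightarrow> complex) \<Rightarrow> complex" where
  "jackson_Iic_neg q a f = jackson_Ici q a (\<lambda>x. f (- x))"

definition jackson_0_to :: "real \<Rightarrow> real \<Rightarrow> (real \<Rightarrow> complex) \<Rightarrow> complex" where
  "jackson_0_to q a f =
     of_real ((1 - q) * a) * (\<Sum>\<^sub>\<infinity>n\<in>{0::int..}. of_real (q powi n) * f (a * q powi n))"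

definition jackson_Iic_0 :: "real \<Rightarrow> (real \<Rightarrow> complex) \<Rightarrow> complex" where
  "jackson_Iic_0 q f =
     of_real (1 - q) * (\<Sum>\<^sub>\<infinity>n\<in>(UNIV::int set). of_real (q powi n) * f (- (q powi n)))"

definition jackson_Iic :: "real \<Rightarrow> real \<Rightarrow> (real \<Rightarrow> complex) \<Rightarrow> complex" where
  "jackson_Iic q b f =
     (if b < 0 then jackson_Iic_neg q (- b) f else jackson_Iic_0 q f + jackson_0_to q b f)"

text \<open>
  Rubin's \<open>q\<close>-derivative.  On \<open>Rq q\<close> it only involves values of \<open>f\<close> on \<open>Rq q\<close>, and it maps
  functions vanishing outside \<open>Rq q\<close> to functions vanishing outside \<open>Rq q\<close> (division by zero
  gives \<open>0\<close> at the origin).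
\<close>

definition dq :: "real \<Rightarrow> (real \<Rightarrow> complex) \<Rightarrow> real \<Rightarrow> complex" where
  "dq q f z =
     (f (inverse q * z) + f (- (inverse q * z)) - f (q * z) + f (- (q * z)) - 2 * f (- z))
       / of_real (2 * (1 - q) * z)"

definition Eq_space :: "real \<Rightarrow> (real \<Rightarrow> complex) set" where
  "Eq_space q = {f. (\<forall>x. x \<notin> Rq q \<longrightarrow> f x = 0) \<and>
     (\<forall>(n::nat) (a::real). a \<ge> 0 \<longrightarrow>
        bdd_above {cmod ((dq q ^^ k) f x) |k x. k \<le> n \<and> x \<in> {-a..a} \<inter> Rq q}) \<and>
     (\<forall>n::nat. \<exists>L. ((dq q ^^ n) f \<longlongrightarrow> L) (at 0 within Rq q))}"

definition Dq_space :: "real \<Rightarrow> (real \<Rightarrow> complex) set" where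
  "Dq_space q = {f \<in> Eq_space q. \<exists>M. \<forall>x\<in>Rq q. \<bar>x\<bar> > M \<longrightarrow> f x = 0}"

definition Dq_even_space :: "real \<Rightarrow> (real \<Rightarrow> complex) set" where
  "Dq_even_space q = {f \<in> Dq_space q. \<forall>x. f (- x) = f x}"

definition W_kernel :: "real \<Rightarrow> real \<Rightarrow> real \<Rightarrow> real" where
  "W_kernel \<alpha> q t =
     qpoch_inf (t\<^sup>2 * q\<^sup>2) (q\<^sup>2) / qpoch_inf (t\<^sup>2 * q powr (2 * \<alpha> + 1)) (q\<^sup>2)"

definition q_Weyl :: "real \<Rightarrow> real \<Rightarrow> (real \<Rightarrow> complex) \<Rightarrow> real \<Rightarrow> complex" where
  "q_Weyl \<alpha> q f t =
     (if t \<in> Rq q then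
        of_real ((1 + q) powr (- \<alpha> + 1/2) / Gamma_q2 q (\<alpha> + 1/2)) *
        jackson_Ici q (q * \<bar>t\<bar>) (\<lambda>x. of_real (W_kernel \<alpha> q (t / x)) * f x * of_real (x powr (2 * \<alpha>)))
      else 0)"

definition jackson_abs_ge :: "real \<Rightarrow> real \<Rightarrow> (real \<Rightarrow> complex) \<Rightarrow> complex" where
  "jackson_abs_ge q a g = jackson_Ici q a (\<lambda>x. g x + g (- x))"

definition dual_intertwining :: "real \<Rightarrow> real \<Rightarrow> (real \<Rightarrow> complex) \<Rightarrow> real \<Rightarrow> complex" where
  "dual_intertwining \<alpha> q f t =
     (if t \<in> Rq q then
        of_real ((1 + q) powr (- \<alpha> + 1/2) / (2 * Gamma_q2 q (\<alpha> + 1/2))) *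
        jackson_abs_ge q (q * \<bar>t\<bar>)
          (\<lambda>x. of_real (W_kernel \<alpha> q (t / x)) * of_real (1 + t / x) * f x * of_real (\<bar>x\<bar> powr (2 * \<alpha>)))
      else 0)"

definition J_op :: "real \<Rightarrow> (real \<Rightarrow> complex) \<Rightarrow> real \<Rightarrow> complex" where
  "J_op q f x = (if x \<in> Rq q then jackson_Iic q (q * x) f else 0)"

definition complex_function_subspace :: "(real \<Rightarrow> complex) set \<Rightarrow> bool" where
  "complex_function_subspace V \<longleftrightarrow>
     (\<lambda>x. 0) \<in> V \<and>
     (\<forall>f\<in>V. \<forall>g\<in>V. (\<lambda>x. f x + g x) \<in> V) \<and>
     (\<forall>(c::complex). \<forall>f\<in>V. (\<lambda>x. c * f x) \<in> V)"

definition linear_isomorphism_on ::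
  "(real \<Rightarrow> complex) set \<Rightarrow> (real \<Rightarrow> complex) set \<Rightarrow>
   ((real \<Rightarrow> complex) \<Rightarrow> real \<Rightarrow> complex) \<Rightarrow> bool" where
  "linear_isomorphism_on V W T \<longleftrightarrow>
     complex_function_subspace V \<and> complex_function_subspace W \<and>
     (\<forall>f\<in>V. \<forall>g\<in>V. T (\<lambda>x. f x + g x) = (\<lambda>x. T f x + T g x)) \<and>
     (\<forall>(c::complex). \<forall>f\<in>V. T (\<lambda>x. c * f x) = (\<lambda>x. c * T f x)) \<and>
     bij_betw T V W"

end

theory Submission
  imports Defs
begin

text \<open>
  Put \<open>Q = q\<^sup>2\<close> and \<open>p = q powr (2 * \<alpha> + 1)\<close>, and encode an even function \<open>f\<close> supported in
  \<open>\<bar>x\<bar> \<le> q powi (- K)\<close> by the power series \<open>U\<close> with coefficients \<open>f (q powi (n - K))\<close>.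

  A function on \<open>Rq q\<close> lies in \<open>Eq_space q\<close> iff it has a Taylor expansion of every order at \<open>0\<close>;
  for even \<open>f\<close> this says that \<open>(1 - X) (1 - Q X) \<dots> (1 - Q\<^bsup>N-1\<^esup> X) U\<close> has coefficients
  \<open>O(Q\<^bsup>N n\<^esup>)\<close> for every \<open>N\<close>, since these factors annihilate the first \<open>N\<close> even monomials.
  By the \<open>q\<close>-binomial theorem the Weyl operator maps \<open>U\<close> to a constant times
  \<open>(pX; Q)\<^sub>\<infinity> / (X; Q)\<^sub>\<infinity> \<cdot> U(pX)\<close>.  It is inverted by the reciprocal product, and both products
  preserve the growth condition because they can be split after finitely many factors.

  On even functions the dual operator is the Weyl operator \<open>R\<close>.  If \<open>g\<close> is even, it maps \<open>dq q g\<close> to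
  \<open>dq q (R g)\<close>, and \<open>J_op\<close> inverts \<open>dq\<close> from even to odd functions.  Hence it equals
  \<open>dq q \<circ> R \<circ> J_op q\<close> on odd functions, which is inverted by \<open>dq q \<circ> R\<^sup>-\<^sup>1 \<circ> J_op q\<close>.
\<close>

unbundle no vec_syntax and fps_syntax

subsection \<open>Geometric growth of power series coefficients\<close>

text \<open>Indexing the grid inward from the edge of the support makes an integral outward from a
  grid point a finite sum. As the Weyl kernel depends on \<open>t / x\<close> alone, this sum is a
  Cauchy product, and inversion becomes algebra of formal series. The analytic question is whether
  smoothness at 0 survives. Decay of the coefficients by itself does not: those of the kernel series
  tend to a non-zero constant, so multiplying by it destroys any decay. What survives is the list of
  geometric rates present in the coefficients. The weight changes the rates \<open>Q ^ i\<close> of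
  \<open>U\<close> into \<open>p * Q ^ i\<close>; the numerator factors of the kernel series
  annihilate exactly these, and its denominator factors put the rates \<open>Q ^ i\<close> back. For
  odd functions the kernel series carries an additional dilation by \<open>q\<close>. Conjugation by
  \<open>dq\<close> removes it, because the quotient of infinite products satisfies a first-order
  \<open>q\<close>-difference equation; this is the reason for the detour through a
  primitive.\<close>

definition lin :: "real \<Rightarrow> complex fps" where
  "lin c = 1 - fps_const (of_real c) * fps_X"

lemma lin_mult_nth:
  "(lin c * U) $ n = U $ n - (if n = 0 then 0 else of_real c * U $ (n - 1))"
  by (simp add: lin_def left_diff_distrib mult.assoc)

lemma lin_nth_0 [simp]: "lin c $ 0 = 1"
  by (simp add: lin_def)

lemma lin_nonzero [simp]: "lin c \<noteq> 0"
proof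
  assume "lin c = 0"
  then have "lin c $ 0 = 0" by simp
  then show False by (simp add: lin_def)
qed

text \<open>This substitutes \<open>r * X\<close> for the variable. On the grid, multiplying a
  function by \<open>\<bar>x\<bar> powr s\<close> is dilation by \<open>q powr s\<close> up to a
  constant, so the weight of the Weyl integral and the division by the variable in \<open>dq\<close>
  both appear as dilations.\<close>

definition dilate :: "real \<Rightarrow> complex fps \<Rightarrow> complex fps" where
  "dilate r U = Abs_fps (\<lambda>n. of_real r ^ n * U $ n)"

lemma dilate_nth [simp]: "dilate r U $ n = of_real r ^ n * U $ n"
  by (simp add: dilate_def)

lemma dilate_mult: "dilate r (U * V) = dilate r U * dilate r V"
proof (rule fps_ext)
  fix n
  have *: "of_real r ^ i * U $ i * (of_real r ^ (n - i) * V $ (n - i))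
      = of_real r ^ n * (U $ i * V $ (n - i))" if "i \<le> n" for i
  proof -
    have "complex_of_real r ^ n = of_real r ^ i * of_real r ^ (n - i)"
      using that by (simp flip: power_add)
    then show ?thesis by simp
  qed
  then show "dilate r (U * V) $ n = (dilate r U * dilate r V) $ n"
    unfolding dilate_nth fps_mult_nth sum_distrib_left by (intro sum.cong refl, subst *) auto
qed

lemma dilate_dilate: "dilate r (dilate s U) = dilate (r * s) U"
  by (rule fps_ext) (simp add: power_mult_distrib)

lemma dilate_1 [simp]: "dilate 1 U = U"
  by (rule fps_ext) simp

lemma dilate_lin: "dilate r (lin c) = lin (r * c)"
  by (rule fps_ext) (auto simp: lin_def fps_X_def)

lemma dilate_prod_lin:
  "dilate r (\<Prod>i<(N::nat). lin (c i)) = (\<Prod>i<N. lin (r * c i))"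
  by (induction N) (auto simp: dilate_mult dilate_lin intro: fps_ext)

text \<open>For coefficients that are values at grid points, the rate \<open>\<rho> = Q ^ N\<close>
  means a bound by a multiple of \<open>\<bar>x\<bar> ^ (2 * N)\<close>.\<close>

definition geo_bounded :: "real \<Rightarrow> complex fps \<Rightarrow> bool" where
  "geo_bounded \<rho> U \<longleftrightarrow> (\<exists>C. \<forall>n. cmod (U $ n) \<le> C * \<rho> ^ n)"

lemma geo_boundedE:
  assumes "geo_bounded \<rho> U" "0 < \<rho>"
  obtains C where "C \<ge> 0" "\<And>n. cmod (U $ n) \<le> C * \<rho> ^ n"
proof -
  obtain C where C: "\<And>n. cmod (U $ n) \<le> C * \<rho> ^ n"
    using assms by (auto simp: geo_bounded_def)
  have "C \<ge> 0" using order_trans[OF norm_ge_zero C[of 0]] by simp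
  then show ?thesis using C that by blast
qed

lemma geo_bounded_add:
  assumes "geo_bounded \<rho> U" "geo_bounded \<rho> V"
  shows "geo_bounded \<rho> (U + V)"
proof -
  obtain C D where "\<And>n. cmod (U $ n) \<le> C * \<rho> ^ n" "\<And>n. cmod (V $ n) \<le> D * \<rho> ^ n"
    using assms by (auto simp: geo_bounded_def)
  then have "cmod ((U + V) $ n) \<le> (C + D) * \<rho> ^ n" for n
    using norm_triangle_ineq[of "U $ n" "V $ n"]
    by (smt (verit) distrib_right fps_add_nth)
  then show ?thesis by (auto simp: geo_bounded_def)
qed

lemma geo_bounded_scale:
  assumes "geo_bounded \<rho> U"
  shows "geo_bounded \<rho> (fps_const c * U)"
proof -
  obtain C where "\<And>n. cmod (U $ n) \<le> C * \<rho> ^ n"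
    using assms by (auto simp: geo_bounded_def)
  then have "cmod ((fps_const c * U) $ n) \<le> (cmod c * C) * \<rho> ^ n" for n
    by (simp add: norm_mult mult.assoc mult_left_mono)
  then show ?thesis by (auto simp: geo_bounded_def)
qed

lemma geo_bounded_sum:
  assumes "\<And>i. i \<in> A \<Longrightarrow> geo_bounded \<rho> (U i)"
  shows "geo_bounded \<rho> (\<Sum>i\<in>A. U i)"
  using assms
proof (induction A rule: infinite_finite_induct)
  case empty
  show ?case by (auto simp: geo_bounded_def intro!: exI[of _ 0])
next
  case (infinite A)
  then show ?case by (auto simp: geo_bounded_def intro!: exI[of _ 0])
qed (auto intro: geo_bounded_add)

lemma geo_bounded_1: "0 < \<rho> \<Longrightarrow> geo_bounded \<rho> 1"
  by (auto simp: geo_bounded_def intro!: exI[of _ 1])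

lemma geo_bounded_lin:
  assumes "geo_bounded \<rho> U" "0 < \<rho>"
  shows "geo_bounded \<rho> (lin c * U)"
proof -
  obtain C where C: "C \<ge> 0" "\<And>n. cmod (U $ n) \<le> C * \<rho> ^ n"
    using geo_boundedE[OF assms] by blast
  have "cmod ((lin c * U) $ n) \<le> (C + \<bar>c\<bar> * C / \<rho>) * \<rho> ^ n" for n
  proof (cases n)
    case 0
    then show ?thesis using C(1) C(2)[of 0] assms by (simp add: lin_mult_nth add_increasing2)
  next
    case (Suc m)
    have "cmod ((lin c * U) $ n) \<le> cmod (U $ n) + \<bar>c\<bar> * cmod (U $ m)"
      using norm_triangle_ineq4[of "U $ n" "of_real c * U $ m"]
      by (simp add: lin_mult_nth Suc norm_mult)
    also have "\<dots> \<le> C * \<rho> ^ n + \<bar>c\<bar> * (C * \<rho> ^ m)"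
      by (intro add_mono mult_left_mono C) auto
    also have "\<dots> = (C + \<bar>c\<bar> * C / \<rho>) * \<rho> ^ n"
      using assms Suc by (simp add: field_simps)
    finally show ?thesis .
  qed
  then show ?thesis by (auto simp: geo_bounded_def)
qed

lemma geo_bounded_prod_lin:
  assumes "geo_bounded \<rho> U" "0 < \<rho>"
  shows "geo_bounded \<rho> ((\<Prod>i\<in>A. lin (c i)) * U)"
  using assms
  by (induction A rule: infinite_finite_induct) (auto simp: mult.assoc geo_bounded_lin)

text \<open>Convolution against the larger rate leaves a geometric series of ratio
  \<open>\<rho> / \<sigma>\<close>; with equal rates a factor \<open>n + 1\<close> would remain,
  hence the strict inequality.\<close>

lemma geo_bounded_mult:
  assumes U: "geo_bounded \<sigma> U" and V: "geo_bounded \<rho> V" and \<rho>: "0 < \<rho>" "\<rho> < \<sigma>"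
  shows "geo_bounded \<sigma> (U * V)"
proof -
  have \<sigma>: "0 < \<sigma>" using \<rho> by simp
  obtain C where C: "C \<ge> 0" "\<And>n. cmod (U $ n) \<le> C * \<sigma> ^ n"
    using geo_boundedE[OF U \<sigma>] by blast
  obtain D where D: "D \<ge> 0" "\<And>n. cmod (V $ n) \<le> D * \<rho> ^ n"
    using geo_boundedE[OF V \<rho>(1)] by blast
  have r: "0 \<le> \<rho> / \<sigma>" "\<rho> / \<sigma> < 1" using \<rho> by auto
  have "cmod ((U * V) $ n) \<le> (C * D / (1 - \<rho> / \<sigma>)) * \<sigma> ^ n" for n
  proof -
    have "cmod ((U * V) $ n) \<le> (\<Sum>i\<le>n. cmod (V $ i) * cmod (U $ (n - i)))"
      using norm_sum[of "\<lambda>i. V $ i * U $ (n - i)" "{..n}"]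
      by (simp add: mult.commute[of U V] fps_mult_nth atMost_atLeast0 norm_mult)
    also have "\<dots> \<le> (\<Sum>i\<le>n. (D * \<rho> ^ i) * (C * \<sigma> ^ (n - i)))"
      by (intro sum_mono mult_mono C D) (use C D \<rho> \<sigma> in auto)
    also have "\<dots> = (\<Sum>i\<le>n. C * D * \<sigma> ^ n * (\<rho> / \<sigma>) ^ i)"
      using \<sigma> by (intro sum.cong) (auto simp: power_diff power_divide)
    also have "\<dots> = C * D * \<sigma> ^ n * (\<Sum>i<Suc n. (\<rho> / \<sigma>) ^ i)"
      by (simp add: sum_distrib_left lessThan_Suc_atMost)
    also have "\<dots> \<le> C * D * \<sigma> ^ n * (1 / (1 - \<rho> / \<sigma>))"
    proof (intro mult_left_mono)
      have "(\<Sum>i<Suc n. (\<rho> / \<sigma>) ^ i) \<le> (\<Sum>i. (\<rho> / \<sigma>) ^ i)"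
        using r by (intro sum_le_suminf summable_geometric) auto
      then show "(\<Sum>i<Suc n. (\<rho> / \<sigma>) ^ i) \<le> 1 / (1 - \<rho> / \<sigma>)"
        using r by (subst (asm) suminf_geometric) auto
    qed (use C D \<sigma> in auto)
    finally show ?thesis by simp
  qed
  then show ?thesis unfolding geo_bounded_def by blast
qed

lemma geo_bounded_dilate:
  assumes "geo_bounded \<rho> U" "0 < r"
  shows "geo_bounded (r * \<rho>) (dilate r U)"
proof -
  obtain C where C: "\<And>n. cmod (U $ n) \<le> C * \<rho> ^ n"
    using assms by (auto simp: geo_bounded_def)
  have "cmod (dilate r U $ n) \<le> C * (r * \<rho>) ^ n" for n
    using mult_left_mono[OF C[of n], of "r ^ n"] assms(2)
    by (simp add: norm_mult norm_power power_mult_distrib mult_ac)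
  then show ?thesis by (auto simp: geo_bounded_def)
qed

text \<open>The reciprocal of \<open>lin c\<close>. For \<open>c = Q ^ j\<close> its coefficients
  are, up to scaling, the values of \<open>x ^ (2 * j)\<close> on the grid.\<close>

definition geo :: "real \<Rightarrow> complex fps" where
  "geo c = Abs_fps (\<lambda>n. of_real c ^ n)"

lemma geo_nth [simp]: "geo c $ n = of_real c ^ n"
  by (simp add: geo_def)

lemma lin_geo: "lin c * geo c = 1"
  by (rule fps_ext) (auto simp: lin_mult_nth simp flip: power_Suc)

text \<open>Partial fractions: after multiplication by \<open>lin a * lin b\<close>, which may be
  cancelled, both sides become 1.\<close>

lemma geo_mult_geo:
  assumes "a \<noteq> b"
  shows "geo a * geo b = fps_const (of_real (a / (a - b))) * geo a + fps_const (of_real (b / (b - a))) * geo b"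
    (is "_ = ?R")
proof -
  have lin_a: "lin b = fps_const (1 - of_real (b / a)) + fps_const (of_real (b / a)) * lin a" if "a \<noteq> 0"
    using that by (simp add: lin_def fps_eq_iff)
  have "lin a * (lin b * ?R) =
      fps_const (of_real (a / (a - b))) * lin b * (lin a * geo a)
      + fps_const (of_real (b / (b - a))) * lin a * (lin b * geo b)"
    by (simp add: algebra_simps)
  also have "\<dots> = fps_const (of_real (a / (a - b))) * lin b + fps_const (of_real (b / (b - a))) * lin a"
    by (simp only: lin_geo mult_1_right)
  also have "\<dots> = 1"
  proof (rule fps_ext)
    fix n
    have "b / (b - a) = - (b / (a - b))"
      by (metis minus_diff_eq minus_divide_right)
    then have 1: "a / (a - b) + b / (b - a) = 1" and 2: "a / (a - b) * b + b / (b - a) * a = 0"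
      using assms by (simp_all flip: diff_divide_distrib)
    have "complex_of_real (a / (a - b)) + of_real (b / (b - a)) = 1"
      "complex_of_real (a / (a - b)) * of_real b + of_real (b / (b - a)) * of_real a = 0"
      using 1 2 by (metis of_real_add of_real_1, metis of_real_add of_real_mult of_real_0)
    then show "(fps_const (of_real (a / (a - b))) * lin b + fps_const (of_real (b / (b - a))) * lin a) $ n = (1 :: complex fps) $ n"
      by (auto simp: lin_def fps_X_def algebra_simps simp del: of_real_divide of_real_diff)
  qed
  also have "\<dots> = lin a * (lin b * (geo a * geo b))"
    using lin_geo[of a] lin_geo[of b] by (metis (no_types, lifting) mult.assoc mult.commute mult_1_right)
  finally show ?thesis by simp
qed

text \<open>Dividing by \<open>lin \<mu>\<close> gives \<open>\<mu> ^ n\<close> times the partial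
  sums of \<open>r $ m / \<mu> ^ m\<close>. The full sum exists because
  \<open>\<rho> < \<mu>\<close> and contributes the multiple of \<open>geo \<mu>\<close>; the
  remaining tail has rate \<open>\<rho>\<close>.\<close>

lemma geo_mult_geo_bounded:
  assumes r: "geo_bounded \<rho> r" and \<rho>: "0 < \<rho>" "\<rho> < \<mu>"
  shows "\<exists>L. geo_bounded \<rho> (geo \<mu> * r - fps_const L * geo \<mu>)"
proof -
  obtain C where C: "C \<ge> 0" "\<And>n. cmod (r $ n) \<le> C * \<rho> ^ n"
    using geo_boundedE[OF r \<rho>(1)] by blast
  define s where "s m = r $ m / of_real \<mu> ^ m" for m
  have x: "0 < \<rho> / \<mu>" "\<rho> / \<mu> < 1" "\<mu> > 0" "norm (\<rho> / \<mu>) < 1" using \<rho> by auto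
  have s_le: "cmod (s m) \<le> C * (\<rho> / \<mu>) ^ m" for m
    using C(2)[of m] x(3) by (simp add: s_def norm_divide norm_power power_divide divide_right_mono)
  have geo_sum: "(\<lambda>m. C * (\<rho> / \<mu>) ^ m) sums (C * (1 / (1 - \<rho> / \<mu>)))"
    using x by (intro sums_mult geometric_sums) auto
  have sn: "summable (\<lambda>m. norm (s m))"
    by (rule summable_comparison_test'[OF sums_summable[OF geo_sum]]) (use s_le in auto)
  then have ss: "summable s" by (rule summable_norm_cancel)
  \<comment> \<open>This is the series \<open>r\<close> evaluated at
    \<open>1 / \<mu>\<close>.\<close>
  define L where "L = (\<Sum>m. s m)"
  have "cmod ((geo \<mu> * r - fps_const L * geo \<mu>) $ n) \<le> (C / (1 - \<rho> / \<mu>)) * \<rho> ^ n" for n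
  proof -
    have "(geo \<mu> * r) $ n = (\<Sum>i\<le>n. r $ i * of_real \<mu> ^ (n - i))"
      by (simp add: mult.commute[of "geo \<mu>"] fps_mult_nth atMost_atLeast0)
    also have "\<dots> = of_real \<mu> ^ n * (\<Sum>i<Suc n. s i)"
      unfolding sum_distrib_left lessThan_Suc_atMost
      using x by (intro sum.cong) (auto simp: s_def power_diff)
    finally have "(geo \<mu> * r - fps_const L * geo \<mu>) $ n = - (of_real \<mu> ^ n * (L - (\<Sum>i<Suc n. s i)))"
      by (simp add: algebra_simps)
    also have "L - (\<Sum>i<Suc n. s i) = (\<Sum>m. s (m + Suc n))"
      using suminf_split_initial_segment[OF ss, of "Suc n"] by (simp add: L_def)
    finally have e: "cmod ((geo \<mu> * r - fps_const L * geo \<mu>) $ n) = \<mu> ^ n * cmod (\<Sum>m. s (m + Suc n))"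
      using x by (simp add: norm_mult norm_power)
    have "cmod (\<Sum>m. s (m + Suc n)) \<le> (\<Sum>m. norm (s (m + Suc n)))"
      using sn by (intro summable_norm summable_ignore_initial_segment)
    also have "\<dots> \<le> (\<Sum>m. (\<rho> / \<mu>) ^ Suc n * (C * (\<rho> / \<mu>) ^ m))"
    proof (intro suminf_le summable_mult[OF sums_summable[OF geo_sum]] summable_ignore_initial_segment[OF sn])
      show "norm (s (m + Suc n)) \<le> (\<rho> / \<mu>) ^ Suc n * (C * (\<rho> / \<mu>) ^ m)" for m
        using s_le[of "m + Suc n"] by (simp only: power_add mult_ac)
    qed
    also have "\<dots> = (\<rho> / \<mu>) ^ Suc n * (C / (1 - \<rho> / \<mu>))"
      using sums_unique[OF sums_mult[OF geo_sum, of "(\<rho> / \<mu>) ^ Suc n"]] by (simp only: mult_1_right times_divide_eq_right)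
    also have "\<dots> \<le> (\<rho> / \<mu>) ^ n * (C / (1 - \<rho> / \<mu>))"
      using x C by (intro mult_right_mono power_decreasing) auto
    finally have "\<mu> ^ n * cmod (\<Sum>m. s (m + Suc n)) \<le> \<mu> ^ n * ((\<rho> / \<mu>) ^ n * (C / (1 - \<rho> / \<mu>)))"
      using x by (intro mult_left_mono) auto
    also have "\<dots> = (C / (1 - \<rho> / \<mu>)) * \<rho> ^ n"
      using x by (simp add: power_divide)
    finally show ?thesis using e by simp
  qed
  then show ?thesis unfolding geo_bounded_def by blast
qed

text \<open>The factors are divided out one at a time. The induction hypothesis expands
  \<open>lin (c N) * U\<close>; division by \<open>lin (c N)\<close> keeps the remainder at rate
  \<open>\<rho>\<close> up to a multiple of \<open>geo (c N)\<close>, and partial fractions, which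
  require distinct rates, split the products \<open>geo (c i) * geo (c N)\<close>.\<close>

lemma geo_expansion:
  assumes "geo_bounded \<rho> ((\<Prod>i<(N::nat). lin (c i)) * U)" "0 < \<rho>" "\<And>i. i < N \<Longrightarrow> \<rho> < c i"
    "inj_on c {..<N}"
  shows "\<exists>a. geo_bounded \<rho> (U - (\<Sum>i<N. fps_const (a i) * geo (c i)))"
  using assms
proof (induction N arbitrary: U)
  case 0
  then show ?case by simp
next
  case (Suc N)
  have "\<exists>a. geo_bounded \<rho> (lin (c N) * U - (\<Sum>i<N. fps_const (a i) * geo (c i)))"
    using Suc.prems by (intro Suc.IH) (auto simp: mult.assoc intro: inj_on_subset)
  then obtain a where a: "geo_bounded \<rho> (lin (c N) * U - (\<Sum>i<N. fps_const (a i) * geo (c i)))"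
    (is "geo_bounded \<rho> ?r") by blast
  obtain L where L: "geo_bounded \<rho> (geo (c N) * ?r - fps_const L * geo (c N))"
    using geo_mult_geo_bounded[OF a] Suc.prems by blast
  have ne: "c i \<noteq> c N" if "i < N" for i
    using Suc.prems(4) that by (auto simp: inj_on_def)
  define b where "b i = a i * of_real (c i / (c i - c N))" for i
  \<comment> \<open>\<open>d\<close> collects all contributions to \<open>geo (c N)\<close>: one
    from the remainder and one from each partial fraction.\<close>
  define d where "d = L + (\<Sum>i<N. a i * of_real (c N / (c N - c i)))"
  have "geo (c N) * ?r = U - (\<Sum>i<N. fps_const (a i) * (geo (c i) * geo (c N)))"
  proof -
    have "geo (c N) * (lin (c N) * U) = U"
      using lin_geo[of "c N"] by (metis mult.assoc mult.commute mult_1_left)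
    then show ?thesis
      by (simp add: right_diff_distrib sum_distrib_left mult_ac)
  qed
  also have "\<dots> = U - (\<Sum>i<N. fps_const (b i) * geo (c i))
     - (\<Sum>i<N. fps_const (a i * of_real (c N / (c N - c i)))) * geo (c N)"
  proof -
    have "fps_const (a i) * (geo (c i) * geo (c N)) = fps_const (b i) * geo (c i)
       + fps_const (a i * of_real (c N / (c N - c i))) * geo (c N)" if "i < N" for i
      unfolding geo_mult_geo[OF ne[OF that]] b_def
      by (simp add: distrib_left flip: mult.assoc)
    then have "(\<Sum>i<N. fps_const (a i) * (geo (c i) * geo (c N))) = (\<Sum>i<N. fps_const (b i) * geo (c i)
       + fps_const (a i * of_real (c N / (c N - c i))) * geo (c N))"
      by (intro sum.cong) auto
    then show ?thesis
      by (simp only: sum.distrib sum_distrib_right diff_diff_eq)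
  qed
  also have "(\<Sum>i<N. fps_const (a i * of_real (c N / (c N - c i)))) = fps_const (d - L)"
    by (rule fps_ext) (auto simp: d_def fps_sum_nth)
  finally have "geo (c N) * ?r - fps_const L * geo (c N)
     = U - (\<Sum>i<Suc N. fps_const ((b(N := d)) i) * geo (c i))"
    by (simp add: algebra_simps flip: fps_const_sub)
  then show ?case using L by metis
qed

text \<open>Each \<open>geo (c i)\<close> is cancelled by the factor \<open>lin (c i)\<close>; what
  is left is a polynomial, which is bounded at any positive rate.\<close>

lemma geo_bounded_of_expansion:
  assumes "geo_bounded \<rho> (U - (\<Sum>i<(N::nat). fps_const (a i) * geo (c i)))" "0 < \<rho>"
  shows "geo_bounded \<rho> ((\<Prod>i<N. lin (c i)) * U)"
proof -
  let ?P = "\<Prod>i<N. lin (c i)"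
  have "geo_bounded \<rho> (?P * (fps_const (a i) * geo (c i)))" if "i < N" for i
  proof -
    have "?P = lin (c i) * (\<Prod>j\<in>{..<N} - {i}. lin (c j))"
      using that by (intro prod.remove) auto
    then have "?P * (fps_const (a i) * geo (c i))
        = fps_const (a i) * ((\<Prod>j\<in>{..<N} - {i}. lin (c j)) * (lin (c i) * geo (c i)))"
      by (simp only: mult_ac)
    moreover have "geo_bounded \<rho> ((\<Prod>j\<in>{..<N} - {i}. lin (c j)) * (lin (c i) * geo (c i)))"
      unfolding lin_geo by (intro geo_bounded_prod_lin geo_bounded_1 assms(2))
    ultimately show ?thesis
      by (simp only: geo_bounded_scale)
  qed
  then have "geo_bounded \<rho> (\<Sum>i<N. ?P * (fps_const (a i) * geo (c i)))"
    by (intro geo_bounded_sum) auto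
  moreover have "geo_bounded \<rho> (?P * (U - (\<Sum>i<N. fps_const (a i) * geo (c i))))"
    by (rule geo_bounded_prod_lin[OF assms])
  ultimately have "geo_bounded \<rho> (?P * (U - (\<Sum>i<N. fps_const (a i) * geo (c i)))
      + (\<Sum>i<N. ?P * (fps_const (a i) * geo (c i))))"
    by (intro geo_bounded_add)
  then show ?thesis
    by (simp only: right_diff_distrib sum_distrib_left diff_add_cancel)
qed

subsection \<open>The \<open>q\<close>-binomial series\<close>

text \<open>The series of \<open>(aX; Q)\<^sub>\<infinity> / (bX; Q)\<^sub>\<infinity>\<close>.\<close>

definition qbin :: "real \<Rightarrow> real \<Rightarrow> real \<Rightarrow> complex fps" where
  "qbin Q a b = Abs_fps (\<lambda>n. of_real ((\<Prod>i<n. b - a * Q ^ i) / (\<Prod>i<n. 1 - Q ^ Suc i)))"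

lemma qbin_nth: "qbin Q a b $ n = of_real ((\<Prod>i<n. b - a * Q ^ i) / (\<Prod>i<n. 1 - Q ^ Suc i))"
  by (simp add: qbin_def)

lemma qbin_dilate: "dilate r (qbin Q a b) = qbin Q (r * a) (r * b)"
proof (rule fps_ext)
  fix n
  have "(\<Prod>i<n. r * b - r * a * Q ^ i) = r ^ n * (\<Prod>i<n. b - a * Q ^ i)"
    by (induction n) (auto simp: algebra_simps)
  then show "dilate r (qbin Q a b) $ n = qbin Q (r * a) (r * b) $ n"
    by (simp add: qbin_nth)
qed

text \<open>By \<open>geo_expansion\<close>, for \<open>a > 0\<close> and \<open>0 < Q < 1\<close>
  the coefficients are combinations of the geometric sequences of ratio \<open>a * Q ^ i\<close>
  with \<open>i < N\<close>, up to an error of rate \<open>a * Q ^ N\<close>. Smooth even functions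
  have the base \<open>a = 1\<close>; other bases arise by dilation.\<close>

definition smooth_fps :: "real \<Rightarrow> real \<Rightarrow> complex fps \<Rightarrow> bool" where
  "smooth_fps Q a U \<longleftrightarrow> (\<forall>N. geo_bounded (a * Q ^ N) ((\<Prod>i<N. lin (a * Q ^ i)) * U))"

context
  fixes Q :: real
  assumes Q: "0 < Q" "Q < 1"
begin

lemma one_minus_Q_power: "1 - Q ^ Suc i > 0"
  using Q power_Suc_less_one[of Q i] by simp

text \<open>The factor \<open>lin b\<close> cancels the first factor of the denominator product. On
  coefficients this is a rational identity in \<open>Q ^ m\<close>, so no question of convergence
  arises.\<close>

lemma lin_mult_qbin: "lin b * qbin Q a b = qbin Q a (b * Q)"
proof (rule fps_ext)
  fix n
  show "(lin b * qbin Q a b) $ n = qbin Q a (b * Q) $ n"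
  proof (cases n)
    case 0
    then show ?thesis by (simp add: lin_mult_nth qbin_nth)
  next
    case (Suc m)
    \<comment> \<open>The factor \<open>i = 0\<close> is split off; each later one is
      \<open>Q * (b - a * Q ^ i)\<close> with shifted index.\<close>
    have 1: "(\<Prod>i<Suc m. b * Q - a * Q ^ i) = (b * Q - a) * Q ^ m * (\<Prod>i<m. b - a * Q ^ i)"
    proof -
      have "(\<Prod>i<Suc m. b * Q - a * Q ^ i) = (b * Q - a) * (\<Prod>i<m. Q * (b - a * Q ^ i))"
        by (subst prod.lessThan_Suc_shift) (simp add: algebra_simps)
      then show ?thesis by (simp add: prod.distrib)
    qed
    have *: "P * (b - a * X) / (D * d) - b * (P / D) = (b * Q - a) * X * P / (D * d)"
      if "D \<noteq> 0" "d \<noteq> 0" "d = 1 - Q * X" for P D d X :: real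
    proof -
      have "P * (b - a * X) / (D * d) - b * (P / D) = (P * (b - a * X) - b * P * d) / (D * d)"
        using that(1,2) by (simp add: diff_divide_distrib)
      also have "P * (b - a * X) - b * P * d = (b * Q - a) * X * P"
        by (simp add: that(3) algebra_simps)
      finally show ?thesis .
    qed
    have "(\<Prod>i<m. 1 - Q ^ Suc i) \<noteq> 0" "1 - Q ^ Suc m \<noteq> 0"
      using one_minus_Q_power by (auto simp: less_le)
    then have "(\<Prod>i<Suc m. b - a * Q ^ i) / (\<Prod>i<Suc m. 1 - Q ^ Suc i)
        - b * ((\<Prod>i<m. b - a * Q ^ i) / (\<Prod>i<m. 1 - Q ^ Suc i))
       = (\<Prod>i<Suc m. b * Q - a * Q ^ i) / (\<Prod>i<Suc m. 1 - Q ^ Suc i)"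
      unfolding 1 unfolding prod.lessThan_Suc by (rule *) simp_all
    then show ?thesis
      unfolding lin_mult_nth qbin_nth Suc
      by (simp only: nat.simps(3) if_False diff_Suc_1 flip: of_real_diff of_real_mult)
  qed
qed

text \<open>Here \<open>lin a\<close> restores the first factor of the numerator product.\<close>

lemma lin_mult_qbin': "lin a * qbin Q (a * Q) b = qbin Q a b"
proof (rule fps_ext)
  fix n
  show "(lin a * qbin Q (a * Q) b) $ n = qbin Q a b $ n"
  proof (cases n)
    case 0
    then show ?thesis by (simp add: lin_mult_nth qbin_nth)
  next
    case (Suc m)
    have 1: "(\<Prod>i<Suc m. b - a * Q ^ i) = (b - a) * (\<Prod>i<m. b - a * Q * Q ^ i)"
      by (subst prod.lessThan_Suc_shift) (simp add: algebra_simps)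
    have *: "P * (b - a * Q * X) / (D * d) - a * (P / D) = (b - a) * P / (D * d)"
      if "D \<noteq> 0" "d \<noteq> 0" "d = 1 - Q * X" for P D d X :: real
    proof -
      have "P * (b - a * Q * X) / (D * d) - a * (P / D) = (P * (b - a * Q * X) - a * P * d) / (D * d)"
        using that(1,2) by (simp add: diff_divide_distrib)
      also have "P * (b - a * Q * X) - a * P * d = (b - a) * P"
        by (simp add: that(3) algebra_simps)
      finally show ?thesis .
    qed
    have "(\<Prod>i<m. 1 - Q ^ Suc i) \<noteq> 0" "1 - Q ^ Suc m \<noteq> 0"
      using one_minus_Q_power by (auto simp: less_le)
    then have "(\<Prod>i<Suc m. b - a * Q * Q ^ i) / (\<Prod>i<Suc m. 1 - Q ^ Suc i)
        - a * ((\<Prod>i<m. b - a * Q * Q ^ i) / (\<Prod>i<m. 1 - Q ^ Suc i))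
       = (\<Prod>i<Suc m. b - a * Q ^ i) / (\<Prod>i<Suc m. 1 - Q ^ Suc i)"
      unfolding 1 unfolding prod.lessThan_Suc by (rule *) simp_all
    then show ?thesis
      unfolding lin_mult_nth qbin_nth Suc
      by (simp only: nat.simps(3) if_False diff_Suc_1 flip: of_real_diff of_real_mult)
  qed
qed

lemma prod_lin_mult_qbin: "(\<Prod>i<M. lin (b * Q ^ i)) * qbin Q a b = qbin Q a (b * Q ^ M)"
proof (induction M)
  case (Suc M)
  then show ?case using lin_mult_qbin[of "b * Q ^ M" a] by (simp add: mult.assoc mult.left_commute[of _ "lin _"] mult.commute[of Q])
qed simp

lemma prod_lin_mult_qbin': "(\<Prod>i<N. lin (a * Q ^ i)) * qbin Q (a * Q ^ N) b = qbin Q a b"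
proof (induction N)
  case (Suc N)
  then show ?case using lin_mult_qbin'[of "a * Q ^ N" b] by (simp add: mult.assoc mult.commute[of Q])
qed simp

text \<open>This is the \<open>q\<close>-difference equation of the quotient: the series on the
  right is \<open>qbin Q a b\<close> taken at \<open>Q * X\<close>.\<close>

lemma lin_mult_qbin_swap: "lin b * qbin Q a b = lin a * qbin Q (a * Q) (b * Q)"
  using lin_mult_qbin lin_mult_qbin' by simp

text \<open>The two \<open>q\<close>-difference equations give \<open>H(X) = H(Q X)\<close> for the
  product \<open>H\<close>. As \<open>Q ^ n\<close> differs from 1 for positive \<open>n\<close>,
  only the constant coefficient survives. This replaces a convolution identity for the
  coefficients.\<close>

lemma qbin_inverse: "qbin Q a b * qbin Q b a = 1"
proof -
  let ?H = "qbin Q a b * qbin Q b a"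
  have "(lin a * lin b) * ?H = (lin b * qbin Q a b) * (lin a * qbin Q b a)"
    by (simp add: mult_ac)
  also have "\<dots> = (lin a * lin b) * dilate Q ?H"
    unfolding dilate_mult qbin_dilate lin_mult_qbin_swap[of b a] lin_mult_qbin_swap[of a b]
    by (simp add: mult_ac)
  finally have H: "?H = dilate Q ?H" by simp
  show ?thesis
  proof (rule fps_ext)
    fix n
    show "?H $ n = 1 $ n"
    proof (cases n)
      case 0
      then show ?thesis by (simp add: qbin_nth)
    next
      case (Suc m)
      have "?H $ n = of_real (Q ^ n) * ?H $ n"
        by (metis H dilate_nth of_real_power)
      then have "of_real (1 - Q ^ n) * ?H $ n = 0"
        by (simp add: algebra_simps)
      then show ?thesis using one_minus_Q_power[of m] Suc
        by (metis fps_one_nth less_irrefl mult_eq_0_iff nat.simps(3) of_real_eq_0_iff)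
    qed
  qed
qed

section \<open>Infinite \<open>q\<close>-shifted factorials and bounds for the
  \<open>q\<close>-binomial coefficients\<close>

lemma qpoch_convergent: "convergent_prod (\<lambda>k. 1 - a * Q ^ k)"
proof -
  have "summable (\<lambda>k. norm ((1 - a * Q ^ k) - 1))"
    using Q by (auto simp: abs_mult intro!: summable_mult summable_geometric)
  then show ?thesis
    by (intro abs_convergent_prod_imp_convergent_prod) (simp add: abs_convergent_prod_conv_summable)
qed

lemma qpoch_factor_pos:
  assumes "0 < a" "a < 1"
  shows "1 - a * Q ^ k > 0"
proof -
  have "a * Q ^ k \<le> a * 1" using Q assms by (intro mult_left_mono power_le_one) auto
  also have "\<dots> < 1" using assms by simp
  finally show ?thesis by simp
qed

lemma qpoch_inf_pos: "0 < a \<Longrightarrow> a < 1 \<Longrightarrow> qpoch_inf a Q > 0"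
  unfolding qpoch_inf_def by (intro less_0_prodinf qpoch_convergent qpoch_factor_pos)

lemma qpoch_inf_split:
  assumes "0 < a" "a < 1"
  shows "qpoch_inf a Q = qpoch_inf (a * Q ^ m) Q * (\<Prod>i<m. 1 - a * Q ^ i)"
proof -
  have "1 - a * Q ^ i \<noteq> 0" for i using qpoch_factor_pos[OF assms, of i] by simp
  then show ?thesis
    unfolding qpoch_inf_def
    by (subst prodinf_split_initial_segment[OF qpoch_convergent, of m]) (simp_all add: power_add mult_ac)
qed

text \<open>The partial products decrease to the infinite product, which is positive.\<close>

lemma qpoch_finite_lower_bound: "\<exists>\<delta>>0. \<forall>n. \<delta> \<le> (\<Prod>i<n. 1 - Q ^ Suc i)"
proof -
  have conv: "convergent_prod (\<lambda>i. 1 - Q ^ Suc i)"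
    using qpoch_convergent[of Q] by simp
  define P where "P = prodinf (\<lambda>i. 1 - Q ^ Suc i)"
  have "P > 0" unfolding P_def using conv one_minus_Q_power by (intro less_0_prodinf) auto
  moreover have "(\<Prod>i<n. 1 - Q ^ Suc i) \<ge> P" for n
    unfolding P_def using conv Q one_minus_Q_power
    by (intro prod_ge_prodinf) (auto simp: less_imp_le convergent_prod_has_prod simp del: power_Suc)
  ultimately show ?thesis by blast
qed

text \<open>The condition \<open>a \<le> b\<close> keeps every numerator factor between 0 and
  \<open>b\<close>, while the denominators are bounded below.\<close>

lemma qbin_bounded:
  assumes "0 < a" "a \<le> b"
  shows "geo_bounded b (qbin Q a b)"
proof -
  obtain \<delta> where \<delta>: "\<delta> > 0" "\<And>n. \<delta> \<le> (\<Prod>i<n. 1 - Q ^ Suc i)"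
    using qpoch_finite_lower_bound by blast
  have "cmod (qbin Q a b $ n) \<le> 1 / \<delta> * b ^ n" for n
  proof -
    have "a * Q ^ i \<le> b" "a * Q ^ i > 0" for i
      using assms Q mult_mono[of a b "Q ^ i" 1] by (auto simp: power_le_one)
    then have *: "0 \<le> b - a * Q ^ i" "b - a * Q ^ i \<le> b" for i
      by (simp_all add: less_imp_le)
    have "0 \<le> (\<Prod>i<n. b - a * Q ^ i)" "(\<Prod>i<n. b - a * Q ^ i) \<le> b ^ n"
      using prod_mono[of "{..<n}" "\<lambda>i. b - a * Q ^ i" "\<lambda>_. b"] *
      by (auto intro!: prod_nonneg)
    then have "(\<Prod>i<n. b - a * Q ^ i) / (\<Prod>i<n. 1 - Q ^ Suc i) \<le> b ^ n / \<delta>"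
      using \<delta> by (intro frac_le) auto
    moreover have "0 \<le> (\<Prod>i<n. b - a * Q ^ i) / (\<Prod>i<n. 1 - Q ^ Suc i)"
      using \<open>0 \<le> (\<Prod>i<n. b - a * Q ^ i)\<close> \<delta>(1) \<delta>(2)[of n] by (intro divide_nonneg_nonneg) auto
    ultimately show ?thesis by (simp add: qbin_nth abs_of_nonneg flip: of_real_prod of_real_divide)
  qed
  then show ?thesis unfolding geo_bounded_def by blast
qed

lemma smooth_fps_dilate:
  assumes "smooth_fps Q a U" "0 < r"
  shows "smooth_fps Q (r * a) (dilate r U)"
  unfolding smooth_fps_def
proof
  fix N
  have "geo_bounded (r * (a * Q ^ N)) (dilate r ((\<Prod>i<N. lin (a * Q ^ i)) * U))"
    using assms by (intro geo_bounded_dilate) (auto simp: smooth_fps_def)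
  then show "geo_bounded (r * a * Q ^ N) ((\<Prod>i<N. lin (r * a * Q ^ i)) * dilate r U)"
    by (simp add: dilate_mult dilate_prod_lin mult.assoc)
qed

lemma smooth_fps_scale:
  assumes "smooth_fps Q a U"
  shows "smooth_fps Q a (fps_const c * U)"
  using assms geo_bounded_scale[of _ _ c]
  by (auto simp: smooth_fps_def mult.left_commute)

text \<open>
  The first \<open>N\<close> numerator factors of the infinite product \<open>qbin Q a b\<close> are spent on \<open>U\<close>; for large
  \<open>N\<close> the result decays faster than the coefficients of the remaining product.
\<close>

lemma smooth_fps_qbin:
  assumes U: "smooth_fps Q a U" and ab: "0 < a" "0 < b"
  shows "smooth_fps Q b (qbin Q a b * U)"
  unfolding smooth_fps_def
proof
  fix M
  have "(\<lambda>N. a * Q ^ N) \<longlonglongrightarrow> a * 0"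
    using Q by (intro tendsto_mult LIMSEQ_realpow_zero) auto
  then have "\<forall>\<^sub>F N in sequentially. a * Q ^ N < b * Q ^ M"
    by (rule order_tendstoD(2)) (use ab Q in auto)
  then obtain N where N: "a * Q ^ N < b * Q ^ M"
    by (auto simp: eventually_sequentially)
  have "(\<Prod>i<M. lin (b * Q ^ i)) * (qbin Q a b * U) = qbin Q a (b * Q ^ M) * U"
    by (simp only: prod_lin_mult_qbin flip: mult.assoc)
  also have "\<dots> = ((\<Prod>i<N. lin (a * Q ^ i)) * qbin Q (a * Q ^ N) (b * Q ^ M)) * U"
    by (simp only: prod_lin_mult_qbin')
  also have "\<dots> = qbin Q (a * Q ^ N) (b * Q ^ M) * ((\<Prod>i<N. lin (a * Q ^ i)) * U)"
    by (simp only: mult_ac)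
  finally have "(\<Prod>i<M. lin (b * Q ^ i)) * (qbin Q a b * U) = \<dots>" .
  moreover have "geo_bounded (b * Q ^ M)
      (qbin Q (a * Q ^ N) (b * Q ^ M) * ((\<Prod>i<N. lin (a * Q ^ i)) * U))"
  proof (rule geo_bounded_mult)
    show "geo_bounded (b * Q ^ M) (qbin Q (a * Q ^ N) (b * Q ^ M))"
      using ab Q N by (intro qbin_bounded) auto
    show "geo_bounded (a * Q ^ N) ((\<Prod>i<N. lin (a * Q ^ i)) * U)"
      using U by (simp add: smooth_fps_def)
  qed (use ab Q N in auto)
  ultimately show "geo_bounded (b * Q ^ M) ((\<Prod>i<M. lin (b * Q ^ i)) * (qbin Q a b * U))"
    by (simp only:)
qed

end

subsection \<open>Taylor expansions at the origin\<close>

lemma uminus_Rq_iff [simp]: "- x \<in> Rq q \<longleftrightarrow> x \<in> Rq q"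
  by (auto simp: Rq_def minus_equation_iff[of x])

lemma even_part_even: "even_part f (- x) = even_part f x"
  by (simp add: even_part_def add.commute)

lemma odd_part_odd: "odd_part f (- x) = - odd_part f x"
  by (simp add: odd_part_def field_simps)

lemma even_odd_sum: "even_part f x + odd_part f x = f x"
  by (simp add: even_part_def odd_part_def field_simps)

text \<open>The factor in \<open>dq_power\<close>. It depends on parity because \<open>dq\<close>
  compares an even function with its value at \<open>x / q\<close> and an odd one with its value at
  \<open>q * x\<close>.\<close>

definition dq_coeff :: "real \<Rightarrow> nat \<Rightarrow> complex" where
  "dq_coeff q i = of_real ((if even i then inverse q ^ i - 1 else 1 - q ^ i) / (1 - q))"

text \<open>The bound is asked on every bounded part of \<open>Rq q\<close>, not only near 0, so
  that order 0 is the local boundedness which \<open>Eq_space\<close> demands of each iterate of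
  \<open>dq\<close>.\<close>

definition zero_order :: "real \<Rightarrow> nat \<Rightarrow> (real \<Rightarrow> complex) \<Rightarrow> bool" where
  "zero_order q M f \<longleftrightarrow> (\<forall>B. \<exists>C. \<forall>x\<in>Rq q. \<bar>x\<bar> \<le> B \<longrightarrow> cmod (f x) \<le> C * \<bar>x\<bar> ^ M)"

text \<open>Taylor expansions of all orders; the coefficients may be chosen afresh for each
  order.\<close>

definition has_jets :: "real \<Rightarrow> (real \<Rightarrow> complex) \<Rightarrow> bool" where
  "has_jets q f \<longleftrightarrow> (\<forall>M. \<exists>a. zero_order q M (\<lambda>x. f x - (\<Sum>i<M. a i * of_real x ^ i)))"

context
  fixes q :: real
  assumes q: "0 < q" "q < 1"
begin

lemma zero_notin_Rq: "0 \<notin> Rq q"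
  using q by (auto simp: Rq_def)

lemma Rq_mult_iff [simp]: "q * x \<in> Rq q \<longleftrightarrow> x \<in> Rq q"
proof
  assume "x \<in> Rq q"
  then obtain n :: int where "x = q powi n \<or> x = - (q powi n)" by (auto simp: Rq_def)
  then have "q * x = q powi (n + 1) \<or> q * x = - (q powi (n + 1))"
    using q by (auto simp: power_int_add)
  then show "q * x \<in> Rq q" by (auto simp: Rq_def)
next
  assume "q * x \<in> Rq q"
  then obtain n :: int where "q * x = q powi n \<or> q * x = - (q powi n)" by (auto simp: Rq_def)
  then have "x = q powi (n - 1) \<or> x = - (q powi (n - 1))"
    using q by (auto simp: power_int_diff field_simps)
  then show "x \<in> Rq q" by (auto simp: Rq_def)
qed

lemma Rq_divide_iff [simp]: "x / q \<in> Rq q \<longleftrightarrow> x \<in> Rq q"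
  using Rq_mult_iff[of "x / q"] q by simp

lemma Rq_power_mult: "x \<in> Rq q \<Longrightarrow> q ^ j * x \<in> Rq q"
  by (induction j) (auto simp: mult.assoc)

lemma dq_eq: "dq q f z = (f (z / q) + f (- (z / q)) - f (q * z) + f (- (q * z)) - 2 * f (- z))
    / of_real (2 * (1 - q) * z)"
  by (simp add: dq_def divide_inverse mult.commute)

lemma dq_outside:
  assumes "\<And>x. x \<notin> Rq q \<Longrightarrow> f x = 0" "x \<notin> Rq q"
  shows "dq q f x = 0"
  using assms by (simp add: dq_eq)

text \<open>For even functions the values at \<open>q * z\<close> cancel and \<open>dq\<close> looks
  only outward; for odd ones the values at \<open>z / q\<close> cancel and it looks only
  inward.\<close>

lemma dq_even:
  assumes "\<And>x. f (- x) = f x"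
  shows "dq q f z = (f (z / q) - f z) / of_real ((1 - q) * z)"
proof -
  have "dq q f z = (2 * (f (z / q) - f z)) / (2 * of_real ((1 - q) * z))"
    by (simp add: dq_eq assms)
  then show ?thesis by (simp only: mult_divide_mult_cancel_left_if) simp
qed

lemma dq_odd:
  assumes "\<And>x. f (- x) = - f x"
  shows "dq q f z = (f z - f (q * z)) / of_real ((1 - q) * z)"
proof -
  have "dq q f z = (2 * (f z - f (q * z))) / (2 * of_real ((1 - q) * z))"
    by (simp add: dq_eq assms)
  then show ?thesis by (simp only: mult_divide_mult_cancel_left_if) simp
qed

lemma dq_add: "dq q (\<lambda>x. f x + g x) x = dq q f x + dq q g x"
  by (simp add: dq_def algebra_simps flip: add_divide_distrib diff_divide_distrib)

lemma dq_cmult: "dq q (\<lambda>x. c * f x) x = c * dq q f x"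
  by (simp add: dq_def algebra_simps flip: add_divide_distrib diff_divide_distrib)

lemma dq_diff: "dq q (\<lambda>x. f x - g x) x = dq q f x - dq q g x"
  using dq_add[of f "\<lambda>x. - 1 * g x"] dq_cmult[of "-1" g] by simp

lemma dq_sum: "dq q (\<lambda>x. \<Sum>i\<in>A. f i x) x = (\<Sum>i\<in>A. dq q (f i) x)"
  by (induction A rule: infinite_finite_induct) (simp_all add: dq_add, simp_all add: dq_def)

text \<open>Because of its odd denominator, \<open>dq\<close> anticommutes with reflection of the
  argument, so it exchanges even and odd functions.\<close>

lemma odd_part_dq: "odd_part (dq q f) x = dq q (even_part f) x"
proof -
  define A where "A = f (x / q) + f (- (x / q)) - f (q * x) + f (- (q * x)) - 2 * f (- x)"
  define B where "B = f (- (x / q)) + f (x / q) - f (- (q * x)) + f (q * x) - 2 * f x"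
  define c where "c = complex_of_real (2 * (1 - q) * x)"
  define E where "E = even_part f (x / q) + even_part f (- (x / q)) - even_part f (q * x)
    + even_part f (- (q * x)) - 2 * even_part f (- x)"
  have "dq q f x = A / c"
    by (simp add: dq_eq A_def c_def)
  moreover have "dq q f (- x) = - (B / c)"
  proof -
    have "complex_of_real (2 * (1 - q) * - x) = - c" by (simp add: c_def)
    then show ?thesis by (simp add: dq_eq B_def)
  qed
  ultimately have "odd_part (dq q f) x = ((A + B) / 2) / c"
    by (simp add: odd_part_def add_divide_distrib diff_divide_distrib mult.commute)
  also have "(A + B) / 2 = E"
    by (simp add: A_def B_def E_def even_part_def field_simps)
  also have "E / c = dq q (even_part f) x"
    by (simp add: dq_eq E_def c_def)
  finally show ?thesis .
qed

lemma even_part_dq: "even_part (dq q f) x = dq q (odd_part f) x"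
proof -
  define A where "A = f (x / q) + f (- (x / q)) - f (q * x) + f (- (q * x)) - 2 * f (- x)"
  define B where "B = f (- (x / q)) + f (x / q) - f (- (q * x)) + f (q * x) - 2 * f x"
  define c where "c = complex_of_real (2 * (1 - q) * x)"
  define E where "E = odd_part f (x / q) + odd_part f (- (x / q)) - odd_part f (q * x)
    + odd_part f (- (q * x)) - 2 * odd_part f (- x)"
  have "dq q f x = A / c"
    by (simp add: dq_eq A_def c_def)
  moreover have "dq q f (- x) = - (B / c)"
  proof -
    have "complex_of_real (2 * (1 - q) * - x) = - c" by (simp add: c_def)
    then show ?thesis by (simp add: dq_eq B_def)
  qed
  ultimately have "even_part (dq q f) x = ((A - B) / 2) / c"
    by (simp add: even_part_def add_divide_distrib diff_divide_distrib mult.commute)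
  also have "(A - B) / 2 = E"
    by (simp add: A_def B_def E_def odd_part_def field_simps)
  also have "E / c = dq q (odd_part f) x"
    by (simp add: dq_eq E_def c_def)
  finally show ?thesis .
qed

text \<open>This allows a Taylor polynomial to be integrated term by term; it holds since
  \<open>q ^ i\<close> and its inverse differ from 1 for positive \<open>i\<close>.\<close>

lemma dq_coeff_nonzero: "dq_coeff q (Suc i) \<noteq> 0"
proof -
  have "q ^ Suc i < 1" using q power_Suc_less_one by blast
  moreover have "inverse q ^ Suc i > 1"
    using q by (intro one_less_power) (auto simp: one_less_inverse_iff)
  ultimately show ?thesis using q by (auto simp: dq_coeff_def)
qed

lemma dq_power:
  assumes "x \<noteq> 0"
  shows "dq q (\<lambda>x. of_real x ^ Suc i) x = dq_coeff q (Suc i) * of_real x ^ i"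
proof (cases "even (Suc i)")
  case True
  then have "dq q (\<lambda>x. of_real x ^ Suc i) x
      = (of_real (x / q) ^ Suc i - of_real x ^ Suc i) / of_real ((1 - q) * x)"
    by (intro dq_even) (simp del: power_Suc)
  also have "\<dots> = dq_coeff q (Suc i) * of_real x ^ i"
    using True assms q by (simp add: dq_coeff_def field_simps)
  finally show ?thesis .
next
  case False
  then have "dq q (\<lambda>x. of_real x ^ Suc i) x
      = (of_real x ^ Suc i - of_real (q * x) ^ Suc i) / of_real ((1 - q) * x)"
    by (intro dq_odd) (simp del: power_Suc)
  also have "\<dots> = dq_coeff q (Suc i) * of_real x ^ i"
    using False assms q by (simp add: dq_coeff_def field_simps)
  finally show ?thesis .
qed

lemma dq_monomial:
  assumes "x \<noteq> 0"
  shows "dq q (\<lambda>x. c * of_real x ^ Suc i) x = c * dq_coeff q (Suc i) * of_real x ^ i"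
  using dq_power[OF assms, of i] dq_cmult[of c "\<lambda>x. of_real x ^ Suc i" x] by (simp only: mult.assoc)

section \<open>Calculus of orders of vanishing at the origin\<close>

lemma zero_orderE:
  assumes "zero_order q M f"
  obtains C where "C \<ge> 0" "\<And>x. x \<in> Rq q \<Longrightarrow> \<bar>x\<bar> \<le> B \<Longrightarrow> cmod (f x) \<le> C * \<bar>x\<bar> ^ M"
proof -
  obtain C where C: "\<And>x. x \<in> Rq q \<Longrightarrow> \<bar>x\<bar> \<le> B \<Longrightarrow> cmod (f x) \<le> C * \<bar>x\<bar> ^ M"
    using assms unfolding zero_order_def by metis
  have "cmod (f x) \<le> max 0 C * \<bar>x\<bar> ^ M" if "x \<in> Rq q" "\<bar>x\<bar> \<le> B" for x
    using C[OF that] by (rule order_trans) (intro mult_right_mono, auto)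
  then show ?thesis using that[of "max 0 C"] by auto
qed

lemma zero_orderI:
  assumes "\<And>B. \<exists>C. \<forall>x\<in>Rq q. \<bar>x\<bar> \<le> B \<longrightarrow> cmod (f x) \<le> C * \<bar>x\<bar> ^ M"
  shows "zero_order q M f"
  using assms by (simp add: zero_order_def)

lemma zero_order_cong:
  assumes "\<And>x. x \<in> Rq q \<Longrightarrow> f x = g x"
  shows "zero_order q M f \<longleftrightarrow> zero_order q M g"
  using assms by (simp add: zero_order_def)

lemma zero_order_add:
  assumes "zero_order q M f" "zero_order q M g"
  shows "zero_order q M (\<lambda>x. f x + g x)"
proof (rule zero_orderI)
  fix B
  obtain C where C: "\<And>x. x \<in> Rq q \<Longrightarrow> \<bar>x\<bar> \<le> B \<Longrightarrow> cmod (f x) \<le> C * \<bar>x\<bar> ^ M"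
    using zero_orderE[OF assms(1)] by metis
  obtain D where D: "\<And>x. x \<in> Rq q \<Longrightarrow> \<bar>x\<bar> \<le> B \<Longrightarrow> cmod (g x) \<le> D * \<bar>x\<bar> ^ M"
    using zero_orderE[OF assms(2)] by metis
  have "cmod (f x + g x) \<le> (C + D) * \<bar>x\<bar> ^ M" if "x \<in> Rq q" "\<bar>x\<bar> \<le> B" for x
    using norm_triangle_ineq[of "f x" "g x"] C[OF that] D[OF that] by (simp add: distrib_right)
  then show "\<exists>C. \<forall>x\<in>Rq q. \<bar>x\<bar> \<le> B \<longrightarrow> cmod (f x + g x) \<le> C * \<bar>x\<bar> ^ M" by blast
qed

lemma zero_order_cmult:
  assumes "zero_order q M f"
  shows "zero_order q M (\<lambda>x. c * f x)"
proof (rule zero_orderI)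
  fix B
  obtain C where C: "\<And>x. x \<in> Rq q \<Longrightarrow> \<bar>x\<bar> \<le> B \<Longrightarrow> cmod (f x) \<le> C * \<bar>x\<bar> ^ M"
    using zero_orderE[OF assms] by metis
  have "cmod (c * f x) \<le> (cmod c * C) * \<bar>x\<bar> ^ M" if "x \<in> Rq q" "\<bar>x\<bar> \<le> B" for x
    using mult_left_mono[OF C[OF that], of "cmod c"] by (simp add: norm_mult mult.assoc)
  then show "\<exists>C. \<forall>x\<in>Rq q. \<bar>x\<bar> \<le> B \<longrightarrow> cmod (c * f x) \<le> C * \<bar>x\<bar> ^ M" by blast
qed

lemma zero_order_diff:
  assumes "zero_order q M f" "zero_order q M g"
  shows "zero_order q M (\<lambda>x. f x - g x)"
  using zero_order_add[OF assms(1) zero_order_cmult[OF assms(2), of "-1"]] by simp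

lemma zero_order_dilation:
  assumes "zero_order q M f" "c \<noteq> 0" "\<And>x. x \<in> Rq q \<Longrightarrow> c * x \<in> Rq q"
  shows "zero_order q M (\<lambda>x. f (c * x))"
proof (rule zero_orderI)
  fix B
  obtain C where C: "\<And>x. x \<in> Rq q \<Longrightarrow> \<bar>x\<bar> \<le> \<bar>c\<bar> * B \<Longrightarrow> cmod (f x) \<le> C * \<bar>x\<bar> ^ M"
    using zero_orderE[OF assms(1)] by metis
  have "cmod (f (c * x)) \<le> (C * \<bar>c\<bar> ^ M) * \<bar>x\<bar> ^ M" if "x \<in> Rq q" "\<bar>x\<bar> \<le> B" for x
    using C[of "c * x"] assms(3)[OF that(1)] mult_left_mono[OF that(2), of "\<bar>c\<bar>"]
    by (simp add: abs_mult power_mult_distrib mult.assoc)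
  then show "\<exists>C. \<forall>x\<in>Rq q. \<bar>x\<bar> \<le> B \<longrightarrow> cmod (f (c * x)) \<le> C * \<bar>x\<bar> ^ M" by blast
qed

lemma zero_order_uminus: "zero_order q M f \<Longrightarrow> zero_order q M (\<lambda>x. f (- x))"
  using zero_order_dilation[of M f "-1"] by simp

lemma zero_order_times_x:
  assumes "zero_order q M f"
  shows "zero_order q (Suc M) (\<lambda>x. of_real x * f x)"
proof (rule zero_orderI)
  fix B
  obtain C where C: "\<And>x. x \<in> Rq q \<Longrightarrow> \<bar>x\<bar> \<le> B \<Longrightarrow> cmod (f x) \<le> C * \<bar>x\<bar> ^ M"
    using zero_orderE[OF assms] by metis
  have "cmod (of_real x * f x) \<le> C * \<bar>x\<bar> ^ Suc M" if "x \<in> Rq q" "\<bar>x\<bar> \<le> B" for x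
    using mult_left_mono[OF C[OF that], of "\<bar>x\<bar>"] by (simp add: norm_mult mult.left_commute)
  then show "\<exists>C. \<forall>x\<in>Rq q. \<bar>x\<bar> \<le> B \<longrightarrow> cmod (of_real x * f x) \<le> C * \<bar>x\<bar> ^ Suc M" by blast
qed

lemma zero_order_divide_x:
  assumes "zero_order q (Suc M) f"
  shows "zero_order q M (\<lambda>x. f x / of_real x)"
proof (rule zero_orderI)
  fix B
  obtain C where C: "\<And>x. x \<in> Rq q \<Longrightarrow> \<bar>x\<bar> \<le> B \<Longrightarrow> cmod (f x) \<le> C * \<bar>x\<bar> ^ Suc M"
    using zero_orderE[OF assms] by metis
  have "cmod (f x / of_real x) \<le> C * \<bar>x\<bar> ^ M" if "x \<in> Rq q" "\<bar>x\<bar> \<le> B" for x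
  proof -
    have "x \<noteq> 0" using that zero_notin_Rq by blast
    then show ?thesis using C[OF that] by (simp add: norm_divide divide_le_eq mult_ac)
  qed
  then show "\<exists>C. \<forall>x\<in>Rq q. \<bar>x\<bar> \<le> B \<longrightarrow> cmod (f x / of_real x) \<le> C * \<bar>x\<bar> ^ M" by blast
qed

lemma zero_order_power: "M \<le> i \<Longrightarrow> zero_order q M (\<lambda>x. of_real x ^ i)"
proof (rule zero_orderI)
  fix B :: real
  assume "M \<le> i"
  have "cmod (of_real x ^ i) \<le> \<bar>B\<bar> ^ (i - M) * \<bar>x\<bar> ^ M" if "\<bar>x\<bar> \<le> B" for x
  proof -
    have "cmod (of_real x ^ i) = \<bar>x\<bar> ^ (i - M) * \<bar>x\<bar> ^ M"
      using \<open>M \<le> i\<close> by (simp add: norm_power flip: power_add)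
    also have "\<dots> \<le> \<bar>B\<bar> ^ (i - M) * \<bar>x\<bar> ^ M"
      using that by (intro mult_right_mono power_mono) auto
    finally show ?thesis .
  qed
  then show "\<exists>C. \<forall>x\<in>Rq q. \<bar>x\<bar> \<le> B \<longrightarrow> cmod (of_real x ^ i) \<le> C * \<bar>x\<bar> ^ M" by blast
qed

lemma zero_order_mono:
  assumes "zero_order q N f" "M \<le> N"
  shows "zero_order q M f"
proof (rule zero_orderI)
  fix B
  obtain C where C: "C \<ge> 0" "\<And>x. x \<in> Rq q \<Longrightarrow> \<bar>x\<bar> \<le> B \<Longrightarrow> cmod (f x) \<le> C * \<bar>x\<bar> ^ N"
    using zero_orderE[OF assms(1)] by metis
  have "cmod (f x) \<le> (C * \<bar>B\<bar> ^ (N - M)) * \<bar>x\<bar> ^ M" if "x \<in> Rq q" "\<bar>x\<bar> \<le> B" for x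
  proof -
    have "cmod (f x) \<le> C * (\<bar>x\<bar> ^ (N - M) * \<bar>x\<bar> ^ M)"
      using C(2)[OF that] assms(2) by (simp flip: power_add)
    also have "\<dots> \<le> C * (\<bar>B\<bar> ^ (N - M) * \<bar>x\<bar> ^ M)"
      using that C(1) by (intro mult_left_mono mult_right_mono power_mono) auto
    finally show ?thesis by (simp add: mult.assoc)
  qed
  then show "\<exists>C. \<forall>x\<in>Rq q. \<bar>x\<bar> \<le> B \<longrightarrow> cmod (f x) \<le> C * \<bar>x\<bar> ^ M" by blast
qed

text \<open>\<open>dq\<close> is a combination of dilations, which keep the order, followed by
  division by \<open>x\<close>, which costs one.\<close>

lemma zero_order_dq:
  assumes "zero_order q (Suc M) f"
  shows "zero_order q M (dq q f)"
proof -
  have *: "zero_order q (Suc M) (\<lambda>x. f (c * x))" if "c \<in> {inverse q, - inverse q, q, - q, - 1}" for c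
  proof (rule zero_order_dilation[OF assms])
    show "c \<noteq> 0" using q that by auto
    show "c * x \<in> Rq q" if "x \<in> Rq q" for x
      using that \<open>c \<in> _\<close> Rq_divide_iff[of x] by (auto simp: divide_inverse mult.commute simp del: Rq_divide_iff)
  qed
  have "zero_order q (Suc M) (\<lambda>x. f (inverse q * x) + f (- inverse q * x) - f (q * x) + f (- q * x) - 2 * f (-1 * x))"
    by (intro zero_order_add zero_order_diff zero_order_cmult *) auto
  then have "zero_order q M (\<lambda>x. 1 / of_real (2 * (1 - q)) *
     ((f (inverse q * x) + f (- inverse q * x) - f (q * x) + f (- q * x) - 2 * f (-1 * x)) / of_real x))"
    by (intro zero_order_cmult zero_order_divide_x)
  moreover have "dq q f = (\<lambda>x. 1 / of_real (2 * (1 - q)) *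
     ((f (inverse q * x) + f (- inverse q * x) - f (q * x) + f (- q * x) - 2 * f (-1 * x)) / of_real x))"
    by (rule ext) (simp add: dq_def)
  ultimately show ?thesis by simp
qed

lemma zero_order_tendsto_0:
  assumes "zero_order q (Suc M) f"
  shows "(f \<longlongrightarrow> 0) (at 0 within Rq q)"
proof -
  obtain C where C: "\<And>x. x \<in> Rq q \<Longrightarrow> \<bar>x\<bar> \<le> 1 \<Longrightarrow> cmod (f x) \<le> C * \<bar>x\<bar> ^ Suc M"
    using zero_orderE[OF assms] by metis
  have "((\<lambda>x. C * \<bar>x\<bar> ^ Suc M) \<longlongrightarrow> C * \<bar>0\<bar> ^ Suc M) (at 0 within Rq q)"
    by (intro tendsto_intros)
  then have lim: "((\<lambda>x. C * \<bar>x\<bar> ^ Suc M) \<longlongrightarrow> 0) (at 0 within Rq q)" by simp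
  have "\<forall>\<^sub>F x in at 0 within Rq q. \<bar>x\<bar> \<le> 1"
    unfolding eventually_at by (intro exI[of _ 1]) (auto simp: dist_real_def)
  then have "\<forall>\<^sub>F x in at 0 within Rq q. cmod (f x) \<le> C * \<bar>x\<bar> ^ Suc M"
    using eventually_at_topological C by (auto simp: eventually_at_filter elim!: eventually_mono)
  then show ?thesis using lim by (rule Lim_null_comparison)
qed

text \<open>Since \<open>h\<close> tends to 0 along \<open>q ^ j * x\<close>, it is the sum of its
  differences along these points; their bounds form a geometric series because the order is at least
  one.\<close>

lemma zero_order_of_difference:
  assumes diff: "zero_order q (Suc M) (\<lambda>x. h x - h (q * x))"
    and lim: "(h \<longlongrightarrow> 0) (at 0 within Rq q)"
  shows "zero_order q (Suc M) h"
proof (rule zero_orderI)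
  fix B
  obtain C where C: "C \<ge> 0" "\<And>x. x \<in> Rq q \<Longrightarrow> \<bar>x\<bar> \<le> B \<Longrightarrow> cmod (h x - h (q * x)) \<le> C * \<bar>x\<bar> ^ Suc M"
    using zero_orderE[OF diff] by metis
  define D where "D = C / (1 - q)"
  have "cmod (h x) \<le> D * \<bar>x\<bar> ^ Suc M" if x: "x \<in> Rq q" "\<bar>x\<bar> \<le> B" for x
  proof -
    have x0: "x \<noteq> 0" using x zero_notin_Rq by blast
    have step: "cmod (h (q ^ j * x) - h (q ^ Suc j * x)) \<le> C * \<bar>x\<bar> ^ Suc M * q ^ j" for j
    proof -
      have "cmod (h (q ^ j * x) - h (q * (q ^ j * x))) \<le> C * \<bar>q ^ j * x\<bar> ^ Suc M"
      proof (rule C(2))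
        show "q ^ j * x \<in> Rq q" using x by (intro Rq_power_mult)
        show "\<bar>q ^ j * x\<bar> \<le> B"
          using x q mult_mono[of "q ^ j" 1 "\<bar>x\<bar>" B] by (simp add: abs_mult power_le_one)
      qed
      also have "\<bar>q ^ j * x\<bar> ^ Suc M = \<bar>x\<bar> ^ Suc M * (q ^ j) ^ Suc M"
        using q by (simp add: abs_mult power_mult_distrib del: power_Suc)
      \<comment> \<open>A single power of \<open>q ^ j\<close> is enough for summability.\<close>
      also have "\<dots> \<le> \<bar>x\<bar> ^ Suc M * q ^ j"
        using q power_decreasing[of 1 "Suc M" "q ^ j"]
        by (intro mult_left_mono) (auto simp: power_le_one)
      finally show ?thesis using C(1) by (simp add: mult_left_mono mult.assoc)
    qed
    have tele: "cmod (h x - h (q ^ J * x)) \<le> D * \<bar>x\<bar> ^ Suc M" for J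
    proof -
      have "h x - h (q ^ J * x) = (\<Sum>j<J. h (q ^ j * x) - h (q ^ Suc j * x))"
        by (subst sum_lessThan_telescope') simp
      then have "cmod (h x - h (q ^ J * x)) \<le> (\<Sum>j<J. C * \<bar>x\<bar> ^ Suc M * q ^ j)"
        using step by (metis (no_types, lifting) sum_norm_le)
      also have "\<dots> = C * \<bar>x\<bar> ^ Suc M * (\<Sum>j<J. q ^ j)" by (simp add: sum_distrib_left)
      also have "\<dots> \<le> C * \<bar>x\<bar> ^ Suc M * (1 / (1 - q))"
      proof (intro mult_left_mono)
        have "(\<Sum>j<J. q ^ j) \<le> (\<Sum>j. q ^ j)"
          using q by (intro sum_le_suminf summable_geometric) auto
        then show "(\<Sum>j<J. q ^ j) \<le> 1 / (1 - q)"
          using q by (subst (asm) suminf_geometric) auto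
      qed (use C(1) in auto)
      finally show ?thesis by (simp add: D_def)
    qed
    have "filterlim (\<lambda>J. q ^ J * x) (at 0 within Rq q) sequentially"
      unfolding filterlim_at
    proof
      show "\<forall>\<^sub>F J in sequentially. q ^ J * x \<in> Rq q \<and> q ^ J * x \<noteq> 0"
        using x x0 q Rq_power_mult by (intro always_eventually) auto
      show "(\<lambda>J. q ^ J * x) \<longlonglongrightarrow> 0"
        using q by (intro tendsto_mult_left_zero LIMSEQ_realpow_zero) auto
    qed
    then have "(\<lambda>J. h (q ^ J * x)) \<longlonglongrightarrow> 0"
      by (rule filterlim_compose[OF lim])
    then have "(\<lambda>J. cmod (h x - h (q ^ J * x))) \<longlonglongrightarrow> cmod (h x - 0)"
      by (intro tendsto_intros)
    then have "cmod (h x - 0) \<le> D * \<bar>x\<bar> ^ Suc M"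
      using tele by (intro LIMSEQ_le_const2) auto
    then show ?thesis by simp
  qed
  then show "\<exists>C. \<forall>x\<in>Rq q. \<bar>x\<bar> \<le> B \<longrightarrow> cmod (h x) \<le> C * \<bar>x\<bar> ^ Suc M" by blast
qed

lemma zero_order_even_part: "zero_order q M f \<Longrightarrow> zero_order q M (even_part f)"
  using zero_order_cmult[OF zero_order_add[OF _ zero_order_uminus], of M f f "1/2"]
  by (simp add: even_part_def[abs_def])

lemma zero_order_odd_part: "zero_order q M f \<Longrightarrow> zero_order q M (odd_part f)"
  using zero_order_cmult[OF zero_order_diff[OF _ zero_order_uminus], of M f f "1/2"]
  by (simp add: odd_part_def[abs_def])

lemma filterlim_uminus_Rq: "filterlim uminus (at 0 within Rq q) (at 0 within Rq q)"
  unfolding filterlim_at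
proof
  show "\<forall>\<^sub>F x in at 0 within Rq q. - x \<in> Rq q \<and> - x \<noteq> 0"
    by (auto simp: eventually_at_filter)
  show "(uminus \<longlongrightarrow> 0) (at (0::real) within Rq q)"
    using tendsto_minus[OF tendsto_ident_at, of "0::real" "Rq q"] by simp
qed

text \<open>Splitting by parity turns \<open>dq\<close> into a two-point difference that telescopes.
  The even case yields \<open>h (x / q) - h x\<close>, which is first rescaled by
  \<open>q\<close>.\<close>

lemma zero_order_of_dq:
  assumes dq: "zero_order q M (dq q h)" and lim: "(h \<longlongrightarrow> 0) (at 0 within Rq q)"
  shows "zero_order q (Suc M) h"
proof -
  have lim': "((\<lambda>x. h (- x)) \<longlongrightarrow> 0) (at 0 within Rq q)"
    by (rule filterlim_compose[OF lim filterlim_uminus_Rq])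
  have even: "zero_order q (Suc M) (even_part h)"
  proof (rule zero_order_of_difference)
    have "zero_order q M (dq q (even_part h))"
      using zero_order_odd_part[OF dq] by (simp add: odd_part_dq[abs_def] cong: zero_order_cong)
    then have "zero_order q (Suc M) (\<lambda>x. of_real (1 - q) * (of_real x * dq q (even_part h) x))"
      by (intro zero_order_cmult zero_order_times_x)
    then have "zero_order q (Suc M) (\<lambda>x. even_part h (x / q) - even_part h x)"
      by (rule zero_order_cong[THEN iffD1, rotated])
         (use q zero_notin_Rq in \<open>auto simp: dq_even[of "even_part h", OF even_part_even]\<close>)
    then have "zero_order q (Suc M) (\<lambda>x. even_part h (q * x / q) - even_part h (q * x))"
      by (rule zero_order_dilation) (use q in auto)
    then show "zero_order q (Suc M) (\<lambda>x. even_part h x - even_part h (q * x))" using q by simp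
    show "(even_part h \<longlongrightarrow> 0) (at 0 within Rq q)"
      using tendsto_divide[OF tendsto_add[OF lim lim'] tendsto_const, of 2]
      by (simp add: even_part_def[abs_def])
  qed
  have odd: "zero_order q (Suc M) (odd_part h)"
  proof (rule zero_order_of_difference)
    have "zero_order q M (dq q (odd_part h))"
      using zero_order_even_part[OF dq] by (simp add: even_part_dq[abs_def] cong: zero_order_cong)
    then have "zero_order q (Suc M) (\<lambda>x. of_real (1 - q) * (of_real x * dq q (odd_part h) x))"
      by (intro zero_order_cmult zero_order_times_x)
    then show "zero_order q (Suc M) (\<lambda>x. odd_part h x - odd_part h (q * x))"
      by (rule zero_order_cong[THEN iffD1, rotated])
         (use q zero_notin_Rq in \<open>auto simp: dq_odd[of "odd_part h", OF odd_part_odd]\<close>)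
    show "(odd_part h \<longlongrightarrow> 0) (at 0 within Rq q)"
      using tendsto_divide[OF tendsto_diff[OF lim lim'] tendsto_const, of 2]
      by (simp add: odd_part_def[abs_def])
  qed
  show ?thesis using zero_order_add[OF even odd] by (simp add: even_odd_sum)
qed

section \<open>Smoothness as existence of Taylor expansions\<close>

lemma Eq_space_bdd:
  assumes "f \<in> Eq_space q" "a \<ge> 0"
  shows "bdd_above {cmod ((dq q ^^ k) f x) |k x. k \<le> n \<and> x \<in> {-a..a} \<inter> Rq q}"
proof -
  have "\<forall>n a. a \<ge> 0 \<longrightarrow>
      bdd_above {cmod ((dq q ^^ k) f x) |k x. k \<le> n \<and> x \<in> {-a..a} \<inter> Rq q}"
    using assms(1) unfolding Eq_space_def mem_Collect_eq by (elim conjE)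
  then show ?thesis using assms(2) by simp
qed

text \<open>Induction on the order through \<open>dq q f\<close>: its Taylor polynomial is
  integrated term by term, the limit of \<open>f\<close> at 0 is the constant term, and the error
  gains one order by \<open>zero_order_of_dq\<close>.\<close>

lemma Eq_space_has_jet:
  assumes "f \<in> Eq_space q"
  shows "\<exists>a. zero_order q M (\<lambda>x. f x - (\<Sum>i<M. a i * of_real x ^ i))"
  using assms
proof (induction M arbitrary: f)
  case 0
  have "zero_order q 0 f"
  proof (rule zero_orderI)
    fix B
    have "bdd_above {cmod ((dq q ^^ k) f x) |k x. k \<le> 0 \<and> x \<in> {-\<bar>B\<bar>..\<bar>B\<bar>} \<inter> Rq q}"
      by (rule Eq_space_bdd[OF 0 abs_ge_zero])
    then obtain C where C: "\<And>x. x \<in> {-\<bar>B\<bar>..\<bar>B\<bar>} \<inter> Rq q \<Longrightarrow> cmod (f x) \<le> C"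
      by (auto simp: bdd_above_def)
    have "cmod (f x) \<le> C" if "x \<in> Rq q" "\<bar>x\<bar> \<le> B" for x
      using that by (intro C) auto
    then show "\<exists>C. \<forall>x\<in>Rq q. \<bar>x\<bar> \<le> B \<longrightarrow> cmod (f x) \<le> C * \<bar>x\<bar> ^ 0" by auto
  qed
  then show ?case by simp
next
  case (Suc M)
  have "dq q f \<in> Eq_space q"
    unfolding Eq_space_def mem_Collect_eq
  proof (intro conjI allI impI)
    show "dq q f x = 0" if "x \<notin> Rq q" for x
      using that Suc.prems by (intro dq_outside) (auto simp: Eq_space_def)
    have it: "(dq q ^^ k) (dq q f) = (dq q ^^ Suc k) f" for k
      by (simp add: funpow_swap1)
    show "\<exists>L. ((dq q ^^ n) (dq q f) \<longlongrightarrow> L) (at 0 within Rq q)" for n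
      unfolding it using Suc.prems unfolding Eq_space_def by blast
    show "bdd_above {cmod ((dq q ^^ k) (dq q f) x) |k x. k \<le> n \<and> x \<in> {-a..a} \<inter> Rq q}"
      if "a \<ge> 0" for n a
    proof (rule bdd_above_mono)
      show "bdd_above {cmod ((dq q ^^ k) f x) |k x. k \<le> Suc n \<and> x \<in> {-a..a} \<inter> Rq q}"
        using Suc.prems that by (rule Eq_space_bdd)
      show "{cmod ((dq q ^^ k) (dq q f) x) |k x. k \<le> n \<and> x \<in> {-a..a} \<inter> Rq q}
         \<subseteq> {cmod ((dq q ^^ k) f x) |k x. k \<le> Suc n \<and> x \<in> {-a..a} \<inter> Rq q}"
        unfolding it by (blast intro: Suc_le_mono[THEN iffD2])
    qed
  qed
  then obtain a where a: "zero_order q M (\<lambda>x. dq q f x - (\<Sum>i<M. a i * of_real x ^ i))"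
    using Suc.IH by blast
  have "((dq q ^^ 0) f \<longlongrightarrow> L) (at 0 within Rq q) \<Longrightarrow> (f \<longlongrightarrow> L) (at 0 within Rq q)" for L
    by simp
  then obtain L where L: "(f \<longlongrightarrow> L) (at 0 within Rq q)"
    using Suc.prems unfolding Eq_space_def mem_Collect_eq by metis
  define b where "b i = (case i of 0 \<Rightarrow> L | Suc j \<Rightarrow> a j / dq_coeff q (Suc j))" for i
  define P where "P x = (\<Sum>i<Suc M. b i * of_real x ^ i)" for x :: real
  have P_eq: "P x = L + (\<Sum>i<M. b (Suc i) * of_real x ^ Suc i)" for x
    unfolding P_def by (subst sum.lessThan_Suc_shift) (simp add: b_def)
  have "zero_order q (Suc M) (\<lambda>x. f x - P x)"
  proof (rule zero_order_of_dq)
    have "dq q (\<lambda>x. f x - P x) x = dq q f x - (\<Sum>i<M. a i * of_real x ^ i)" if "x \<in> Rq q" for x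
    proof -
      have "x \<noteq> 0" using that zero_notin_Rq by blast
      have "dq q P x = dq q (\<lambda>x. L) x + (\<Sum>i<M. dq q (\<lambda>x. b (Suc i) * of_real x ^ Suc i) x)"
        unfolding P_eq[abs_def] dq_add dq_sum by simp
      also have "dq q (\<lambda>x. L) x = 0" by (simp add: dq_def)
      also have "(\<Sum>i<M. dq q (\<lambda>x. b (Suc i) * of_real x ^ Suc i) x) = (\<Sum>i<M. a i * of_real x ^ i)"
        using \<open>x \<noteq> 0\<close> dq_coeff_nonzero
        by (intro sum.cong refl) (subst dq_monomial, simp_all add: b_def)
      finally show ?thesis by (simp add: dq_diff)
    qed
    then show "zero_order q M (dq q (\<lambda>x. f x - P x))"
      using a by (simp cong: zero_order_cong)
    have "((\<lambda>x. f x - P x) \<longlongrightarrow> L - (L + (\<Sum>i<M. b (Suc i) * of_real 0 ^ Suc i))) (at 0 within Rq q)"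
      unfolding P_eq by (intro tendsto_intros L)
    then show "((\<lambda>x. f x - P x) \<longlongrightarrow> 0) (at 0 within Rq q)" by simp
  qed
  then show ?case unfolding P_def by blast
qed

lemma has_jets_dq:
  assumes "has_jets q f"
  shows "has_jets q (dq q f)"
  unfolding has_jets_def
proof
  fix M
  obtain a where a: "zero_order q (Suc M) (\<lambda>x. f x - (\<Sum>i<Suc M. a i * of_real x ^ i))"
    using assms unfolding has_jets_def by blast
  have "dq q (\<lambda>x. f x - (\<Sum>i<Suc M. a i * of_real x ^ i)) x
     = dq q f x - (\<Sum>i<M. (a (Suc i) * dq_coeff q (Suc i)) * of_real x ^ i)" if "x \<in> Rq q" for x
  proof -
    have "x \<noteq> 0" using that zero_notin_Rq by blast
    have "dq q (\<lambda>x. \<Sum>i<Suc M. a i * of_real x ^ i) x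
      = dq q (\<lambda>x. a 0) x + (\<Sum>i<M. dq q (\<lambda>x. a (Suc i) * of_real x ^ Suc i) x)"
      unfolding dq_sum by (subst sum.lessThan_Suc_shift) simp
    also have "dq q (\<lambda>x. a 0) x = 0" by (simp add: dq_def)
    also have "(\<Sum>i<M. dq q (\<lambda>x. a (Suc i) * of_real x ^ Suc i) x)
       = (\<Sum>i<M. (a (Suc i) * dq_coeff q (Suc i)) * of_real x ^ i)"
      using \<open>x \<noteq> 0\<close> by (intro sum.cong refl) (rule dq_monomial)
    finally show ?thesis by (simp add: dq_diff)
  qed
  then have "zero_order q M (\<lambda>x. dq q f x - (\<Sum>i<M. (a (Suc i) * dq_coeff q (Suc i)) * of_real x ^ i))"
    using zero_order_dq[OF a] by (simp cong: zero_order_cong)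
  then show "\<exists>a. zero_order q M (\<lambda>x. dq q f x - (\<Sum>i<M. a i * of_real x ^ i))"
    by (intro exI[of _ "\<lambda>i. a (Suc i) * dq_coeff q (Suc i)"])
qed

lemma has_jets_bounded:
  assumes "has_jets q f"
  shows "zero_order q 0 f"
proof -
  obtain a where a: "zero_order q 0 (\<lambda>x. f x - (\<Sum>i<0. a i * of_real x ^ i))"
    using assms unfolding has_jets_def by blast
  then show ?thesis by simp
qed

lemma has_jets_tendsto:
  assumes "has_jets q f"
  shows "\<exists>L. (f \<longlongrightarrow> L) (at 0 within Rq q)"
proof -
  obtain a where a: "zero_order q (Suc 0) (\<lambda>x. f x - (\<Sum>i<Suc 0. a i * of_real x ^ i))"
    using assms unfolding has_jets_def by blast
  then have "((\<lambda>x. f x - a 0) \<longlongrightarrow> 0) (at 0 within Rq q)"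
    using zero_order_tendsto_0[OF a] by simp
  then show ?thesis using LIM_zero_cancel by blast
qed

text \<open>For the converse, \<open>dq\<close> preserves jets; the expansion of order 0 of each
  iterate gives boundedness, that of order 1 the limit.\<close>

lemma Eq_space_iff: "f \<in> Eq_space q \<longleftrightarrow> (\<forall>x. x \<notin> Rq q \<longrightarrow> f x = 0) \<and> has_jets q f"
proof
  assume "f \<in> Eq_space q"
  then show "(\<forall>x. x \<notin> Rq q \<longrightarrow> f x = 0) \<and> has_jets q f"
    using Eq_space_has_jet by (auto simp: Eq_space_def has_jets_def)
next
  assume f: "(\<forall>x. x \<notin> Rq q \<longrightarrow> f x = 0) \<and> has_jets q f"
  then have jets: "has_jets q ((dq q ^^ k) f)" for k
    by (induction k) (auto intro: has_jets_dq)
  show "f \<in> Eq_space q"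
    unfolding Eq_space_def mem_Collect_eq
  proof (intro conjI allI impI)
    show "f x = 0" if "x \<notin> Rq q" for x using f that by blast
    show "\<exists>L. ((dq q ^^ n) f \<longlongrightarrow> L) (at 0 within Rq q)" for n
      by (rule has_jets_tendsto[OF jets])
    fix n and a :: real assume "a \<ge> 0"
    have "\<exists>C. \<forall>x\<in>Rq q. \<bar>x\<bar> \<le> a \<longrightarrow> cmod ((dq q ^^ k) f x) \<le> C" for k
      using has_jets_bounded[OF jets[of k]] by (simp add: zero_order_def)
    then obtain C where C: "\<And>k x. x \<in> Rq q \<Longrightarrow> \<bar>x\<bar> \<le> a \<Longrightarrow> cmod ((dq q ^^ k) f x) \<le> C k"
      by metis
    have "cmod ((dq q ^^ k) f x) \<le> (\<Sum>k\<le>n. \<bar>C k\<bar>)" if "x \<in> Rq q" "\<bar>x\<bar> \<le> a" "k \<le> n" for k x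
    proof -
      have "cmod ((dq q ^^ k) f x) \<le> \<bar>C k\<bar>" using C[OF that(1,2), of k] by simp
      also have "\<dots> \<le> (\<Sum>k\<le>n. \<bar>C k\<bar>)" using that(3) by (intro member_le_sum) auto
      finally show ?thesis .
    qed
    then show "bdd_above {cmod ((dq q ^^ k) f x) |k x. k \<le> n \<and> x \<in> {-a..a} \<inter> Rq q}"
      by (intro bdd_aboveI[of _ "\<Sum>k\<le>n. \<bar>C k\<bar>"]) (auto simp: abs_le_iff)
  qed
qed

text \<open>From the first on, the iterated derivatives of \<open>f\<close> are those of
  \<open>dq q f\<close>, so only \<open>f\<close> itself has to be checked. This serves for the
  primitive \<open>J_op\<close>, whose derivative is known.\<close>

lemma Eq_space_of_dq:
  assumes "\<And>x. x \<notin> Rq q \<Longrightarrow> f x = 0" "zero_order q 0 f" "\<exists>L. (f \<longlongrightarrow> L) (at 0 within Rq q)"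
    and dqf: "dq q f \<in> Eq_space q"
  shows "f \<in> Eq_space q"
  unfolding Eq_space_def mem_Collect_eq
proof (intro conjI allI impI)
  show "f x = 0" if "x \<notin> Rq q" for x using assms(1) that .
  have it: "(dq q ^^ Suc k) f = (dq q ^^ k) (dq q f)" for k
    by (simp add: funpow_swap1)
  show "\<exists>L. ((dq q ^^ n) f \<longlongrightarrow> L) (at 0 within Rq q)" for n
  proof (cases n)
    case 0
    then show ?thesis using assms(3) by simp
  next
    case (Suc k)
    then show ?thesis unfolding Suc it using dqf unfolding Eq_space_def by blast
  qed
  fix n and a :: real assume a: "a \<ge> 0"
  obtain C where C: "\<And>x. x \<in> Rq q \<Longrightarrow> \<bar>x\<bar> \<le> a \<Longrightarrow> cmod (f x) \<le> C"
    using assms(2) unfolding zero_order_def power_0 mult_1_right by metis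
  have "bdd_above {cmod ((dq q ^^ k) (dq q f) x) |k x. k \<le> n \<and> x \<in> {-a..a} \<inter> Rq q}"
    using dqf a by (rule Eq_space_bdd)
  then obtain D where D: "\<And>k x. k \<le> n \<Longrightarrow> x \<in> {-a..a} \<inter> Rq q \<Longrightarrow> cmod ((dq q ^^ k) (dq q f) x) \<le> D"
    unfolding bdd_above_def by blast
  have "cmod ((dq q ^^ k) f x) \<le> max C D" if "k \<le> n" "x \<in> {-a..a} \<inter> Rq q" for k x
  proof (cases k)
    case 0
    then show ?thesis using C[of x] that by (auto simp: abs_le_iff)
  next
    case (Suc j)
    then show ?thesis unfolding Suc it using D[of j x] that Suc by auto
  qed
  then show "bdd_above {cmod ((dq q ^^ k) f x) |k x. k \<le> n \<and> x \<in> {-a..a} \<inter> Rq q}"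
    by (intro bdd_aboveI[of _ "max C D"]) blast
qed

section \<open>Closure properties of jets and of test functions\<close>

lemma has_jets_add: "has_jets q f \<Longrightarrow> has_jets q g \<Longrightarrow> has_jets q (\<lambda>x. f x + g x)"
  unfolding has_jets_def
proof
  fix M
  assume "\<forall>M. \<exists>a. zero_order q M (\<lambda>x. f x - (\<Sum>i<M. a i * of_real x ^ i))"
    "\<forall>M. \<exists>a. zero_order q M (\<lambda>x. g x - (\<Sum>i<M. a i * of_real x ^ i))"
  then obtain a b where "zero_order q M (\<lambda>x. f x - (\<Sum>i<M. a i * of_real x ^ i))"
    "zero_order q M (\<lambda>x. g x - (\<Sum>i<M. b i * of_real x ^ i))" by blast
  from zero_order_add[OF this]
  show "\<exists>a. zero_order q M (\<lambda>x. f x + g x - (\<Sum>i<M. a i * of_real x ^ i))"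
    by (intro exI[of _ "\<lambda>i. a i + b i"]) (simp add: algebra_simps sum.distrib)
qed

lemma has_jets_cmult: "has_jets q f \<Longrightarrow> has_jets q (\<lambda>x. c * f x)"
  unfolding has_jets_def
proof
  fix M
  assume "\<forall>M. \<exists>a. zero_order q M (\<lambda>x. f x - (\<Sum>i<M. a i * of_real x ^ i))"
  then obtain a where "zero_order q M (\<lambda>x. f x - (\<Sum>i<M. a i * of_real x ^ i))" by blast
  from zero_order_cmult[OF this, of c]
  show "\<exists>a. zero_order q M (\<lambda>x. c * f x - (\<Sum>i<M. a i * of_real x ^ i))"
    by (intro exI[of _ "\<lambda>i. c * a i"]) (simp add: algebra_simps sum_distrib_left)
qed

lemma has_jets_uminus: "has_jets q f \<Longrightarrow> has_jets q (\<lambda>x. f (- x))"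
  unfolding has_jets_def
proof
  fix M
  assume "\<forall>M. \<exists>a. zero_order q M (\<lambda>x. f x - (\<Sum>i<M. a i * of_real x ^ i))"
  then obtain a where "zero_order q M (\<lambda>x. f x - (\<Sum>i<M. a i * of_real x ^ i))" by blast
  from zero_order_uminus[OF this]
  show "\<exists>a. zero_order q M (\<lambda>x. f (- x) - (\<Sum>i<M. a i * of_real x ^ i))"
    by (intro exI[of _ "\<lambda>i. a i * (- 1) ^ i"]) (simp add: power_minus[of "of_real _"] mult_ac)
qed

lemma Dq_space_iff:
  "f \<in> Dq_space q \<longleftrightarrow>
    (\<forall>x. x \<notin> Rq q \<longrightarrow> f x = 0) \<and> has_jets q f \<and> (\<exists>M. \<forall>x. \<bar>x\<bar> > M \<longrightarrow> f x = 0)"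
  unfolding Dq_space_def mem_Collect_eq Eq_space_iff by blast

lemma Dq_space_add:
  assumes "f \<in> Dq_space q" "g \<in> Dq_space q"
  shows "(\<lambda>x. f x + g x) \<in> Dq_space q"
proof -
  obtain M N where "\<And>x. \<bar>x\<bar> > M \<Longrightarrow> f x = 0" "\<And>x. \<bar>x\<bar> > N \<Longrightarrow> g x = 0"
    using assms unfolding Dq_space_iff by metis
  then have "\<exists>M. \<forall>x. \<bar>x\<bar> > M \<longrightarrow> f x + g x = 0" by (intro exI[of _ "max M N"]) simp
  then show ?thesis using assms has_jets_add[of f g] unfolding Dq_space_iff by simp
qed

lemma Dq_space_cmult:
  assumes "f \<in> Dq_space q"
  shows "(\<lambda>x. c * f x) \<in> Dq_space q"
  using assms has_jets_cmult[of f c] unfolding Dq_space_iff by (auto; metis)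

lemma Dq_space_uminus:
  assumes "f \<in> Dq_space q"
  shows "(\<lambda>x. f (- x)) \<in> Dq_space q"
  using assms has_jets_uminus[of f] unfolding Dq_space_iff by (auto; metis abs_minus_cancel)

lemma Dq_space_dq:
  assumes "f \<in> Dq_space q"
  shows "dq q f \<in> Dq_space q"
proof -
  obtain M where M: "\<And>x. \<bar>x\<bar> > M \<Longrightarrow> f x = 0" using assms unfolding Dq_space_iff by blast
  \<comment> \<open>The division by \<open>q\<close> makes room for \<open>q * x\<close>, the
    innermost argument that occurs.\<close>
  have "dq q f x = 0" if x: "\<bar>x\<bar> > \<bar>M\<bar> / q" for x
  proof -
    have "\<bar>M\<bar> < \<bar>q * x\<bar>" using x q by (simp add: abs_mult field_simps)
    moreover have "\<bar>q * x\<bar> \<le> \<bar>x\<bar>" "\<bar>x\<bar> \<le> \<bar>x / q\<bar>"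
      using q mult_right_mono[of q 1 "\<bar>x\<bar>"] by (auto simp: abs_mult field_simps)
    ultimately show ?thesis by (simp add: dq_eq M)
  qed
  then show ?thesis using assms has_jets_dq dq_outside unfolding Dq_space_iff by blast
qed

lemma Dq_space_0: "(\<lambda>x. 0) \<in> Dq_space q"
proof -
  have "has_jets q (\<lambda>x. 0)"
    by (auto simp: has_jets_def zero_order_def intro!: exI[of _ "\<lambda>_. 0"] exI[of _ 0])
  then show ?thesis by (simp add: Dq_space_iff)
qed

lemma even_part_Dq: "f \<in> Dq_space q \<Longrightarrow> even_part f \<in> Dq_even_space q"
  using Dq_space_cmult[OF Dq_space_add[OF _ Dq_space_uminus], of f f "1/2"]
  by (simp add: Dq_even_space_def even_part_even) (simp add: even_part_def[abs_def])

lemma odd_part_Dq: "f \<in> Dq_space q \<Longrightarrow> odd_part f \<in> Dq_space q"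
  using Dq_space_cmult[OF Dq_space_add[OF _ Dq_space_cmult[OF Dq_space_uminus]], of f f "1/2" "-1"]
  by (simp add: odd_part_def[abs_def])

end

subsection \<open>Even functions as power series\<close>

text \<open>The index runs inward from the outermost point \<open>q powi (- K)\<close> of the
  support, so that the neighbour outside index 0 lies beyond the support.\<close>

definition grid :: "real \<Rightarrow> int \<Rightarrow> nat \<Rightarrow> real" where
  "grid q K n = q powi (int n - K)"

text \<open>Vanishing off \<open>Rq q\<close> is included, so that such a function is determined by
  its values at the grid points and their negatives.\<close>

definition supported_on :: "real \<Rightarrow> int \<Rightarrow> (real \<Rightarrow> complex) \<Rightarrow> bool" where
  "supported_on q K f \<longleftrightarrow> (\<forall>x. \<bar>x\<bar> > q powi (- K) \<longrightarrow> f x = 0) \<and> (\<forall>x. x \<notin> Rq q \<longrightarrow> f x = 0)"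

definition grid_fps :: "real \<Rightarrow> int \<Rightarrow> (real \<Rightarrow> complex) \<Rightarrow> complex fps" where
  "grid_fps q K f = Abs_fps (\<lambda>n. f (grid q K n))"

lemma grid_fps_nth [simp]: "grid_fps q K f $ n = f (grid q K n)"
  by (simp add: grid_fps_def)

text \<open>The even function with prescribed values on the grid; it supplies preimages under the
  Weyl operator.\<close>

definition grid_fun :: "real \<Rightarrow> int \<Rightarrow> complex fps \<Rightarrow> real \<Rightarrow> complex" where
  "grid_fun q K U x = (if \<exists>n. \<bar>x\<bar> = grid q K n then U $ (THE n. \<bar>x\<bar> = grid q K n) else 0)"

context
  fixes q :: real
  assumes q: "0 < q" "q < 1"
begin

lemma q2: "0 < q\<^sup>2" "q\<^sup>2 < 1"
  using q by (auto simp: power_less_one_iff)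

lemma grid_pos: "grid q K n > 0"
  using q by (simp add: grid_def)

lemma grid_in_Rq [simp]: "grid q K n \<in> Rq q"
  by (auto simp: grid_def Rq_def)

lemma grid_eq: "grid q K n = q powi (- K) * q ^ n"
  using q by (simp add: grid_def power_int_diff power_int_minus divide_inverse)

lemma grid_Suc: "grid q K (Suc n) = q * grid q K n"
  by (simp add: grid_eq)

lemma grid_less_iff: "grid q K m < grid q K n \<longleftrightarrow> n < m"
  using q by (simp add: grid_eq)

lemma grid_inj [simp]: "grid q K m = grid q K n \<longleftrightarrow> m = n"
  by (metis grid_less_iff less_irrefl linorder_neqE_nat)

lemma grid_le: "grid q K n \<le> q powi (- K)"
  using q by (simp add: grid_eq mult_left_le power_le_one)

lemma power_int_less_iff: "q powi m < q powi n \<longleftrightarrow> n < m"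
  using q power_int_strict_decreasing[of n m q] power_int_strict_decreasing[of m n q]
  by (metis linorder_neqE_linordered_idom order_less_asym)

lemma Rq_cases:
  assumes "x \<in> Rq q"
  obtains (large) k :: int where "\<bar>x\<bar> = q powi k" "\<bar>x\<bar> > q powi (- K)" "k < - K"
  | (grid) n where "\<bar>x\<bar> = grid q K n"
proof -
  obtain k :: int where k: "\<bar>x\<bar> = q powi k" using assms q by (auto simp: Rq_def)
  show ?thesis
  proof (cases "k < - K")
    case True
    then show ?thesis using large[OF k] k by (simp add: power_int_less_iff)
  next
    case False
    then have "\<bar>x\<bar> = grid q K (nat (k + K))" using k by (simp add: grid_def)
    then show ?thesis by (rule grid)
  qed
qed

lemma supported_onD: "supported_on q K f \<Longrightarrow> \<bar>x\<bar> > q powi (- K) \<Longrightarrow> f x = 0"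
  by (simp add: supported_on_def)

lemma supported_on_outside: "supported_on q K f \<Longrightarrow> x \<notin> Rq q \<Longrightarrow> f x = 0"
  by (simp add: supported_on_def)

lemma supported_on_ext:
  assumes "supported_on q K f" "supported_on q K g"
    and "\<And>n. f (grid q K n) = g (grid q K n)" "\<And>n. f (- grid q K n) = g (- grid q K n)"
  shows "f = g"
proof
  fix x
  show "f x = g x"
  proof (cases "x \<in> Rq q")
    case True
    then show ?thesis
    proof (cases rule: Rq_cases[where K = K])
      case (grid n)
      then have "x = grid q K n \<or> x = - grid q K n" by linarith
      then show ?thesis using assms(3,4) by auto
    qed (use assms(1,2) supported_onD in metis)
  qed (use assms(1,2) supported_on_outside in metis)
qed

lemma supported_on_ext_even:
  assumes "supported_on q K f" "supported_on q K g" "\<And>x. f (- x) = f x" "\<And>x. g (- x) = g x"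
    and "grid_fps q K f = grid_fps q K g"
  shows "f = g"
  using assms(1,2)
proof (rule supported_on_ext)
  show *: "f (grid q K n) = g (grid q K n)" for n
    using arg_cong[OF assms(5), of "\<lambda>U. U $ n"] by simp
  show "f (- grid q K n) = g (- grid q K n)" for n
    by (simp add: assms(3,4) *)
qed

lemma supported_on_mono:
  assumes "supported_on q K f" "K \<le> L"
  shows "supported_on q L f"
proof -
  have "q powi (- K) \<le> q powi (- L)"
    using power_int_less_iff[of "- K" "- L"] assms(2) by (cases "K = L") auto
  then show ?thesis using assms(1) unfolding supported_on_def by fastforce
qed

lemma supported_on_add:
  "supported_on q K f \<Longrightarrow> supported_on q K g \<Longrightarrow> supported_on q K (\<lambda>x. f x + g x)"
  by (simp add: supported_on_def)

lemma supported_on_cmult: "supported_on q K f \<Longrightarrow> supported_on q K (\<lambda>x. c * f x)"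
  by (simp add: supported_on_def)

lemma supported_on_even_part: "supported_on q K f \<Longrightarrow> supported_on q K (even_part f)"
  by (simp add: supported_on_def even_part_def)

lemma Dq_space_supported:
  assumes "f \<in> Dq_space q"
  shows "\<exists>K. supported_on q K f"
proof -
  obtain M where M: "\<And>x. \<bar>x\<bar> > M \<Longrightarrow> f x = 0" "\<And>x. x \<notin> Rq q \<Longrightarrow> f x = 0"
    using assms unfolding Dq_space_iff[OF q] by blast
  obtain k where k: "M < inverse q ^ k"
    using real_arch_pow[of "inverse q" M] q by (auto simp: one_less_inverse_iff)
  have "supported_on q (int k) f"
    unfolding supported_on_def using M k by (auto simp: power_int_minus power_inverse)
  then show ?thesis by blast
qed

lemma Dq_space_supported2:
  assumes "f \<in> Dq_space q" "g \<in> Dq_space q"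
  obtains K where "supported_on q K f" "supported_on q K g"
proof -
  obtain K L where "supported_on q K f" "supported_on q L g"
    using assms Dq_space_supported by blast
  then show ?thesis
    using that[of "max K L"] supported_on_mono[of _ _ "max K L"] by simp
qed

lemma Dq_spaceI: "supported_on q K f \<Longrightarrow> has_jets q f \<Longrightarrow> f \<in> Dq_space q"
  unfolding Dq_space_iff[OF q] supported_on_def by blast

lemma grid_fun_grid: "grid_fun q K U (grid q K n) = U $ n" "grid_fun q K U (- grid q K n) = U $ n"
  using grid_pos[of K n] by (simp_all add: grid_fun_def)

lemma grid_fps_grid_fun: "grid_fps q K (grid_fun q K U) = U"
  by (rule fps_ext) (simp add: grid_fun_grid)

lemma grid_fun_even: "grid_fun q K U (- x) = grid_fun q K U x"
  by (simp add: grid_fun_def)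

lemma grid_fun_supported: "supported_on q K (grid_fun q K U)"
  unfolding supported_on_def
proof (intro conjI allI impI)
  show "grid_fun q K U x = 0" if "\<bar>x\<bar> > q powi (- K)" for x
    using that grid_le[of K] unfolding grid_fun_def by (metis not_less)
  show "grid_fun q K U x = 0" if "x \<notin> Rq q" for x
  proof -
    have "\<bar>x\<bar> \<noteq> grid q K n" for n
      using that grid_in_Rq[of K n] by (metis abs_if uminus_Rq_iff)
    then show ?thesis by (simp add: grid_fun_def)
  qed
qed

lemma zero_order_sum:
  assumes "\<And>i. i \<in> A \<Longrightarrow> zero_order q M (f i)"
  shows "zero_order q M (\<lambda>x. \<Sum>i\<in>A. f i x)"
  using assms
proof (induction A rule: infinite_finite_induct)
  case (insert a A)
  then show ?case by (simp add: zero_order_add[OF q])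
qed (auto simp: zero_order_def intro!: exI[of _ 0])

text \<open>Even orders suffice: in the expansion of order \<open>2 * M\<close> the terms of degree
  at least \<open>M\<close> can be moved into the error.\<close>

lemma has_jetsI:
  assumes "\<And>N. \<exists>a. zero_order q (2 * N) (\<lambda>x. f x - (\<Sum>i<2 * N. a i * of_real x ^ i))"
  shows "has_jets q f"
  unfolding has_jets_def
proof
  fix M
  obtain a where a: "zero_order q (2 * M) (\<lambda>x. f x - (\<Sum>i<2 * M. a i * of_real x ^ i))"
    using assms by blast
  have "zero_order q M (\<lambda>x. \<Sum>i\<in>{M..<2 * M}. a i * of_real x ^ i)"
    by (intro zero_order_sum zero_order_cmult[OF q] zero_order_power[OF q]) auto
  moreover have "zero_order q M (\<lambda>x. f x - (\<Sum>i<2 * M. a i * of_real x ^ i))"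
    by (rule zero_order_mono[OF q a]) simp
  ultimately have "zero_order q M (\<lambda>x. (f x - (\<Sum>i<2 * M. a i * of_real x ^ i))
      + (\<Sum>i\<in>{M..<2 * M}. a i * of_real x ^ i))"
    by (intro zero_order_add[OF q])
  moreover have "(\<Sum>i<2 * M. a i * of_real x ^ i) = (\<Sum>i<M. a i * of_real x ^ i)
      + (\<Sum>i\<in>{M..<2 * M}. a i * of_real x ^ i)" for x :: real
    by (subst sum.union_disjoint[symmetric]) (auto intro: sum.cong)
  ultimately show "\<exists>a. zero_order q M (\<lambda>x. f x - (\<Sum>i<M. a i * of_real x ^ i))"
    by (intro exI[of _ a]) simp
qed

text \<open>For \<open>\<bar>x\<bar> > \<delta>\<close> the power \<open>\<bar>x\<bar> ^ M\<close>
  is at least \<open>\<delta> ^ M\<close>, so local boundedness already gives the bound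
  there.\<close>

lemma zero_order_local:
  assumes "zero_order q 0 f" "\<delta> > 0"
    and C: "\<And>x. x \<in> Rq q \<Longrightarrow> \<bar>x\<bar> \<le> \<delta> \<Longrightarrow> cmod (f x) \<le> C * \<bar>x\<bar> ^ M"
  shows "zero_order q M f"
proof (rule zero_orderI[OF q])
  fix B
  obtain D where D: "D \<ge> 0" "\<And>x. x \<in> Rq q \<Longrightarrow> \<bar>x\<bar> \<le> B \<Longrightarrow> cmod (f x) \<le> D * \<bar>x\<bar> ^ 0"
    using zero_orderE[OF q assms(1)] by metis
  have "cmod (f x) \<le> max C (D / \<delta> ^ M) * \<bar>x\<bar> ^ M" if x: "x \<in> Rq q" "\<bar>x\<bar> \<le> B" for x
  proof (cases "\<bar>x\<bar> \<le> \<delta>")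
    case True
    then have "cmod (f x) \<le> C * \<bar>x\<bar> ^ M" using C x by blast
    also have "\<dots> \<le> max C (D / \<delta> ^ M) * \<bar>x\<bar> ^ M" by (intro mult_right_mono) auto
    finally show ?thesis .
  next
    case False
    have "cmod (f x) \<le> D / \<delta> ^ M * \<delta> ^ M" using D(2)[OF x] assms(2) by simp
    also have "\<dots> \<le> D / \<delta> ^ M * \<bar>x\<bar> ^ M"
      using D(1) assms(2) False by (intro mult_left_mono power_mono) auto
    also have "\<dots> \<le> max C (D / \<delta> ^ M) * \<bar>x\<bar> ^ M" by (intro mult_right_mono) auto
    finally show ?thesis .
  qed
  then show "\<exists>C. \<forall>x\<in>Rq q. \<bar>x\<bar> \<le> B \<longrightarrow> cmod (f x) \<le> C * \<bar>x\<bar> ^ M" by blast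
qed

lemma sum_even_powers:
  fixes a :: "nat \<Rightarrow> complex"
  shows "(\<Sum>i<2 * N. (if even i then a (i div 2) else 0) * z ^ i) = (\<Sum>j<N. a j * z ^ (2 * j))"
  by (induction N) auto

text \<open>The dictionary between functions and series: an even monomial restricted to the grid is
  a geometric sequence of ratio \<open>(q\<^sup>2) ^ j\<close>.\<close>

lemma grid_even_power: "complex_of_real (grid q K n) ^ (2 * j)
    = of_real ((q powi (- K)) ^ (2 * j)) * of_real ((q\<^sup>2) ^ j) ^ n"
  by (simp add: grid_eq power_mult_distrib flip: power_mult of_real_power) (simp add: mult_ac)

lemma grid_diff_nth:
  "(grid_fps q K f - (\<Sum>j<(N::nat). fps_const (a j * of_real ((q powi (- K)) ^ (2 * j))) * geo ((q\<^sup>2) ^ j))) $ n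
    = f (grid q K n) - (\<Sum>j<N. a j * of_real (grid q K n) ^ (2 * j))"
  by (simp add: fps_sum_nth grid_even_power mult.assoc)

text \<open>For even \<open>f\<close>, averaging the Taylor polynomial over \<open>x\<close> and
  \<open>- x\<close> keeps the order of the error and leaves only even powers. On the grid these are
  geometric sequences, which the \<open>lin\<close> factors reduce to polynomials.\<close>

lemma Dq_imp_smooth_fps:
  assumes f: "f \<in> Dq_space q" and even: "\<And>x. f (- x) = f x"
  shows "smooth_fps (q\<^sup>2) 1 (grid_fps q K f)"
  unfolding smooth_fps_def mult_1_left
proof
  fix N
  obtain a where a: "zero_order q (2 * N) (\<lambda>x. f x - (\<Sum>i<2 * N. a i * of_real x ^ i))"
    using f unfolding Dq_space_iff[OF q] has_jets_def by blast
  have P: "even_part (\<lambda>x. \<Sum>i<2 * N. a i * of_real x ^ i) x = (\<Sum>j<N. a (2 * j) * of_real x ^ (2 * j))"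
    for x :: real
    unfolding even_part_def sum.distrib[symmetric] sum_divide_distrib sum_even_powers[symmetric]
    by (intro sum.cong) auto
  have "even_part (\<lambda>x. f x - g x) x = f x - even_part g x" for g x
    by (simp add: even_part_def even diff_divide_distrib add_divide_distrib)
  then have "even_part (\<lambda>x. f x - (\<Sum>i<2 * N. a i * of_real x ^ i))
      = (\<lambda>x. f x - even_part (\<lambda>x. \<Sum>i<2 * N. a i * of_real x ^ i) x)"
    by (intro ext)
  also have "\<dots> = (\<lambda>x. f x - (\<Sum>j<N. a (2 * j) * of_real x ^ (2 * j)))"
    unfolding P ..
  finally have "even_part (\<lambda>x. f x - (\<Sum>i<2 * N. a i * of_real x ^ i))
      = (\<lambda>x. f x - (\<Sum>j<N. a (2 * j) * of_real x ^ (2 * j)))" .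
  then have "zero_order q (2 * N) (\<lambda>x. f x - (\<Sum>j<N. a (2 * j) * of_real x ^ (2 * j)))"
    using zero_order_even_part[OF q a] by (simp only:)
  then obtain C where C: "C \<ge> 0" "\<And>x. x \<in> Rq q \<Longrightarrow> \<bar>x\<bar> \<le> q powi (- K) \<Longrightarrow>
      cmod (f x - (\<Sum>j<N. a (2 * j) * of_real x ^ (2 * j))) \<le> C * \<bar>x\<bar> ^ (2 * N)"
    by (rule zero_orderE[OF q, where B = "q powi (- K)"]; blast)
  have "geo_bounded ((q\<^sup>2) ^ N) (grid_fps q K f
     - (\<Sum>j<N. fps_const (a (2 * j) * of_real ((q powi (- K)) ^ (2 * j))) * geo ((q\<^sup>2) ^ j)))"
    unfolding geo_bounded_def grid_diff_nth
  proof (intro exI allI)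
    fix n
    have "cmod (f (grid q K n) - (\<Sum>j<N. a (2 * j) * of_real (grid q K n) ^ (2 * j)))
        \<le> C * \<bar>grid q K n\<bar> ^ (2 * N)"
      using grid_pos[of K n] by (intro C(2)) (auto simp: grid_le)
    also have "\<bar>grid q K n\<bar> ^ (2 * N) = (q powi (- K)) ^ (2 * N) * ((q\<^sup>2) ^ N) ^ n"
      using q by (simp add: grid_eq abs_mult power_mult_distrib flip: power_mult) (simp add: mult_ac)
    finally show "cmod (f (grid q K n) - (\<Sum>j<N. a (2 * j) * of_real (grid q K n) ^ (2 * j)))
       \<le> C * (q powi (- K)) ^ (2 * N) * ((q\<^sup>2) ^ N) ^ n"
      by (simp add: mult.assoc)
  qed
  then show "geo_bounded ((q\<^sup>2) ^ N) ((\<Prod>i<N. lin ((q\<^sup>2) ^ i)) * grid_fps q K f)"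
    by (rule geo_bounded_of_expansion) (use q in auto)
qed

text \<open>The growth condition gives a geometric expansion on the grid, which is read back as an
  even polynomial. Beyond the support \<open>f\<close> vanishes but the polynomial need not, so the
  estimate for \<open>\<bar>x\<bar> \<le> y\<close> is extended by
  \<open>zero_order_local\<close>.\<close>

lemma smooth_fps_imp_Dq:
  assumes supp: "supported_on q K f" and even: "\<And>x. f (- x) = f x"
    and smooth: "smooth_fps (q\<^sup>2) 1 (grid_fps q K f)"
  shows "f \<in> Dq_space q"
proof (rule Dq_spaceI[OF supp], rule has_jetsI)
  fix N
  have grid_bound: "cmod (h x) \<le> C"
    if "\<And>n. cmod (h (grid q K n)) \<le> C" "\<And>x. h (- x) = h x" "\<bar>x\<bar> = grid q K n" for h :: "real \<Rightarrow> complex" and x n C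
  proof -
    have "x = grid q K n \<or> x = - grid q K n" using that(3) by linarith
    then show ?thesis using that(1)[of n] that(2) by auto
  qed
  have bounded: "zero_order q 0 f"
  proof (rule zero_orderI[OF q])
    fix B
    have "geo_bounded ((q\<^sup>2) ^ 0) ((\<Prod>i<0. lin ((q\<^sup>2) ^ i)) * grid_fps q K f)"
      using smooth unfolding smooth_fps_def mult_1_left by blast
    then obtain C where C: "C \<ge> 0" "\<And>n. cmod (f (grid q K n)) \<le> C"
      using geo_boundedE[of 1 "grid_fps q K f"] by auto
    have "cmod (f x) \<le> C * \<bar>x\<bar> ^ 0" if "x \<in> Rq q" for x
      using that
    proof (cases rule: Rq_cases[where K = K])
      case large
      then show ?thesis using supported_onD[OF supp] C(1) by simp
    next
      case (grid n)
      then show ?thesis using grid_bound[of f C x n] C(2) even by simp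
    qed
    then show "\<exists>C. \<forall>x\<in>Rq q. \<bar>x\<bar> \<le> B \<longrightarrow> cmod (f x) \<le> C * \<bar>x\<bar> ^ 0" by blast
  qed
  have "inj_on (\<lambda>i. (q\<^sup>2) ^ i) {..<N}"
    using q2 by (auto simp: inj_on_def power_inject_exp')
  moreover have "(q\<^sup>2) ^ N < (q\<^sup>2) ^ i" if "i < N" for i
    using q2 that by (intro power_strict_decreasing) auto
  ultimately obtain b where b: "geo_bounded ((q\<^sup>2) ^ N) (grid_fps q K f - (\<Sum>i<N. fps_const (b i) * geo ((q\<^sup>2) ^ i)))"
    using geo_expansion[where \<rho> = "(q\<^sup>2) ^ N" and N = N and c = "\<lambda>i. (q\<^sup>2) ^ i" and U = "grid_fps q K f"] smooth q2
    unfolding smooth_fps_def mult_1_left by auto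
  define y where "y = q powi (- K)"
  have y: "y > 0" using q by (simp add: y_def)
  \<comment> \<open>The denominator is the value of \<open>x ^ (2 * j)\<close> at the outermost grid
    point.\<close>
  define a where "a j = b j / of_real (y ^ (2 * j))" for j
  have "b j = a j * of_real ((q powi (- K)) ^ (2 * j))" for j
    using y by (simp add: a_def flip: y_def)
  then have "geo_bounded ((q\<^sup>2) ^ N) (grid_fps q K f
     - (\<Sum>j<N. fps_const (a j * of_real ((q powi (- K)) ^ (2 * j))) * geo ((q\<^sup>2) ^ j)))"
    using b by simp
  then obtain C where
    C: "\<And>n. cmod (f (grid q K n) - (\<Sum>j<N. a j * of_real (grid q K n) ^ (2 * j))) \<le> C * ((q\<^sup>2) ^ N) ^ n"
    unfolding geo_bounded_def grid_diff_nth by blast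
  define h where "h x = f x - (\<Sum>j<N. a j * of_real x ^ (2 * j))" for x
  have "zero_order q (2 * N) h"
  proof (rule zero_order_local)
    show "zero_order q 0 h"
      unfolding h_def
      by (intro zero_order_diff[OF q] bounded zero_order_sum zero_order_cmult[OF q] zero_order_power[OF q]) auto
    show "y > 0" by fact
    fix x assume x: "x \<in> Rq q" "\<bar>x\<bar> \<le> y"
    from x(1) show "cmod (h x) \<le> C / y ^ (2 * N) * \<bar>x\<bar> ^ (2 * N)"
    proof (cases rule: Rq_cases[where K = K])
      case large
      then show ?thesis using x(2) by (simp add: y_def)
    next
      case (grid n)
      have hev: "h (- x) = h x" by (simp add: h_def even)
      have "x = grid q K n \<or> x = - grid q K n" using grid by linarith
      then have "h x = h (grid q K n)" using hev by auto
      then have "cmod (h x) \<le> C * ((q\<^sup>2) ^ N) ^ n" using C[of n] by (simp add: h_def)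
      also have "((q\<^sup>2) ^ N) ^ n = \<bar>x\<bar> ^ (2 * N) / y ^ (2 * N)"
        using y by (simp add: grid grid_eq power_mult_distrib flip: power_mult y_def) (simp add: mult_ac)
      finally show ?thesis by simp
    qed
  qed
  then have "zero_order q (2 * N) (\<lambda>x. f x - (\<Sum>i<2 * N. (if even i then a (i div 2) else 0) * of_real x ^ i))"
    unfolding h_def[abs_def] sum_even_powers .
  then show "\<exists>a. zero_order q (2 * N) (\<lambda>x. f x - (\<Sum>i<2 * N. a i * of_real x ^ i))"
    by (intro exI[of _ "\<lambda>i. if even i then a (i div 2) else 0"])
qed

text \<open>Starting at exponent -1 cancels the factor \<open>q\<close> in the lower limit, so the
  innermost node is \<open>grid q K n\<close>; nodes outside \<open>grid q K 0\<close> lie beyond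
  the support.\<close>

lemma jackson_Ici_grid:
  assumes "\<And>x. x > q powi (- K) \<Longrightarrow> h x = 0"
  shows "jackson_Ici q (q * grid q K n) h = of_real (1 - q) * (\<Sum>i\<le>n. of_real (grid q K i) * h (grid q K i))"
proof -
  define F where "F m = complex_of_real (q powi m) * h (q * grid q K n * q powi m)" for m
  have pt: "q * grid q K n * q powi m = q powi (int n - K + 1 + m)" for m
    using q by (simp add: grid_def power_int_add power_int_diff)
  have "(\<Sum>\<^sub>\<infinity>m\<in>{..-1::int}. F m) = (\<Sum>\<^sub>\<infinity>m\<in>{- 1 - int n..-1}. F m)"
  proof (rule infsum_cong_neutral)
    fix m assume "m \<in> {..-1} - {- 1 - int n..-1}"
    then have "q * grid q K n * q powi m > q powi (- K)"
      unfolding pt power_int_less_iff by auto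
    then show "F m = 0" by (simp add: F_def assms)
  qed auto
  also have "\<dots> = (\<Sum>m\<in>{- 1 - int n..-1}. F m)" by simp
  \<comment> \<open>Exponent -1 belongs to \<open>grid q K n\<close>, exponent
    \<open>- 1 - n\<close> to \<open>grid q K 0\<close>.\<close>
  also have "\<dots> = (\<Sum>i\<le>n. F (int i - int n - 1))"
    by (rule sum.reindex_bij_witness[of _ "\<lambda>i. int i - int n - 1" "\<lambda>m. nat (m + int n + 1)"]) auto
  finally have "jackson_Ici q (q * grid q K n) h
      = (\<Sum>i\<le>n. of_real ((1 - q) * (q * grid q K n)) * F (int i - int n - 1))"
    by (simp add: jackson_Ici_def F_def sum_distrib_left)
  also have "\<dots> = (\<Sum>i\<le>n. of_real (1 - q) * (of_real (grid q K i) * h (grid q K i)))"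
  proof (rule sum.cong)
    fix i
    have "q * grid q K n * q powi (int i - int n - 1) = grid q K i"
      unfolding pt by (simp add: grid_def)
    then show "of_real ((1 - q) * (q * grid q K n)) * F (int i - int n - 1)
        = of_real (1 - q) * (of_real (grid q K i) * h (grid q K i))"
      unfolding F_def by (metis (no_types, lifting) mult.assoc of_real_mult)
  qed simp
  finally show ?thesis by (simp add: sum_distrib_left)
qed

lemma jackson_Ici_beyond_support:
  assumes "\<And>x. x > q powi (- K) \<Longrightarrow> h x = 0" "k < - K"
  shows "jackson_Ici q (q * q powi k) h = 0"
proof -
  have "h (q * q powi k * q powi m) = 0" if "m \<le> -1" for m
  proof (rule assms(1))
    have "q * q powi k * q powi m = q powi (k + 1 + m)"
      using q by (simp add: power_int_add)
    then show "q powi (- K) < q * q powi k * q powi m"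
      using that assms(2) by (simp add: power_int_less_iff)
  qed
  then have "(\<Sum>\<^sub>\<infinity>m\<in>{..-1::int}. of_real (q powi m) * h (q * q powi k * q powi m)) = 0"
    by (intro infsum_0) auto
  then show ?thesis by (simp only: jackson_Ici_def mult_zero_right)
qed

end

subsection \<open>The Weyl operator\<close>

text \<open>The exponent is that of the density \<open>x powr (2 * \<alpha>)\<close> times the
  factor \<open>x\<close> of the Jackson sum. The same number is the parameter in the denominator of
  \<open>W_kernel\<close>, so the zeros of the kernel series match the dilated rates.\<close>

definition weyl_base :: "real \<Rightarrow> real \<Rightarrow> real" where
  "weyl_base \<alpha> q = q powr (2 * \<alpha> + 1)"

definition weyl_factor :: "real \<Rightarrow> real \<Rightarrow> real" where
  "weyl_factor \<alpha> q = (1 + q) powr (- \<alpha> + 1/2) / Gamma_q2 q (\<alpha> + 1/2)"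

text \<open>All that does not depend on the grid index; the last factor is the effect of the offset
  \<open>K\<close> on the weight.\<close>

definition weyl_const :: "real \<Rightarrow> real \<Rightarrow> int \<Rightarrow> real" where
  "weyl_const \<alpha> q K =
     weyl_factor \<alpha> q * (1 - q) * W_kernel \<alpha> q 1 * weyl_base \<alpha> q powi (- K)"

context
  fixes q \<alpha> :: real
  assumes q: "0 < q" "q < 1" and \<alpha>: "\<alpha> > - 1/2"
begin

lemma weyl_base_pos: "0 < weyl_base \<alpha> q" and weyl_base_less_1: "weyl_base \<alpha> q < 1"
  using q \<alpha> powr_less_mono2[of "2 * \<alpha> + 1" q 1] by (auto simp: weyl_base_def)

lemma weyl_factor_nonzero: "weyl_factor \<alpha> q \<noteq> 0"
proof -
  have "q powr (2 * (\<alpha> + 1/2)) = weyl_base \<alpha> q"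
    by (simp add: weyl_base_def distrib_left)
  then have "Gamma_q2 q (\<alpha> + 1/2) \<noteq> 0"
    using qpoch_inf_pos[OF q2[OF q] weyl_base_pos weyl_base_less_1]
      qpoch_inf_pos[OF q2[OF q] q2[OF q]] q2[OF q]
    by (simp add: Gamma_q2_def)
  then show ?thesis using q by (simp add: weyl_factor_def)
qed

text \<open>At \<open>t = q ^ m\<close> both infinite products start \<open>m\<close> factors later.
  Relative to the value at 1 this leaves \<open>(p; Q)\<^sub>m / (Q; Q)\<^sub>m\<close>, a
  coefficient of the \<open>q\<close>-binomial series.\<close>

lemma W_kernel_power:
  "complex_of_real (W_kernel \<alpha> q (q ^ m))
    = of_real (W_kernel \<alpha> q 1) * qbin (q\<^sup>2) (weyl_base \<alpha> q) 1 $ m"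
proof -
  have 1: "(q ^ m)\<^sup>2 * q\<^sup>2 = q\<^sup>2 * (q\<^sup>2) ^ m" "(q ^ m)\<^sup>2 * q powr (2 * \<alpha> + 1) = weyl_base \<alpha> q * (q\<^sup>2) ^ m"
    by (simp_all add: weyl_base_def mult.commute flip: power_mult)
  have A: "qpoch_inf (q\<^sup>2) (q\<^sup>2) = qpoch_inf (q\<^sup>2 * (q\<^sup>2) ^ m) (q\<^sup>2) * (\<Prod>i<m. 1 - (q\<^sup>2) ^ Suc i)"
    using qpoch_inf_split[OF q2[OF q] q2[OF q], of m] by simp
  have B: "qpoch_inf (weyl_base \<alpha> q) (q\<^sup>2)
      = qpoch_inf (weyl_base \<alpha> q * (q\<^sup>2) ^ m) (q\<^sup>2) * (\<Prod>i<m. 1 - weyl_base \<alpha> q * (q\<^sup>2) ^ i)"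
    by (rule qpoch_inf_split[OF q2[OF q] weyl_base_pos weyl_base_less_1])
  have "qpoch_inf (q\<^sup>2) (q\<^sup>2) > 0" "qpoch_inf (weyl_base \<alpha> q) (q\<^sup>2) > 0"
    by (auto intro!: qpoch_inf_pos[OF q2[OF q]] q2[OF q] weyl_base_pos weyl_base_less_1)
  then have nz: "(\<Prod>i<m. 1 - (q\<^sup>2) ^ Suc i) \<noteq> 0" "(\<Prod>i<m. 1 - weyl_base \<alpha> q * (q\<^sup>2) ^ i) \<noteq> 0"
    "qpoch_inf (weyl_base \<alpha> q * (q\<^sup>2) ^ m) (q\<^sup>2) \<noteq> 0"
    unfolding A B by (metis less_irrefl mult_zero_right, metis less_irrefl mult_zero_right, metis less_irrefl mult_zero_left)
  have *: "X / Y = X * P / (Y * R) * (R / P)" if "P \<noteq> 0" "R \<noteq> 0" for X Y P R :: real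
    using that by (simp add: field_simps)
  have "W_kernel \<alpha> q (q ^ m) = W_kernel \<alpha> q 1 *
      ((\<Prod>i<m. 1 - weyl_base \<alpha> q * (q\<^sup>2) ^ i) / (\<Prod>i<m. 1 - (q\<^sup>2) ^ Suc i))"
    unfolding W_kernel_def 1 power_one mult_1_left unfolding weyl_base_def[symmetric]
    unfolding A B using nz(1,2) by (rule *)
  then show ?thesis by (simp only: qbin_nth of_real_mult)
qed

lemma W_kernel_uminus: "W_kernel \<alpha> q (- t) = W_kernel \<alpha> q t"
  by (simp add: W_kernel_def)

lemma W_kernel_1_nonzero: "W_kernel \<alpha> q 1 \<noteq> 0"
proof -
  have "qpoch_inf (q\<^sup>2) (q\<^sup>2) > 0" "qpoch_inf (weyl_base \<alpha> q) (q\<^sup>2) > 0"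
    by (auto intro!: qpoch_inf_pos[OF q2[OF q]] q2[OF q] weyl_base_pos weyl_base_less_1)
  then show ?thesis by (simp add: W_kernel_def weyl_base_def)
qed

lemma weyl_const_nonzero: "weyl_const \<alpha> q K \<noteq> 0"
  using weyl_factor_nonzero W_kernel_1_nonzero weyl_base_pos q by (simp add: weyl_const_def)

lemma grid_divide:
  assumes "i \<le> n"
  shows "grid q K n / grid q K i = q ^ (n - i)"
  using assms q by (simp add: grid_eq[OF q] power_diff)

lemma grid_powr: "grid q K i * grid q K i powr (2 * \<alpha>) = weyl_base \<alpha> q powi (- K) * weyl_base \<alpha> q ^ i"
proof -
  have "grid q K i * grid q K i powr (2 * \<alpha>) = grid q K i powr (2 * \<alpha> + 1)"
    using grid_pos[OF q, of K i] by (simp add: powr_add)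
  also have "\<dots> = q powr (of_int (int i - K) * (2 * \<alpha> + 1))"
    using q by (simp add: grid_def powr_powr flip: powr_real_of_int')
  also have "\<dots> = weyl_base \<alpha> q powi (int i - K)"
    using q by (simp add: weyl_base_def powr_powr mult.commute flip: powr_real_of_int')
  also have "\<dots> = weyl_base \<alpha> q powi (- K) * weyl_base \<alpha> q ^ i"
    using weyl_base_pos by (simp add: power_int_diff power_int_minus divide_inverse)
  finally show ?thesis .
qed

text \<open>Up to sign \<open>t / x\<close> is \<open>q ^ (n - i)\<close>, the kernel is even, and
  the sum runs over \<open>i \<le> n\<close>: this is a coefficient of a Cauchy product.\<close>

lemma q_Weyl_grid:
  assumes supp: "supported_on q K f" and t: "\<bar>t\<bar> = grid q K n"
  shows "q_Weyl \<alpha> q f t = of_real (weyl_const \<alpha> q K) *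
    (qbin (q\<^sup>2) (weyl_base \<alpha> q) 1 * dilate (weyl_base \<alpha> q) (grid_fps q K f)) $ n"
proof -
  have t': "t = grid q K n \<or> t = - grid q K n" using t by linarith
  then have "t \<in> Rq q" using grid_in_Rq[OF q, of K n] by auto
  then have "q_Weyl \<alpha> q f t = of_real (weyl_factor \<alpha> q) * (of_real (1 - q) *
     (\<Sum>i\<le>n. of_real (grid q K i) *
        (of_real (W_kernel \<alpha> q (t / grid q K i)) * f (grid q K i) * of_real (grid q K i powr (2 * \<alpha>)))))"
    unfolding q_Weyl_def t weyl_factor_def[symmetric]
    by (subst jackson_Ici_grid[OF q]) (use supp in \<open>auto simp: supported_on_def\<close>)
  also have "(\<Sum>i\<le>n. of_real (grid q K i) *
        (of_real (W_kernel \<alpha> q (t / grid q K i)) * f (grid q K i) * of_real (grid q K i powr (2 * \<alpha>))))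
     = (\<Sum>i\<le>n. of_real (W_kernel \<alpha> q 1) * of_real (weyl_base \<alpha> q powi (- K)) *
         (qbin (q\<^sup>2) (weyl_base \<alpha> q) 1 $ (n - i) * (dilate (weyl_base \<alpha> q) (grid_fps q K f) $ i)))"
  proof (rule sum.cong[OF refl])
    fix i assume "i \<in> {..n}"
    then have W: "complex_of_real (W_kernel \<alpha> q (t / grid q K i))
       = of_real (W_kernel \<alpha> q 1) * qbin (q\<^sup>2) (weyl_base \<alpha> q) 1 $ (n - i)"
      using t' by (auto simp: grid_divide W_kernel_uminus W_kernel_power)
    have "complex_of_real (grid q K i) * of_real (grid q K i powr (2 * \<alpha>))
        = of_real (weyl_base \<alpha> q powi (- K)) * of_real (weyl_base \<alpha> q) ^ i"
      by (metis grid_powr of_real_mult of_real_power)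
    then have "(complex_of_real (grid q K i) * of_real (grid q K i powr (2 * \<alpha>)))
          * (of_real (W_kernel \<alpha> q (t / grid q K i)) * f (grid q K i))
      = (of_real (weyl_base \<alpha> q powi (- K)) * of_real (weyl_base \<alpha> q) ^ i)
          * (of_real (W_kernel \<alpha> q 1) * qbin (q\<^sup>2) (weyl_base \<alpha> q) 1 $ (n - i) * f (grid q K i))"
      by (simp only: W)
    then show "complex_of_real (grid q K i) *
        (of_real (W_kernel \<alpha> q (t / grid q K i)) * f (grid q K i) * of_real (grid q K i powr (2 * \<alpha>)))
      = of_real (W_kernel \<alpha> q 1) * of_real (weyl_base \<alpha> q powi (- K)) *
         (qbin (q\<^sup>2) (weyl_base \<alpha> q) 1 $ (n - i) * (dilate (weyl_base \<alpha> q) (grid_fps q K f) $ i))"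
      unfolding dilate_nth grid_fps_nth by (simp only: mult_ac)
  qed
  also have "\<dots> = of_real (W_kernel \<alpha> q 1) * of_real (weyl_base \<alpha> q powi (- K)) *
       (qbin (q\<^sup>2) (weyl_base \<alpha> q) 1 * dilate (weyl_base \<alpha> q) (grid_fps q K f)) $ n"
    by (simp only: mult.commute[of "qbin _ _ _"] fps_mult_nth atMost_atLeast0 sum_distrib_left) (simp only: mult_ac)
  finally show ?thesis
    by (simp add: weyl_const_def mult_ac)
qed

lemma q_Weyl_supported:
  assumes supp: "supported_on q K f"
  shows "supported_on q K (q_Weyl \<alpha> q f)"
  unfolding supported_on_def
proof (intro conjI allI impI)
  show "q_Weyl \<alpha> q f t = 0" if "t \<notin> Rq q" for t using that by (simp add: q_Weyl_def)
  fix t assume t: "\<bar>t\<bar> > q powi (- K)"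
  show "q_Weyl \<alpha> q f t = 0"
  proof (cases "t \<in> Rq q")
    case True
    then show ?thesis
    proof (cases rule: Rq_cases[OF q, where K = K, consumes 1, case_names large grid])
      case (large k)
      show ?thesis
        unfolding q_Weyl_def large(1)
        by (subst jackson_Ici_beyond_support[OF q _ large(3)])
           (use supp in \<open>auto simp: supported_on_def\<close>)
    next
      case (grid n)
      then show ?thesis using t grid_le[OF q, of K n] by simp
    qed
  qed (simp add: q_Weyl_def)
qed

lemma q_Weyl_even: "q_Weyl \<alpha> q f (- t) = q_Weyl \<alpha> q f t"
  by (simp add: q_Weyl_def W_kernel_uminus)

lemma grid_fps_q_Weyl:
  assumes "supported_on q K f"
  shows "grid_fps q K (q_Weyl \<alpha> q f) = fps_const (of_real (weyl_const \<alpha> q K)) *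
    (qbin (q\<^sup>2) (weyl_base \<alpha> q) 1 * dilate (weyl_base \<alpha> q) (grid_fps q K f))"
proof (rule fps_ext)
  fix n
  have "q_Weyl \<alpha> q f (grid q K n) = of_real (weyl_const \<alpha> q K) *
    (qbin (q\<^sup>2) (weyl_base \<alpha> q) 1 * dilate (weyl_base \<alpha> q) (grid_fps q K f)) $ n"
    using grid_pos[OF q, of K n] by (intro q_Weyl_grid[OF assms]) simp
  then show "grid_fps q K (q_Weyl \<alpha> q f) $ n = (fps_const (of_real (weyl_const \<alpha> q K)) *
    (qbin (q\<^sup>2) (weyl_base \<alpha> q) 1 * dilate (weyl_base \<alpha> q) (grid_fps q K f))) $ n"
    by simp
qed

text \<open>Dilation moves the base of \<open>smooth_fps\<close> from 1 to
  \<open>weyl_base \<alpha> q\<close>, and multiplication by \<open>qbin\<close> with these two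
  parameters moves it back to 1.\<close>

lemma q_Weyl_Dq_even:
  assumes "f \<in> Dq_even_space q"
  shows "q_Weyl \<alpha> q f \<in> Dq_even_space q"
proof -
  have f: "f \<in> Dq_space q" "\<And>x. f (- x) = f x" using assms by (auto simp: Dq_even_space_def)
  obtain K where K: "supported_on q K f" using Dq_space_supported[OF q f(1)] by blast
  have "smooth_fps (q\<^sup>2) (weyl_base \<alpha> q * 1) (dilate (weyl_base \<alpha> q) (grid_fps q K f))"
    by (intro smooth_fps_dilate[OF q2[OF q]] Dq_imp_smooth_fps[OF q] f weyl_base_pos)
  then have "smooth_fps (q\<^sup>2) 1 (grid_fps q K (q_Weyl \<alpha> q f))"
    unfolding grid_fps_q_Weyl[OF K] using weyl_base_pos
    by (intro smooth_fps_scale[OF q2[OF q]] smooth_fps_qbin[OF q2[OF q]]) auto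
  then have "q_Weyl \<alpha> q f \<in> Dq_space q"
    by (intro smooth_fps_imp_Dq[OF q q_Weyl_supported[OF K]] q_Weyl_even)
  then show ?thesis by (simp add: Dq_even_space_def q_Weyl_even)
qed

lemma q_Weyl_bij: "bij_betw (q_Weyl \<alpha> q) (Dq_even_space q) (Dq_even_space q)"
proof (rule bij_betw_imageI)
  let ?p = "weyl_base \<alpha> q"
  show "inj_on (q_Weyl \<alpha> q) (Dq_even_space q)"
  proof (rule inj_onI)
    fix f g assume fg: "f \<in> Dq_even_space q" "g \<in> Dq_even_space q" "q_Weyl \<alpha> q f = q_Weyl \<alpha> q g"
    then have D: "f \<in> Dq_space q" "g \<in> Dq_space q" and even: "\<And>x. f (- x) = f x" "\<And>x. g (- x) = g x"
      by (auto simp: Dq_even_space_def)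
    obtain K where K: "supported_on q K f" "supported_on q K g"
      using Dq_space_supported2[OF q D] by blast
    \<comment> \<open>The constant has been cancelled; the reciprocal series now isolates the
      dilated coefficients.\<close>
    have "qbin (q\<^sup>2) 1 ?p * (qbin (q\<^sup>2) ?p 1 * dilate ?p (grid_fps q K f))
        = qbin (q\<^sup>2) 1 ?p * (qbin (q\<^sup>2) ?p 1 * dilate ?p (grid_fps q K g))"
      using grid_fps_q_Weyl[OF K(1)] grid_fps_q_Weyl[OF K(2)] fg(3) weyl_const_nonzero[of K] by auto
    then have "dilate ?p (grid_fps q K f) = dilate ?p (grid_fps q K g)"
      by (simp add: qbin_inverse[OF q2[OF q]] flip: mult.assoc)
    then have "dilate (1 / ?p) (dilate ?p (grid_fps q K f)) = dilate (1 / ?p) (dilate ?p (grid_fps q K g))"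
      by simp
    then have "grid_fps q K f = grid_fps q K g"
      using weyl_base_pos by (simp add: dilate_dilate)
    then show "f = g" by (rule supported_on_ext_even[OF q K even])
  qed
  have "h \<in> q_Weyl \<alpha> q ` Dq_even_space q" if "h \<in> Dq_even_space q" for h
  proof -
    have h: "h \<in> Dq_space q" "\<And>x. h (- x) = h x" using that by (auto simp: Dq_even_space_def)
    obtain K where K: "supported_on q K h" using Dq_space_supported[OF q h(1)] by blast
    define c where "c = complex_of_real (weyl_const \<alpha> q K)"
    have c: "c \<noteq> 0" using weyl_const_nonzero by (simp add: c_def)
    \<comment> \<open>\<open>U\<close> undoes the steps of \<open>grid_fps_q_Weyl\<close> in reverse
      order. The base of smoothness goes from 1 to \<open>?p\<close> under \<open>qbin\<close> and
      back to 1 under the dilation.\<close>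
    define U where "U = dilate (1 / ?p) (fps_const (1 / c) * (qbin (q\<^sup>2) 1 ?p * grid_fps q K h))"
    define f where "f = grid_fun q K U"
    have supp: "supported_on q K f" unfolding f_def by (rule grid_fun_supported[OF q])
    have gf: "grid_fps q K f = U" unfolding f_def by (rule grid_fps_grid_fun[OF q])
    have "smooth_fps (q\<^sup>2) (1 / ?p * ?p) U"
      unfolding U_def using weyl_base_pos
      by (intro smooth_fps_dilate[OF q2[OF q]] smooth_fps_scale[OF q2[OF q]] smooth_fps_qbin[OF q2[OF q]]
          Dq_imp_smooth_fps[OF q] h) auto
    then have "smooth_fps (q\<^sup>2) 1 (grid_fps q K f)"
      using weyl_base_pos by (simp add: gf)
    then have "f \<in> Dq_space q"
      by (intro smooth_fps_imp_Dq[OF q supp]) (simp_all add: f_def grid_fun_even[OF q])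
    then have fD: "f \<in> Dq_even_space q"
      by (simp add: Dq_even_space_def f_def grid_fun_even[OF q])
    have "grid_fps q K (q_Weyl \<alpha> q f) = fps_const c * (qbin (q\<^sup>2) ?p 1 *
        (fps_const (1 / c) * (qbin (q\<^sup>2) 1 ?p * grid_fps q K h)))"
      unfolding grid_fps_q_Weyl[OF supp] gf U_def c_def[symmetric]
      using weyl_base_pos by (simp add: dilate_dilate)
    also have "\<dots> = (fps_const c * fps_const (1 / c)) * (qbin (q\<^sup>2) ?p 1 * qbin (q\<^sup>2) 1 ?p) * grid_fps q K h"
      by (simp only: mult_ac)
    also have "\<dots> = grid_fps q K h"
      using c by (simp add: qbin_inverse[OF q2[OF q]])
    finally have "q_Weyl \<alpha> q f = h"
      by (rule supported_on_ext_even[OF q q_Weyl_supported[OF supp] K q_Weyl_even h(2)])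
    then show ?thesis using fD by blast
  qed
  then show "q_Weyl \<alpha> q ` Dq_even_space q = Dq_even_space q"
    using q_Weyl_Dq_even by blast
qed

end

subsection \<open>The operator \<open>J\<close> and the dual intertwining operator\<close>

lemma dilate_fps_const_mult: "dilate r (fps_const c * U) = fps_const c * dilate r U"
  by (rule fps_ext) simp

context
  fixes q :: real
  assumes q: "0 < q" "q < 1"
begin

section \<open>The \<open>q\<close>-derivative of even functions on the grid\<close>

lemma dq_even_odd:
  assumes "\<And>x. g (- x) = g x"
  shows "dq q g (- x) = - dq q g x"
proof -
  have "complex_of_real ((1 - q) * - x) = - of_real ((1 - q) * x)" by simp
  then show ?thesis unfolding dq_even[OF q, of g, OF assms] by (simp add: assms)
qed

lemma dq_even_grid:
  assumes "supported_on q K g" "\<And>x. g (- x) = g x"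
  shows "dq q g (grid q K n) =
    ((if n = 0 then 0 else g (grid q K (n - 1))) - g (grid q K n)) / of_real ((1 - q) * grid q K n)"
proof -
  have "g (grid q K n / q) = (if n = 0 then 0 else g (grid q K (n - 1)))"
  proof (cases n)
    case 0
    \<comment> \<open>The neighbour outside the outermost grid point is beyond the support; this is
      the 0 which multiplication by \<open>fps_X\<close> puts at index 0.\<close>
    have "1 * q powi (- K) < q powi (- K) / q"
      using q by (simp add: field_simps)
    then show ?thesis using 0 supported_onD[OF q assms(1), of "grid q K 0 / q"] q
      by (simp add: grid_def)
  next
    case (Suc m)
    then show ?thesis using q by (simp add: grid_Suc[OF q])
  qed
  then show ?thesis unfolding dq_even[OF q, of g, OF assms(2)] by simp
qed

text \<open>An even function is compared only with its value further out, so its support does not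
  grow and \<open>g\<close> and \<open>dq q g\<close> share one grid.\<close>

lemma supported_on_dq_even:
  assumes "supported_on q K g" "\<And>x. g (- x) = g x"
  shows "supported_on q K (dq q g)"
  unfolding supported_on_def
proof (intro conjI allI impI)
  show "dq q g x = 0" if "x \<notin> Rq q" for x
    using that supported_on_outside[OF q assms(1)] by (intro dq_outside[OF q]) auto
  fix x assume x: "\<bar>x\<bar> > q powi (- K)"
  have "\<bar>x\<bar> \<le> \<bar>x / q\<bar>" using q mult_left_le[of q "\<bar>x\<bar>"] by (simp add: pos_le_divide_eq)
  then have "g (x / q) = 0" "g x = 0"
    using x by (auto intro!: supported_onD[OF q assms(1)])
  then show "dq q g x = 0" unfolding dq_even[OF q, of g, OF assms(2)] by simp
qed

text \<open>The outer value minus the present one is multiplication by \<open>- lin 1\<close>, and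
  the denominator, proportional to \<open>q ^ n\<close>, is dilation by
  \<open>1 / q\<close>.\<close>

lemma grid_fps_dq_even:
  assumes "supported_on q K g" "\<And>x. g (- x) = g x"
  shows "grid_fps q K (dq q g) =
    fps_const (of_real (- 1 / ((1 - q) * q powi (- K)))) * dilate (1 / q) (lin 1 * grid_fps q K g)"
proof (rule fps_ext)
  fix n
  have "- 1 / ((1 - q) * q powi (- K)) * (1 / q) ^ n = - 1 / ((1 - q) * grid q K n)"
    using q by (simp add: grid_eq[OF q] power_divide)
  then have c: "complex_of_real (- 1 / ((1 - q) * q powi (- K))) * of_real (1 / q) ^ n
      = - 1 / of_real ((1 - q) * grid q K n)"
    by (metis of_real_1 of_real_divide of_real_minus of_real_mult of_real_power)
  have "dq q g (grid q K n) = - 1 / of_real ((1 - q) * grid q K n) * (lin 1 * grid_fps q K g) $ n"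
  proof -
    have neg: "(a - b) / z = - 1 / z * (b - a)" for a b z :: complex
      by (simp add: diff_divide_distrib)
    show ?thesis
      unfolding dq_even_grid[OF assms] lin_mult_nth by (subst neg) simp
  qed
  then show "grid_fps q K (dq q g) $ n =
    (fps_const (of_real (- 1 / ((1 - q) * q powi (- K)))) * dilate (1 / q) (lin 1 * grid_fps q K g)) $ n"
    unfolding fps_mult_left_const_nth dilate_nth grid_fps_nth mult.assoc[symmetric] c .
qed

section \<open>The primitive of an odd function\<close>

lemma jackson_summand_summable:
  assumes supp: "supported_on q K h" and bdd: "\<And>x. x \<in> Rq q \<Longrightarrow> cmod (h x) \<le> C"
  shows "(\<lambda>k::int. of_real (q powi k) * h (q powi k)) summable_on UNIV"
    "summable (\<lambda>n. norm (of_real (grid q K n) * h (grid q K n)))"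
proof -
  let ?s = "\<lambda>k::int. of_real (q powi k) * h (q powi k)"
  show sm: "summable (\<lambda>n. norm (of_real (grid q K n) * h (grid q K n)))"
  proof (rule summable_comparison_test')
    show "summable (\<lambda>n. (C * q powi (- K)) * q ^ n)"
      using q by (intro summable_mult summable_geometric) auto
    fix n
    have "norm (of_real (grid q K n) * h (grid q K n)) \<le> grid q K n * C"
      using bdd[OF grid_in_Rq[OF q, of K n]] grid_pos[OF q, of K n]
      by (simp add: norm_mult)
    then show "norm (norm (of_real (grid q K n) * h (grid q K n))) \<le> (C * q powi (- K)) * q ^ n"
      by (simp add: grid_eq[OF q] mult_ac)
  qed
  have "(\<lambda>n. of_real (grid q K n) * h (grid q K n)) summable_on UNIV"
    by (rule norm_summable_imp_summable_on[OF sm])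
  also have "(\<lambda>n. of_real (grid q K n) * h (grid q K n)) = ?s \<circ> (\<lambda>n. int n - K)"
    by (auto simp: grid_def)
  finally have "?s summable_on ((\<lambda>n. int n - K) ` UNIV)"
    by (subst summable_on_reindex) (auto simp: inj_on_def comp_def)
  then show "?s summable_on UNIV"
  proof (rule summable_on_cong_neutral[THEN iffD1, rotated -1])
    fix k :: int assume "k \<in> UNIV - range (\<lambda>n. int n - K)"
    then have "k \<noteq> int (nat (k + K)) - K" by blast
    then have "k < - K" by linarith
    then have "q powi k > q powi (- K)" using power_int_less_iff[OF q] by simp
    then show "?s k = 0" using supported_onD[OF q supp, of "q powi k"] q by simp
  qed auto
qed

text \<open>The substitution \<open>k = j + 1 + n\<close> absorbs the scale, so Jackson sums at
  different scales become sums of one family over different sets of exponents.\<close>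

lemma infsum_shift:
  "of_real ((1 - q) * (q * q powi j)) * (\<Sum>\<^sub>\<infinity>n\<in>A. of_real (q powi n) * h (q * q powi j * q powi n))
    = of_real (1 - q) * (\<Sum>\<^sub>\<infinity>k\<in>(\<lambda>n. j + 1 + n) ` A. complex_of_real (q powi k) * h (q powi k))"
proof -
  have pt: "q * q powi j * q powi n = q powi (j + 1 + n)" for n
    using q by (simp add: power_int_add)
  have "(\<Sum>\<^sub>\<infinity>k\<in>(\<lambda>n. j + 1 + n) ` A. complex_of_real (q powi k) * h (q powi k))
    = (\<Sum>\<^sub>\<infinity>n\<in>A. complex_of_real (q powi (j + 1 + n)) * h (q powi (j + 1 + n)))"
    by (subst infsum_reindex) (auto simp: inj_on_def o_def)
  also have "\<dots> = (\<Sum>\<^sub>\<infinity>n\<in>A. of_real (q * q powi j) * (of_real (q powi n) * h (q * q powi j * q powi n)))"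
    unfolding pt[symmetric] by (simp add: mult.assoc)
  also have "\<dots> = of_real (q * q powi j) * (\<Sum>\<^sub>\<infinity>n\<in>A. of_real (q powi n) * h (q * q powi j * q powi n))"
    by (rule infsum_cmult_right')
  finally show ?thesis by simp
qed

text \<open>An odd function has integral 0 over the whole line, so its integral up to
  \<open>q * x\<close> is minus the integral over the rest; for negative \<open>x\<close>,
  reflection gives the same value. By the compact support only finitely many nodes then
  contribute.\<close>

lemma J_op_eq_jackson_Ici:
  assumes supp: "supported_on q K h" and bdd: "\<And>x. x \<in> Rq q \<Longrightarrow> cmod (h x) \<le> C"
    and odd: "\<And>x. h (- x) = - h x" and x: "x \<in> Rq q"
  shows "J_op q h x = - jackson_Ici q (q * \<bar>x\<bar>) h"
proof -
  obtain j :: int where j: "x = q powi j \<or> x = - (q powi j)" using x by (auto simp: Rq_def)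
  have pos: "q powi j > 0" using q by simp
  show ?thesis
    using j
  proof
    assume "x = - (q powi j)"
    then show ?thesis
      using x pos q by (simp add: J_op_def jackson_Iic_def jackson_Iic_neg_def jackson_Ici_def odd infsum_uminus)
  next
    assume xj: "x = q powi j"
    let ?s = "\<lambda>k::int. of_real (q powi k) * h (q powi k)"
    \<comment> \<open>Splitting the sum over all exponents at \<open>j\<close> requires both pieces
      to be summable.\<close>
    have sm: "?s summable_on A" for A
      using jackson_summand_summable(1)[OF supp bdd] by (rule summable_on_subset_banach) auto
    have im: "(\<lambda>n. j + 1 + n) ` {0..} = {j + 1..}" "(\<lambda>n. j + 1 + n) ` {..-1} = {..j}"
    proof -
      show "(\<lambda>n. j + 1 + n) ` {0..} = {j + 1..}" by simp
      show "(\<lambda>n. j + 1 + n) ` {..-1} = {..j}"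
        by (auto intro: image_eqI[of _ _ "_ - (j + 1)"])
    qed
    have "jackson_Iic_0 q h = - (of_real (1 - q) * (\<Sum>\<^sub>\<infinity>k. ?s k))"
      by (simp add: jackson_Iic_0_def odd infsum_uminus)
    also have "(\<Sum>\<^sub>\<infinity>k. ?s k) = (\<Sum>\<^sub>\<infinity>k\<in>{..j}. ?s k) + (\<Sum>\<^sub>\<infinity>k\<in>{j + 1..}. ?s k)"
    proof -
      have "{..j} \<union> {j + 1..} = UNIV" "{..j} \<inter> {j + 1..} = {}" by auto
      then show ?thesis using infsum_Un_disjoint[OF sm sm, of "{..j}" "{j + 1..}"] by (simp only:)
    qed
    finally have "jackson_Iic_0 q h
      = - (of_real (1 - q) * ((\<Sum>\<^sub>\<infinity>k\<in>{..j}. ?s k) + (\<Sum>\<^sub>\<infinity>k\<in>{j + 1..}. ?s k)))" .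
    moreover have "jackson_0_to q (q * x) h = of_real (1 - q) * (\<Sum>\<^sub>\<infinity>k\<in>{j + 1..}. ?s k)"
      unfolding jackson_0_to_def xj infsum_shift im ..
    moreover have "jackson_Ici q (q * x) h = of_real (1 - q) * (\<Sum>\<^sub>\<infinity>k\<in>{..j}. ?s k)"
      unfolding jackson_Ici_def xj infsum_shift im ..
    ultimately have "jackson_Iic_0 q h + jackson_0_to q (q * x) h = - jackson_Ici q (q * x) h"
      by (simp add: distrib_left)
    moreover have "x > 0" using xj pos by simp
    moreover from this have "q * x > 0" using q by simp
    ultimately show ?thesis
      using x by (simp add: J_op_def jackson_Iic_def)
  qed
qed

context
  fixes K h C
  assumes supp: "supported_on q K h" and bdd: "\<And>x. x \<in> Rq q \<Longrightarrow> cmod (h x) \<le> C"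
    and odd: "\<And>x. h (- x) = - h x"
begin

lemma J_op_even: "J_op q h (- x) = J_op q h x"
proof (cases "x \<in> Rq q")
  case True
  then show ?thesis
    using J_op_eq_jackson_Ici[OF supp bdd odd, of x] J_op_eq_jackson_Ici[OF supp bdd odd, of "- x"] by simp
qed (simp add: J_op_def)

lemma J_op_grid: "J_op q h (grid q K n) = - (of_real (1 - q) * (\<Sum>i\<le>n. of_real (grid q K i) * h (grid q K i)))"
  using J_op_eq_jackson_Ici[OF supp bdd odd grid_in_Rq[OF q], of K n]
    jackson_Ici_grid[OF q, of K h n] grid_pos[OF q, of K n] supp
  by (simp add: supported_on_def)

lemma J_op_supported: "supported_on q K (J_op q h)"
  unfolding supported_on_def
proof (intro conjI allI impI)
  show "J_op q h x = 0" if "x \<notin> Rq q" for x using that by (simp add: J_op_def)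
  fix x assume x: "\<bar>x\<bar> > q powi (- K)"
  show "J_op q h x = 0"
  proof (cases "x \<in> Rq q")
    case True
    then show ?thesis
    proof (cases rule: Rq_cases[OF q, where K = K, consumes 1, case_names large grid])
      case (large k)
      then show ?thesis
        using J_op_eq_jackson_Ici[OF supp bdd odd True] jackson_Ici_beyond_support[OF q _ large(3), of h] supp
        by (simp add: supported_on_def)
    next
      case (grid n)
      then show ?thesis using x grid_le[OF q, of K n] by simp
    qed
  qed (simp add: J_op_def)
qed

text \<open>Consecutive partial sums in \<open>J_op_grid\<close> differ by one summand, whose weight
  is the denominator of \<open>dq\<close>. Oddness covers the negative points.\<close>

lemma dq_J_op: "dq q (J_op q h) = h"
proof (rule supported_on_ext[OF q supported_on_dq_even[OF J_op_supported J_op_even] supp])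
  show *: "dq q (J_op q h) (grid q K n) = h (grid q K n)" for n
  proof -
    have "(if n = 0 then 0 else J_op q h (grid q K (n - 1))) - J_op q h (grid q K n)
        = of_real ((1 - q) * grid q K n) * h (grid q K n)"
      by (cases n) (simp_all add: J_op_grid algebra_simps)
    then show ?thesis
      using dq_even_grid[OF J_op_supported J_op_even, of n] grid_pos[OF q, of K n] q by simp
  qed
  show "dq q (J_op q h) (- grid q K n) = h (- grid q K n)" for n
    using dq_even_odd[of "J_op q h", OF J_op_even] * odd by simp
qed

text \<open>As \<open>dq\<close> returns the smooth function \<open>h\<close>, only boundedness and
  the limit at 0 are missing. Both come from convergence of the partial sums in
  \<open>J_op_grid\<close>, and evenness carries them to negative points.\<close>

lemma J_op_Dq:
  assumes "h \<in> Dq_space q"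
  shows "J_op q h \<in> Dq_even_space q"
proof -
  let ?F = "J_op q h"
  have F_abs: "?F x = ?F \<bar>x\<bar>" for x
    using J_op_even[of x] by (simp add: abs_if)
  have "summable (\<lambda>i. of_real (grid q K i) * h (grid q K i))"
    by (rule summable_norm_cancel[OF jackson_summand_summable(2)[OF supp bdd]])
  then have "convergent (\<lambda>n. \<Sum>i\<le>n. of_real (grid q K i) * h (grid q K i))"
    using summable_iff_convergent' by blast
  then obtain L' where "(\<lambda>n. \<Sum>i\<le>n. of_real (grid q K i) * h (grid q K i)) \<longlonglongrightarrow> L'"
    by (auto simp: convergent_def)
  then have "(\<lambda>n. - (of_real (1 - q) * (\<Sum>i\<le>n. of_real (grid q K i) * h (grid q K i)))) \<longlonglongrightarrow> - (of_real (1 - q) * L')"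
    by (intro tendsto_intros)
  then obtain L where L: "(\<lambda>n. ?F (grid q K n)) \<longlonglongrightarrow> L"
    unfolding J_op_grid by blast
  have "(?F \<longlongrightarrow> L) (at 0 within Rq q)"
  proof (rule tendstoI)
    fix e :: real assume "e > 0"
    then obtain N where N: "\<And>n. n \<ge> N \<Longrightarrow> dist (?F (grid q K n)) L < e"
      using L unfolding lim_sequentially by blast
    show "\<forall>\<^sub>F x in at 0 within Rq q. dist (?F x) L < e"
      unfolding eventually_at
    proof (intro exI conjI ballI impI)
      show "grid q K N > 0" by (rule grid_pos[OF q])
      fix x assume x: "x \<in> Rq q" "x \<noteq> 0 \<and> dist x 0 < grid q K N"
      from x(1) show "dist (?F x) L < e"
      proof (cases rule: Rq_cases[OF q, where K = K, consumes 1, case_names large grid])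
        case (large k)
        then show ?thesis using x(2) grid_le[OF q, of K N] by (simp add: dist_real_def)
      next
        case (grid n)
        then have "N < n" using x(2) by (simp add: dist_real_def grid_less_iff[OF q])
        then show ?thesis using N[of n] F_abs[of x] grid by simp
      qed
    qed
  qed
  then have lim: "\<exists>L. (?F \<longlongrightarrow> L) (at 0 within Rq q)" by blast
  have bounded: "zero_order q 0 ?F"
  proof (rule zero_orderI[OF q])
    fix B
    obtain D where D: "D > 0" "\<And>n. cmod (?F (grid q K n)) \<le> D"
      using convergent_imp_Bseq[OF convergentI[OF L]] unfolding Bseq_def by blast
    have "cmod (?F x) \<le> D * \<bar>x\<bar> ^ 0" if "x \<in> Rq q" for x
      using that
    proof (cases rule: Rq_cases[OF q, where K = K, consumes 1, case_names large grid])
      case (large k)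
      then show ?thesis using supported_onD[OF q J_op_supported, of x] D(1) by simp
    next
      case (grid n)
      then show ?thesis using D(2)[of n] F_abs[of x] by simp
    qed
    then show "\<exists>C. \<forall>x\<in>Rq q. \<bar>x\<bar> \<le> B \<longrightarrow> cmod (?F x) \<le> C * \<bar>x\<bar> ^ 0" by blast
  qed
  have "?F \<in> Eq_space q"
  proof (rule Eq_space_of_dq[OF q _ bounded lim])
    show "?F x = 0" if "x \<notin> Rq q" for x using that by (simp add: J_op_def)
    show "dq q ?F \<in> Eq_space q" using assms by (simp add: dq_J_op Dq_space_def)
  qed
  then have "?F \<in> Dq_space q"
    using J_op_supported by (auto intro!: Dq_spaceI[OF q] simp: Eq_space_iff[OF q])
  then show ?thesis by (simp add: Dq_even_space_def J_op_even)
qed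

end

lemma Dq_bounded:
  assumes "f \<in> Dq_space q"
  shows "\<exists>C. \<forall>x\<in>Rq q. cmod (f x) \<le> C"
proof -
  obtain K where K: "supported_on q K f" using Dq_space_supported[OF q assms] by blast
  have "zero_order q 0 f" using assms has_jets_bounded[OF q] by (simp add: Dq_space_iff[OF q])
  then obtain C where C: "C \<ge> 0" "\<And>x. x \<in> Rq q \<Longrightarrow> \<bar>x\<bar> \<le> q powi (- K) \<Longrightarrow> cmod (f x) \<le> C * \<bar>x\<bar> ^ 0"
    by (rule zero_orderE[OF q, where B = "q powi (- K)"]; blast)
  have "cmod (f x) \<le> C" if "x \<in> Rq q" for x
    using C(2)[OF that] supported_onD[OF q K, of x] C(1) by (cases "\<bar>x\<bar> \<le> q powi (- K)") auto
  then show ?thesis by blast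
qed

lemma
  assumes h: "h \<in> Dq_space q" and odd: "\<And>x. h (- x) = - h x"
  shows J_op_in_Dq_even: "J_op q h \<in> Dq_even_space q"
    and dq_J_op_Dq: "dq q (J_op q h) = h"
proof -
  obtain K where K: "supported_on q K h" using Dq_space_supported[OF q h] by blast
  obtain C where C: "\<And>x. x \<in> Rq q \<Longrightarrow> cmod (h x) \<le> C" using Dq_bounded[OF h] by blast
  show "J_op q h \<in> Dq_even_space q" by (rule J_op_Dq[OF K C odd h])
  show "dq q (J_op q h) = h" by (rule dq_J_op[OF K C odd])
qed

text \<open>The sum telescopes without a boundary term, since \<open>g\<close> vanishes beyond its
  support.\<close>

lemma J_op_dq:
  assumes g: "g \<in> Dq_even_space q"
  shows "J_op q (dq q g) = g"
proof -
  have gD: "g \<in> Dq_space q" and even: "\<And>x. g (- x) = g x" using g by (auto simp: Dq_even_space_def)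
  obtain K where K: "supported_on q K g" using Dq_space_supported[OF q gD] by blast
  obtain C where C: "\<And>x. x \<in> Rq q \<Longrightarrow> cmod (dq q g x) \<le> C"
    using Dq_bounded[OF Dq_space_dq[OF q gD]] by blast
  note props = supported_on_dq_even[OF K even] C dq_even_odd[of g, OF even]
  have telescope: "(\<Sum>i\<le>n. (if i = 0 then 0 else g (grid q K (i - 1))) - g (grid q K i)) = - g (grid q K n)" for n
    by (induction n) simp_all
  show ?thesis
  proof (rule supported_on_ext_even[OF q])
    show "supported_on q K (J_op q (dq q g))" by (rule J_op_supported[OF props])
    show "supported_on q K g" by (rule K)
    show "J_op q (dq q g) (- x) = J_op q (dq q g) x" for x by (rule J_op_even[OF props])
    show "g (- x) = g x" for x by (rule even)
    show "grid_fps q K (J_op q (dq q g)) = grid_fps q K g"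
    proof (rule fps_ext)
      fix n
      have "(\<Sum>i\<le>n. of_real (grid q K i) * dq q g (grid q K i))
        = (\<Sum>i\<le>n. ((if i = 0 then 0 else g (grid q K (i - 1))) - g (grid q K i)) / of_real (1 - q))"
        using grid_pos[OF q] by (intro sum.cong refl) (simp add: dq_even_grid[OF K even] less_imp_neq[symmetric])
      also have "\<dots> = - g (grid q K n) / of_real (1 - q)"
        by (simp only: telescope flip: sum_divide_distrib)
      finally show "grid_fps q K (J_op q (dq q g)) $ n = grid_fps q K g $ n"
        using q by (simp add: J_op_grid[OF props])
    qed
  qed
qed

end

section \<open>The dual intertwining operator in terms of parity parts\<close>

context
  fixes q \<alpha> :: real
  assumes q: "0 < q" "q < 1" and \<alpha>: "\<alpha> > - 1/2"
begin

text \<open>When \<open>x\<close> and \<open>- x\<close> are added, the factor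
  \<open>1 + t / x\<close> pairs 1 with the even part and \<open>t / x\<close> with the odd part;
  the resulting 2 cancels the one in the normalisation. The sign \<open>s\<close> treats both
  half-lines at once.\<close>

lemma dual_intertwining_grid_sum:
  assumes supp: "supported_on q K f" and s: "s = 1 \<or> s = - 1"
  shows "dual_intertwining \<alpha> q f (s * grid q K n) = of_real (weyl_factor \<alpha> q * (1 - q)) *
    (\<Sum>i\<le>n. of_real (grid q K i * grid q K i powr (2 * \<alpha>)) * of_real (W_kernel \<alpha> q (q ^ (n - i))) *
       (even_part f (grid q K i) + of_real (s * q ^ (n - i)) * odd_part f (grid q K i)))"
proof -
  let ?t = "s * grid q K n"
  let ?h = "\<lambda>x. of_real (W_kernel \<alpha> q (?t / x)) * of_real (1 + ?t / x) * f x * of_real (\<bar>x\<bar> powr (2 * \<alpha>))"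
  have t: "?t \<in> Rq q" "\<bar>?t\<bar> = grid q K n" using s grid_pos[OF q, of K n] grid_in_Rq[OF q, of K n] by auto
  have "jackson_abs_ge q (q * \<bar>?t\<bar>) ?h
    = of_real (1 - q) * (\<Sum>i\<le>n. of_real (grid q K i) * (?h (grid q K i) + ?h (- grid q K i)))"
    unfolding jackson_abs_ge_def t(2)
    by (subst jackson_Ici_grid[OF q]) (use supp in \<open>auto simp: supported_on_def\<close>)
  also have "(\<Sum>i\<le>n. of_real (grid q K i) * (?h (grid q K i) + ?h (- grid q K i)))
     = (\<Sum>i\<le>n. 2 * (of_real (grid q K i * grid q K i powr (2 * \<alpha>)) * of_real (W_kernel \<alpha> q (q ^ (n - i))) *
       (even_part f (grid q K i) + of_real (s * q ^ (n - i)) * odd_part f (grid q K i))))"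
  proof (rule sum.cong[OF refl])
    fix i assume "i \<in> {..n}"
    define g where "g = grid q K i"
    define r where "r = s * q ^ (n - i)"
    have g: "g > 0" using grid_pos[OF q] by (simp add: g_def)
    have r1: "?t / g = r"
      using grid_divide[OF q \<alpha>, where i = i and n = n and K = K] \<open>i \<in> {..n}\<close>
      by (simp add: g_def r_def flip: times_divide_eq_right)
    then have r2: "?t / (- g) = - r" by simp
    have W: "W_kernel \<alpha> q r = W_kernel \<alpha> q (q ^ (n - i))" "W_kernel \<alpha> q (- r) = W_kernel \<alpha> q (q ^ (n - i))"
      using s by (auto simp: r_def W_kernel_uminus[OF q \<alpha>])
    have f1: "f g = even_part f g + odd_part f g"
      by (simp only: even_odd_sum)
    have f2: "f (- g) = even_part f g - odd_part f g"
      by (simp add: even_part_def odd_part_def field_simps)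
    show "of_real (grid q K i) * (?h (grid q K i) + ?h (- grid q K i))
      = 2 * (of_real (grid q K i * grid q K i powr (2 * \<alpha>)) * of_real (W_kernel \<alpha> q (q ^ (n - i))) *
       (even_part f (grid q K i) + of_real (s * q ^ (n - i)) * odd_part f (grid q K i)))"
      unfolding g_def[symmetric] r_def[symmetric] r1 r2 W f1 f2
      using g by (simp add: algebra_simps)
  qed
  finally show ?thesis
    unfolding dual_intertwining_def using t(1)
    by (simp add: weyl_factor_def sum_distrib_left[symmetric])
qed

text \<open>The extra factor \<open>q ^ (n - i)\<close> of the odd term dilates the kernel series by
  \<open>q\<close>, which multiplies both parameters of \<open>qbin\<close> by
  \<open>q\<close>.\<close>

lemma dual_intertwining_grid:
  assumes supp: "supported_on q K f" and s: "s = 1 \<or> s = - 1"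
  shows "dual_intertwining \<alpha> q f (s * grid q K n) = of_real (weyl_const \<alpha> q K) *
    ((qbin (q\<^sup>2) (weyl_base \<alpha> q) 1 * dilate (weyl_base \<alpha> q) (grid_fps q K (even_part f))) $ n
     + of_real s *
       (qbin (q\<^sup>2) (q * weyl_base \<alpha> q) q * dilate (weyl_base \<alpha> q) (grid_fps q K (odd_part f))) $ n)"
proof -
  let ?p = "weyl_base \<alpha> q"
  let ?c = "of_real (?p powi (- K)) * complex_of_real (W_kernel \<alpha> q 1)"
  have "qbin (q\<^sup>2) (q * ?p) q = dilate q (qbin (q\<^sup>2) ?p 1)"
    by (simp add: qbin_dilate)
  then have w: "qbin (q\<^sup>2) (q * ?p) q $ m = of_real q ^ m * qbin (q\<^sup>2) ?p 1 $ m" for m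
    by simp
  have "of_real (grid q K i * grid q K i powr (2 * \<alpha>)) * of_real (W_kernel \<alpha> q (q ^ (n - i))) *
       (even_part f (grid q K i) + of_real (s * q ^ (n - i)) * odd_part f (grid q K i))
    = ?c * (dilate ?p (grid_fps q K (even_part f)) $ i * qbin (q\<^sup>2) ?p 1 $ (n - i)
      + of_real s * (dilate ?p (grid_fps q K (odd_part f)) $ i * qbin (q\<^sup>2) (q * ?p) q $ (n - i)))" for i
    unfolding grid_powr[OF q \<alpha>] W_kernel_power[OF q \<alpha>] w dilate_nth grid_fps_nth
    by (simp only: of_real_mult of_real_power) (simp add: algebra_simps)
  then show ?thesis
    unfolding dual_intertwining_grid_sum[OF assms]
    by (simp add: mult.commute[of "qbin _ _ _"] fps_mult_nth atMost_atLeast0 sum.distrib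
        weyl_const_def sum_distrib_left[symmetric] mult_ac)
qed

lemma dual_intertwining_supported:
  assumes supp: "supported_on q K f"
  shows "supported_on q K (dual_intertwining \<alpha> q f)"
  unfolding supported_on_def
proof (intro conjI allI impI)
  show "dual_intertwining \<alpha> q f t = 0" if "t \<notin> Rq q" for t using that by (simp add: dual_intertwining_def)
  fix t assume t: "\<bar>t\<bar> > q powi (- K)"
  show "dual_intertwining \<alpha> q f t = 0"
  proof (cases "t \<in> Rq q")
    case True
    then show ?thesis
    proof (cases rule: Rq_cases[OF q, where K = K, consumes 1, case_names large grid])
      case (large k)
      show ?thesis
        unfolding dual_intertwining_def jackson_abs_ge_def large(1)
        by (subst jackson_Ici_beyond_support[OF q _ large(3)])
           (use supp in \<open>auto simp: supported_on_def\<close>)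
    next
      case (grid n)
      then show ?thesis using t grid_le[OF q, of K n] by simp
    qed
  qed (simp add: dual_intertwining_def)
qed

text \<open>
  Since \<open>dq\<close> acts on the grid as \<open>lin 1\<close> followed by a dilation, that \<open>dual_intertwining\<close> turns
  \<open>dq g\<close> into \<open>dq\<close> of the Weyl transform of \<open>g\<close> is an instance of \<open>lin_mult_qbin_swap\<close>.
\<close>

lemma dual_intertwining_decomposition:
  assumes f: "f \<in> Dq_space q" and g: "g \<in> Dq_even_space q" and fg: "odd_part f = dq q g"
  shows "dual_intertwining \<alpha> q f = (\<lambda>x. q_Weyl \<alpha> q (even_part f) x + dq q (q_Weyl \<alpha> q g) x)"
proof -
  let ?p = "weyl_base \<alpha> q" and ?R = "q_Weyl \<alpha> q"
  have gD: "g \<in> Dq_space q" and even: "\<And>x. g (- x) = g x" using g by (auto simp: Dq_even_space_def)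
  obtain K where K: "supported_on q K f" "supported_on q K g"
    using Dq_space_supported2[OF q f gD] by blast
  define G where "G = grid_fps q K g"
  note R = q_Weyl_supported[OF q \<alpha> K(2)] q_Weyl_even[OF q \<alpha>, of g]
  have e: "supported_on q K (even_part f)" by (rule supported_on_even_part[OF q K(1)])
  \<comment> \<open>Pulling the dilation by \<open>1 / q\<close> to the front turns the parameters
    \<open>q * ?p\<close> and \<open>q\<close> into \<open>?p * q\<^sup>2\<close> and
    \<open>q\<^sup>2\<close>, to which the \<open>q\<close>-difference equation applies.\<close>
  have "qbin (q\<^sup>2) (q * ?p) q * dilate ?p (dilate (1 / q) (lin 1 * G))
     = dilate (1 / q) (dilate q (qbin (q\<^sup>2) (q * ?p) q) * dilate ?p (lin 1 * G))"
    using q by (simp add: dilate_mult dilate_dilate mult.commute)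
  also have "dilate q (qbin (q\<^sup>2) (q * ?p) q) = qbin (q\<^sup>2) (?p * q\<^sup>2) (1 * q\<^sup>2)"
    by (simp add: qbin_dilate power2_eq_square mult_ac)
  also have "dilate ?p (lin 1 * G) = lin ?p * dilate ?p G"
    by (simp add: dilate_mult dilate_lin)
  also have "qbin (q\<^sup>2) (?p * q\<^sup>2) (1 * q\<^sup>2) * (lin ?p * dilate ?p G)
     = (lin ?p * qbin (q\<^sup>2) (?p * q\<^sup>2) (1 * q\<^sup>2)) * dilate ?p G"
    by (simp only: mult_ac)
  also have "\<dots> = lin 1 * (qbin (q\<^sup>2) ?p 1 * dilate ?p G)"
    by (simp only: lin_mult_qbin_swap[OF q2[OF q], of 1 ?p, symmetric] mult.assoc)
  finally have Z: "qbin (q\<^sup>2) (q * ?p) q * dilate ?p (dilate (1 / q) (lin 1 * G))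
     = dilate (1 / q) (lin 1 * (qbin (q\<^sup>2) ?p 1 * dilate ?p G))" .
  define c where "c = fps_const (complex_of_real (weyl_const \<alpha> q K))"
  define \<kappa> where "\<kappa> = fps_const (complex_of_real (- 1 / ((1 - q) * q powi (- K))))"
  have "c * (qbin (q\<^sup>2) (q * ?p) q * dilate ?p (grid_fps q K (dq q g)))
      = \<kappa> * (c * (qbin (q\<^sup>2) (q * ?p) q * dilate ?p (dilate (1 / q) (lin 1 * G))))"
    unfolding grid_fps_dq_even[OF q K(2) even] G_def[symmetric] \<kappa>_def[symmetric]
    by (simp only: dilate_fps_const_mult \<kappa>_def) (simp only: mult_ac)
  also have "\<dots> = \<kappa> * dilate (1 / q) (c * (lin 1 * (qbin (q\<^sup>2) ?p 1 * dilate ?p G)))"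
    by (simp only: Z c_def dilate_fps_const_mult)
  also have "\<dots> = \<kappa> * dilate (1 / q) (lin 1 * (c * (qbin (q\<^sup>2) ?p 1 * dilate ?p G)))"
    by (simp only: mult.left_commute)
  also have "\<dots> = grid_fps q K (dq q (?R g))"
    unfolding grid_fps_dq_even[OF q R] grid_fps_q_Weyl[OF q \<alpha> K(2)] G_def \<kappa>_def c_def ..
  finally have "fps_const (of_real (weyl_const \<alpha> q K)) * (qbin (q\<^sup>2) (q * ?p) q * dilate ?p (grid_fps q K (dq q g)))
     = grid_fps q K (dq q (?R g))"
    unfolding c_def .
  from arg_cong[OF this, of "\<lambda>U. U $ n" for n]
  have odd: "of_real (weyl_const \<alpha> q K) * (qbin (q\<^sup>2) (q * ?p) q * dilate ?p (grid_fps q K (odd_part f))) $ n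
     = dq q (?R g) (grid q K n)" for n
    by (simp add: fg)
  have eq: "dual_intertwining \<alpha> q f (s * grid q K n)
      = ?R (even_part f) (s * grid q K n) + dq q (?R g) (s * grid q K n)" if s: "s = 1 \<or> s = - 1" for s n
  proof -
    have abs: "\<bar>s * grid q K n\<bar> = grid q K n" using s grid_pos[OF q, of K n] by auto
    \<comment> \<open>The \<open>q\<close>-derivative of an even function is odd, matching the sign
      of the odd term in \<open>dual_intertwining_grid\<close>.\<close>
    have "dq q (?R g) (s * grid q K n) = of_real s * dq q (?R g) (grid q K n)"
      using s dq_even_odd[OF q, of "?R g", OF R(2)] by auto
    then show ?thesis
      unfolding dual_intertwining_grid[OF K(1) s] q_Weyl_grid[OF q \<alpha> e abs] odd[symmetric]
      by (simp add: distrib_left mult.left_commute)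
  qed
  show ?thesis
  proof (rule supported_on_ext[OF q dual_intertwining_supported[OF K(1)]])
    show "supported_on q K (\<lambda>x. ?R (even_part f) x + dq q (?R g) x)"
      by (intro supported_on_add[OF q] q_Weyl_supported[OF q \<alpha> e] supported_on_dq_even[OF q R])
    show "dual_intertwining \<alpha> q f (grid q K n) = ?R (even_part f) (grid q K n) + dq q (?R g) (grid q K n)" for n
      using eq[of 1 n] by simp
    show "dual_intertwining \<alpha> q f (- grid q K n) = ?R (even_part f) (- grid q K n) + dq q (?R g) (- grid q K n)" for n
      using eq[of "- 1" n] by simp
  qed
qed

text \<open>Passing to the finite grid sums avoids summability arguments for
  \<open>infsum\<close>.\<close>

lemma dual_intertwining_add:
  assumes "f \<in> Dq_space q" "g \<in> Dq_space q"
  shows "dual_intertwining \<alpha> q (\<lambda>x. f x + g x) = (\<lambda>x. dual_intertwining \<alpha> q f x + dual_intertwining \<alpha> q g x)"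
proof -
  obtain K where K: "supported_on q K f" "supported_on q K g"
    using Dq_space_supported2[OF q assms] by blast
  note K' = supported_on_add[OF q K]
  have parts: "even_part (\<lambda>x. f x + g x) x = even_part f x + even_part g x"
    "odd_part (\<lambda>x. f x + g x) x = odd_part f x + odd_part g x" for x
    by (simp_all add: even_part_def odd_part_def field_simps)
  have eq: "dual_intertwining \<alpha> q (\<lambda>x. f x + g x) (s * grid q K n)
     = dual_intertwining \<alpha> q f (s * grid q K n) + dual_intertwining \<alpha> q g (s * grid q K n)"
    if s: "s = 1 \<or> s = - 1" for s n
    unfolding dual_intertwining_grid_sum[OF K' s] dual_intertwining_grid_sum[OF K(1) s]
      dual_intertwining_grid_sum[OF K(2) s] parts
    by (simp only: distrib_left sum.distrib add_ac)
  show ?thesis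
  proof (rule supported_on_ext[OF q dual_intertwining_supported[OF K']])
    show "supported_on q K (\<lambda>x. dual_intertwining \<alpha> q f x + dual_intertwining \<alpha> q g x)"
      by (intro supported_on_add[OF q] dual_intertwining_supported K)
  qed (use eq[of 1] eq[of "- 1"] in simp_all)
qed

lemma dual_intertwining_cmult:
  assumes "f \<in> Dq_space q"
  shows "dual_intertwining \<alpha> q (\<lambda>x. c * f x) = (\<lambda>x. c * dual_intertwining \<alpha> q f x)"
proof -
  obtain K where K: "supported_on q K f" using Dq_space_supported[OF q assms] by blast
  note K' = supported_on_cmult[OF q K, of c]
  have parts: "even_part (\<lambda>x. c * f x) x = c * even_part f x"
    "odd_part (\<lambda>x. c * f x) x = c * odd_part f x" for x
    by (simp_all add: even_part_def odd_part_def algebra_simps)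
  have eq: "dual_intertwining \<alpha> q (\<lambda>x. c * f x) (s * grid q K n) = c * dual_intertwining \<alpha> q f (s * grid q K n)"
    if s: "s = 1 \<or> s = - 1" for s n
    unfolding dual_intertwining_grid_sum[OF K' s] dual_intertwining_grid_sum[OF K s] parts
    by (simp only: distrib_left sum_distrib_left mult_ac)
  show ?thesis
  proof (rule supported_on_ext[OF q dual_intertwining_supported[OF K']])
    show "supported_on q K (\<lambda>x. c * dual_intertwining \<alpha> q f x)"
      by (intro supported_on_cmult[OF q] dual_intertwining_supported K)
  qed (use eq[of 1] eq[of "- 1"] in simp_all)
qed

end

theorem theorem9:
  fixes q \<alpha> :: real
  assumes "0 < q" and "q < 1"
    and "\<exists>m::int. ln (1 - q) / ln q = of_int (2 * m)"
    and "\<alpha> > - 1/2"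
  shows "linear_isomorphism_on (Dq_space q) (Dq_space q) (dual_intertwining \<alpha> q) \<and>
    (\<forall>f\<in>Dq_space q. \<forall>x\<in>Rq q.
       inv_into (Dq_space q) (dual_intertwining \<alpha> q) f x =
         inv_into (Dq_even_space q) (q_Weyl \<alpha> q) (even_part f) x +
         dq q (inv_into (Dq_even_space q) (q_Weyl \<alpha> q) (J_op q (odd_part f))) x)"
proof -
  note q = assms(1,2) and \<alpha> = assms(4)
  let ?V = "dual_intertwining \<alpha> q" and ?R = "q_Weyl \<alpha> q"
  let ?D = "Dq_space q" and ?E = "Dq_even_space q"
  define S where "S = inv_into ?E ?R"
  \<comment> \<open>The formula to be proved is the candidate; showing that it is a two-sided
    inverse gives bijectivity and the value of \<open>inv_into\<close> together.\<close>
  define \<Phi> where "\<Phi> f = (\<lambda>x. S (even_part f) x + dq q (S (J_op q (odd_part f))) x)" for f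
  note bij = q_Weyl_bij[OF q \<alpha>]
  have RE: "?R g \<in> ?E" and SE: "S g \<in> ?E" and RS: "?R (S g) = g" and SR: "S (?R g) = g"
    if "g \<in> ?E" for g
    using that bij unfolding S_def
    by (auto intro: q_Weyl_Dq_even[OF q \<alpha>] simp: bij_betw_def inv_into_into f_inv_into_f inv_into_f_f)
  \<comment> \<open>\<open>?V\<close> and \<open>\<Phi>\<close> both return an even function plus
    the \<open>q\<close>-derivative of an even one. Recovering the two summands as parity parts lets
    the formulas compose.\<close>
  have parts: "even_part (\<lambda>x. u x + dq q v x) = u" "odd_part (\<lambda>x. u x + dq q v x) = dq q v"
    if "u \<in> ?E" "v \<in> ?E" for u v
  proof -
    have "u (- x) = u x" "dq q v (- x) = - dq q v x" for x
      using that dq_even_odd[OF q, of v] by (auto simp: Dq_even_space_def)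
    then show "even_part (\<lambda>x. u x + dq q v x) = u" "odd_part (\<lambda>x. u x + dq q v x) = dq q v"
      by (auto simp: even_part_def odd_part_def)
  qed
  have sum_D: "(\<lambda>x. u x + dq q v x) \<in> ?D" if "u \<in> ?E" "v \<in> ?E" for u v
    using that by (intro Dq_space_add[OF q] Dq_space_dq[OF q]) (auto simp: Dq_even_space_def)
  have even_D: "even_part f \<in> ?E" and J_D: "J_op q (odd_part f) \<in> ?E"
    and dq_J: "dq q (J_op q (odd_part f)) = odd_part f" if "f \<in> ?D" for f
    using that even_part_Dq[OF q] J_op_in_Dq_even[OF q odd_part_Dq[OF q] odd_part_odd]
      dq_J_op_Dq[OF q odd_part_Dq[OF q] odd_part_odd] by auto
  have V_eq: "?V f = (\<lambda>x. ?R (even_part f) x + dq q (?R (J_op q (odd_part f))) x)" if "f \<in> ?D" for f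
    by (intro dual_intertwining_decomposition[OF q \<alpha> that J_D] that dq_J[symmetric])
  have V_D: "?V f \<in> ?D" if "f \<in> ?D" for f
    unfolding V_eq[OF that] by (intro sum_D RE even_D J_D that)
  have \<Phi>_D: "\<Phi> f \<in> ?D" if "f \<in> ?D" for f
    unfolding \<Phi>_def by (intro sum_D SE even_D J_D that)
  have \<Phi>V: "\<Phi> (?V f) = f" if f: "f \<in> ?D" for f
  proof -
    note E = RE[OF even_D[OF f]] RE[OF J_D[OF f]]
    \<comment> \<open>On the odd part \<open>J_op\<close> cancels \<open>dq\<close>, then
      \<open>S\<close> cancels \<open>?R\<close>, and \<open>dq_J\<close> restores
      \<open>odd_part f\<close>.\<close>
    show ?thesis
      unfolding \<Phi>_def V_eq[OF f] parts[OF E] J_op_dq[OF q E(2)] SR[OF even_D[OF f]] SR[OF J_D[OF f]] dq_J[OF f]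
      by (simp add: even_odd_sum)
  qed
  have V\<Phi>: "?V (\<Phi> f) = f" if f: "f \<in> ?D" for f
  proof -
    note E = SE[OF even_D[OF f]] SE[OF J_D[OF f]]
    show ?thesis
      unfolding V_eq[OF \<Phi>_D[OF f]] unfolding \<Phi>_def parts[OF E] J_op_dq[OF q E(2)]
        RS[OF even_D[OF f]] RS[OF J_D[OF f]] dq_J[OF f]
      by (simp add: even_odd_sum)
  qed
  have bij_V: "bij_betw ?V ?D ?D"
    by (rule bij_betw_byWitness[where f' = \<Phi>]) (auto simp: \<Phi>V V\<Phi> V_D \<Phi>_D)
  have "inv_into ?D ?V f = \<Phi> f" if "f \<in> ?D" for f
    using bij_V that by (intro inv_into_f_eq) (auto simp: bij_betw_def V\<Phi> \<Phi>_D)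
  moreover have "complex_function_subspace ?D"
    unfolding complex_function_subspace_def
    by (intro conjI ballI allI Dq_space_0[OF q] Dq_space_add[OF q] Dq_space_cmult[OF q])
  ultimately show ?thesis
    unfolding linear_isomorphism_on_def \<Phi>_def S_def
    using bij_V dual_intertwining_add[OF q \<alpha>] dual_intertwining_cmult[OF q \<alpha>] by simp
qed

end
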